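(* Let $b,c$ be real constants with $b\ne0$ and $c>0$, let $u_0\in L^1(\mathbf R)$, put $m=\int_{-\infty}^{+\infty}u_0(x)\,dx$, and let $u(\cdot,t)$ be the solution of the Burgers equation $u_t+b\,u\,u_x=c\,u_{xx}$ ($x\in\mathbf R$, $t>0$) with $u(x,0)=u_0(x)$. Let $\mathcal F\in L^1(\mathbf R)\cap L^\infty(\mathbf R)$ be the function $$\mathcal F(x)=\frac{e^{-x^2}}{\mu-h\,\mathrm{erf}(x)},\qquad \mu=\frac{1+e^{-\frac{bm}{2c}}}{2},\qquad h=\left|1-e^{-\frac{bm}{2c}}\right|,$$ where $\mathrm{erf}(x)=\frac1{\sqrt\pi}\int_0^x e^{-\xi^2}\,d\xi$. Then: (i) $\displaystyle \lim_{t\to\infty}\|u(\cdot,t)\|_1=|m|$; (ii) for every $1\le p<\infty$, $$\lim_{t\to\infty}t^{\frac12\left(1-\frac1p\right)}\|u(\cdot,t)\|_p=\frac{|m|}{\sqrt{4\pi c}}\,(4c)^{\frac1{2p}}\left|\frac{2c}{bm}\left(1-e^{-\frac{bm}{2c}}\right)\right|\,\|\mathcal F\|_p ;$$ (iii) $$\lim_{t\to\infty}t^{\frac12}\|u(\cdot,t)\|_\infty=\frac{|m|}{\sqrt{4\pi c}}\left|\frac{2c}{bm}\left(1-e^{-\frac{bm}{2c}}\right)\right|\,\|\mathcal F\|_\infty .$$ When $m=0$, the expression $\frac{2c}{bm}\left(1-e^{-\frac{bm}{2c}}\right)$ is read as its limiting value $1$ (so the right-hand sides of (ii) and (iii) are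 $0$).
   Context: Functions are real-valued. For fixed $t$, $\|u(\cdot,t)\|_p$ denotes the $L^p(\mathbf R)$ norm of $x\mapsto u(x,t)$: $\left(\int_{-\infty}^{+\infty}|u(x,t)|^p\,dx\right)^{1/p}$ if $1\le p<\infty$, and $\sup_{x\in\mathbf R}|u(x,t)|$ if $p=\infty$; the same notation is used for $\|\mathcal F\|_p$. Note the normalization of $\mathrm{erf}$: the prefactor is $1/\sqrt\pi$, not $2/\sqrt\pi$. The initial condition is meant in the sense that $\|u(\cdot,t)-u_0\|_1\to0$ as $t\to0$, $t>0$. The solution is given (Hopf-Cole transformation), for $t>0$, by $$u(x,t)=\frac1{\sqrt{4\pi ct}}\,\frac1{\varphi(x,t)}\int_{-\infty}^{+\infty}e^{-\frac{(x-y)^2}{4ct}}\,\varphi_0(y)\,u_0(y)\,dy,\qquad \varphi(x,t)=\frac1{\sqrt{4\pi ct}}\int_{-\infty}^{+\infty}e^{-\frac{(x-y)^2}{4ct}}\,\varphi_0(y)\,dy,$$ with $\varphi_0(x)=\exp\left(-\frac{b}{2c}\int_{-\infty}^x u_0(\xi)\,d\xi\right)$. *)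

theory Defs
  imports "HOL-Analysis.Analysis"
begin

text \<open>
  Norms on the Lebesgue space of the real line, with values in the extended nonnegative reals, so
  that a function outside the space has norm \<^term>\<open>\<infinity>\<close> (the Bochner integral would give 0).
  The supremum norm is the pointwise supremum, not the essential one.
\<close>

definition Lp_norm :: "real \<Rightarrow> (real \<Rightarrow> real) \<Rightarrow> ennreal" where
  "Lp_norm p f =
     (let I = (\<integral>\<^sup>+x. ennreal (\<bar>f x\<bar> powr p) \<partial>lebesgue)
      in if I = \<infinity> then \<infinity> else ennreal (enn2real I powr (1 / p)))"

definition Linf_norm :: "(real \<Rightarrow> real) \<Rightarrow> ennreal" where
  "Linf_norm f = (SUP x. ennreal \<bar>f x\<bar>)"

definition burgers_equation :: "real \<Rightarrow> real \<Rightarrow> (real \<Rightarrow> real \<Rightarrow> real) \<Rightarrow> bool" where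
  "burgers_equation b c u \<longleftrightarrow>
     (\<exists>ut ux uxx. \<forall>x. \<forall>t>0.
        ((\<lambda>s. u x s) has_real_derivative ut x t) (at t) \<and>
        ((\<lambda>y. u y t) has_real_derivative ux x t) (at x) \<and>
        ((\<lambda>y. ux y t) has_real_derivative uxx x t) (at x) \<and>
        ut x t + b * u x t * ux x t = c * uxx x t)"

definition initial_value_L1 :: "(real \<Rightarrow> real) \<Rightarrow> (real \<Rightarrow> real \<Rightarrow> real) \<Rightarrow> bool" where
  "initial_value_L1 u0 u \<longleftrightarrow> ((\<lambda>t. Lp_norm 1 (\<lambda>x. u x t - u0 x)) \<longlongrightarrow> 0) (at_right 0)"

text \<open>
  The Hopf-Cole representation of the solution with initial value \<open>u0\<close>; it is meaningful for
  \<open>t > 0\<close> only.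
\<close>

definition heat_conv :: "real \<Rightarrow> (real \<Rightarrow> real) \<Rightarrow> real \<Rightarrow> real \<Rightarrow> real" where
  "heat_conv c g x t =
     1 / sqrt (4 * pi * c * t) * (LINT y|lebesgue. exp (- ((x - y)\<^sup>2 / (4 * c * t))) * g y)"

definition phi0 :: "real \<Rightarrow> real \<Rightarrow> (real \<Rightarrow> real) \<Rightarrow> real \<Rightarrow> real" where
  "phi0 b c u0 x = exp (- (b / (2 * c)) * (LINT \<xi>:{..x}|lebesgue. u0 \<xi>))"

definition hopf_cole :: "real \<Rightarrow> real \<Rightarrow> (real \<Rightarrow> real) \<Rightarrow> real \<Rightarrow> real \<Rightarrow> real" where
  "hopf_cole b c u0 x t =
     heat_conv c (\<lambda>y. phi0 b c u0 y * u0 y) x t / heat_conv c (phi0 b c u0) x t"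

text \<open>
  The prefactor is \<open>1 / sqrt pi\<close>, half of the customary one, so the values lie in \<open>(-1/2, 1/2)\<close>.
  The interval integral is signed, as needed for negative arguments.
\<close>

definition erf :: "real \<Rightarrow> real" where
  "erf x = 1 / sqrt pi * (LBINT \<xi>=0..x. exp (- \<xi>\<^sup>2))"

definition burgers_profile :: "real \<Rightarrow> real \<Rightarrow> real \<Rightarrow> real \<Rightarrow> real" where
  "burgers_profile b c m x =
     (let \<mu> = (1 + exp (- (b * m / (2 * c)))) / 2;
          h = \<bar>1 - exp (- (b * m / (2 * c)))\<bar>
      in exp (- x\<^sup>2) / (\<mu> - h * erf x))"

definition mass_factor :: "real \<Rightarrow> real \<Rightarrow> real \<Rightarrow> real" where
  "mass_factor b c m =
     (if m = 0 then 1 else 2 * c / (b * m) * (1 - exp (- (b * m / (2 * c)))))"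

end

theory Submission
  imports Defs "HOL-Probability.Distributions"
begin

text \<open>
  The Hopf-Cole transformation writes the solution as \<open>u = \<psi> / \<phi>\<close>, where \<open>\<phi>\<close> and \<open>\<psi>\<close> solve the heat
  equation with initial values \<open>\<phi>0\<close> and \<open>w = \<phi>0 * u0\<close>. Since \<open>\<phi>0 = exp (k * U)\<close> for the primitive \<open>U\<close> of
  \<open>u0\<close> and \<open>k = - b / (2 * c)\<close>, one has \<open>\<phi>0 = 1 + k * (primitive of w)\<close>, hence \<open>\<phi>\<^sub>x = k * \<psi>\<close>; the Burgers
  equation is then a computation with quotients. As \<open>u0\<close> is merely integrable, the formula for \<open>\<phi>0\<close>
  is a chain rule for an absolutely continuous function (\<open>exp_primitive\<close>), and \<open>\<phi>\<^sub>x = k * \<psi>\<close> an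
  integration by parts carried out with Fubini's theorem (\<open>gauss_moment_primitive\<close>). The initial value
  is attained in mean because Gaussian averages of small width converge in mean, a consequence of
  the continuity of translations in mean (\<open>L1_translation_continuous\<close>).

  For large \<open>t\<close> put \<open>s = sqrt (4 * c * t)\<close> and \<open>x = s * \<xi>\<close>. In these variables \<open>w\<close> contracts to a point mass of
  size \<open>M\<close>, the integral of \<open>w\<close>, and \<open>\<phi>0\<close> to the step function with values \<open>1\<close> and \<open>E = exp (k * m)\<close>. So
  \<open>s * u\<close> tends to \<open>M / sqrt pi * exp (- \<xi>\<^sup>2) / D \<xi>\<close>, where \<open>D\<close>, the Gaussian average of the step function,
  equals \<open>(1 + E) / 2 - (1 - E) * erf \<xi>\<close>: this is \<open>M / sqrt pi\<close> times the profile or its reflection. The convergence holds both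
  in mean and uniformly (\<open>G_tendsto\<close>). Convergence in mean of a uniformly bounded family gives
  convergence of all \<open>p\<close>-norms with \<open>1 \<le> p < \<infinity>\<close>, uniform convergence that of the supremum norm, and
  the powers of \<open>t\<close> in the theorem come from the change of variables. The constants agree because
  \<open>E = 1 + k * M\<close>, that is, \<open>M\<close> is \<open>m\<close> times the mass factor. For \<open>p = 1\<close> the limit is evaluated by noting that
  the profile is, up to a factor, the derivative of \<open>ln D\<close>.
\<close>

section \<open>Lebesgue integrals on the real line\<close>

lemma integrable_translate:
  fixes f :: "real \<Rightarrow> real"
  assumes "integrable lborel f"
  shows "integrable lborel (\<lambda>x. f (x - a))"
  using lborel_integrable_real_affine[OF assms, of 1 "- a"] by simp

lemma integral_translate:
  fixes f :: "real \<Rightarrow> real"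
  shows "(LINT x|lborel. f (x - a)) = (LINT x|lborel. f x)"
  using lborel_integral_real_affine[of 1 f "- a"] by simp

lemma integral_reflect_translate:
  fixes f :: "real \<Rightarrow> real"
  shows "(LINT x|lborel. f (a - x)) = (LINT x|lborel. f x)"
  using lborel_integral_real_affine[of "-1" f a] by simp

lemma integral_dominated_convergence_within:
  fixes s :: "real \<Rightarrow> 'a \<Rightarrow> real" and f w :: "'a \<Rightarrow> real"
  assumes [measurable]: "f \<in> borel_measurable M" "\<And>t. s t \<in> borel_measurable M"
    and "integrable M w"
    and lim: "\<And>x. ((\<lambda>t. s t x) \<longlongrightarrow> f x) (at a within S)"
    and bound: "\<And>t x. t \<in> S \<Longrightarrow> t \<noteq> a \<Longrightarrow> \<bar>s t x\<bar> \<le> w x"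
  shows "((\<lambda>t. integral\<^sup>L M (s t)) \<longlongrightarrow> integral\<^sup>L M f) (at a within S)"
  unfolding tendsto_at_iff_sequentially comp_def
proof (intro allI impI)
  fix X :: "nat \<Rightarrow> real"
  assume X: "\<forall>i. X i \<in> S - {a}" "X \<longlonglongrightarrow> a"
  show "(\<lambda>n. integral\<^sup>L M (s (X n))) \<longlonglongrightarrow> integral\<^sup>L M f"
  proof (rule integral_dominated_convergence[where w = w])
    show "AE x in M. (\<lambda>i. s (X i) x) \<longlonglongrightarrow> f x"
      using lim X unfolding tendsto_at_iff_sequentially comp_def by auto
    show "AE x in M. norm (s (X i) x) \<le> w x" for i
      using bound X by auto
  qed (use assms in auto)
qed

text \<open>
  Continuity of translation passes to limits in mean: the integral is invariant under translation, so
  approximating \<open>f\<close> by \<open>g\<close> costs the same amount before and after the shift.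
\<close>

lemma L1_translation_approx:
  fixes f :: "real \<Rightarrow> real"
  assumes f: "integrable lborel f"
    and approx: "\<And>e. e > 0 \<Longrightarrow> \<exists>g. integrable lborel g \<and> (LINT x|lborel. \<bar>f x - g x\<bar>) \<le> e \<and>
           ((\<lambda>a. LINT x|lborel. \<bar>g (x - a) - g x\<bar>) \<longlongrightarrow> 0) (at 0)"
  shows "((\<lambda>a. LINT x|lborel. \<bar>f (x - a) - f x\<bar>) \<longlongrightarrow> 0) (at 0)"
proof (rule tendstoI)
  fix e :: real assume e: "e > 0"
  then obtain g where g: "integrable lborel g" "(LINT x|lborel. \<bar>f x - g x\<bar>) \<le> e / 4"
    "((\<lambda>a. LINT x|lborel. \<bar>g (x - a) - g x\<bar>) \<longlongrightarrow> 0) (at 0)"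
    using approx[of "e / 4"] by auto
  have bd: "(LINT x|lborel. \<bar>f (x - a) - f x\<bar>) \<le> e / 2 + (LINT x|lborel. \<bar>g (x - a) - g x\<bar>)" for a
  proof -
    have i: "integrable lborel (\<lambda>x. \<bar>f x - g x\<bar>)"
      using f g by auto
    note i' = integrable_translate[OF i, of a]
    have i'': "integrable lborel (\<lambda>x. \<bar>g (x - a) - g x\<bar>)"
      using g(1) integrable_translate[OF g(1), of a] by auto
    have "(LINT x|lborel. \<bar>f (x - a) - f x\<bar>)
        \<le> (LINT x|lborel. \<bar>f (x - a) - g (x - a)\<bar> + \<bar>g (x - a) - g x\<bar> + \<bar>f x - g x\<bar>)"
      using f integrable_translate[OF f, of a] i i' i''
      by (intro integral_mono) auto
    also have "\<dots> = (LINT x|lborel. \<bar>f (x - a) - g (x - a)\<bar>) + (LINT x|lborel. \<bar>g (x - a) - g x\<bar>)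
        + (LINT x|lborel. \<bar>f x - g x\<bar>)"
      using i i' i'' by simp
    also have "(LINT x|lborel. \<bar>f (x - a) - g (x - a)\<bar>) = (LINT x|lborel. \<bar>f x - g x\<bar>)"
      by (rule integral_translate)
    finally show ?thesis
      using g(2) by simp
  qed
  have "\<forall>\<^sub>F a in at 0. dist (LINT x|lborel. \<bar>g (x - a) - g x\<bar>) 0 < e / 2"
    using tendstoD[OF g(3), of "e / 2"] e by simp
  then show "\<forall>\<^sub>F a in at 0. dist (LINT x|lborel. \<bar>f (x - a) - f x\<bar>) 0 < e"
  proof eventually_elim
    case (elim a)
    then show ?case using bd[of a] by (simp add: abs_of_nonneg)
  qed
qed

text \<open>
  The indicator of an open set is lower semicontinuous, so the positive part of
  \<open>indicator U x - indicator U (x - a)\<close> tends to \<open>0\<close> at every point; since the difference has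
  integral \<open>0\<close>, its negative part has the same integral.
\<close>

lemma L1_translation_open:
  fixes U :: "real set"
  assumes U: "open U" "emeasure lborel U < \<infinity>"
  shows "((\<lambda>a. LINT x|lborel. \<bar>indicator U (x - a) - indicat_real U x\<bar>) \<longlongrightarrow> 0) (at 0)"
proof -
  define I where "I = indicat_real U"
  have [measurable]: "I \<in> borel_measurable borel" "U \<in> sets borel"
    using U by (auto simp: I_def)
  have I: "integrable lborel I"
    unfolding I_def using U by (intro integrable_real_indicator) auto
  have pos: "((\<lambda>a. LINT x|lborel. max 0 (I x - I (x - a))) \<longlongrightarrow> (LINT x::real|lborel. 0)) (at 0)"
  proof (rule integral_dominated_convergence_within[where w = I])
    fix x :: real
    show "((\<lambda>a. max 0 (I x - I (x - a))) \<longlongrightarrow> 0) (at 0)"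
    proof (cases "x \<in> U")
      case True
      have "((\<lambda>a. x - a) \<longlongrightarrow> x - 0) (at 0)"
        by (intro tendsto_intros)
      then have "\<forall>\<^sub>F a in at 0. x - a \<in> U"
        using U(1) True by (auto dest: topological_tendstoD)
      then have "\<forall>\<^sub>F a in at 0. max 0 (I x - I (x - a)) = 0"
        by eventually_elim (use True in \<open>simp add: I_def\<close>)
      then show ?thesis
        by (rule tendsto_eventually)
    qed (auto simp: I_def indicator_def)
    show "\<bar>max 0 (I x - I (x - t))\<bar> \<le> I x" for t
      by (auto simp: I_def indicator_def)
  qed (use I in auto)
  have "(LINT x|lborel. \<bar>I (x - a) - I x\<bar>) = 2 * (LINT x|lborel. max 0 (I x - I (x - a)))" for a
  proof -
    note I' = integrable_translate[OF I, of a]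
    have m: "integrable lborel (\<lambda>x. max 0 (I x - I (x - a)))"
      using I I' by auto
    have "(LINT x|lborel. \<bar>I (x - a) - I x\<bar>)
        = (LINT x|lborel. 2 * max 0 (I x - I (x - a)) + (I (x - a) - I x))"
      by (intro Bochner_Integration.integral_cong) (auto simp: max_def)
    also have "\<dots> = 2 * (LINT x|lborel. max 0 (I x - I (x - a)))
        + ((LINT x|lborel. I (x - a)) - (LINT x|lborel. I x))"
      using m I I' by simp
    finally show ?thesis
      using integral_translate[of I a] by simp
  qed
  then show ?thesis
    using tendsto_mult_left[OF pos, of 2] unfolding I_def by simp
qed

lemma L1_translation_continuous:
  fixes f :: "real \<Rightarrow> real"
  assumes "integrable lborel f"
  shows "((\<lambda>a. LINT x|lborel. \<bar>f (x - a) - f x\<bar>) \<longlongrightarrow> 0) (at 0)"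
  using assms
proof (induction rule: integrable_induct)
  case (base A c)
  then have [measurable]: "A \<in> sets borel" by simp
  have iA: "integrable lborel (indicat_real A)"
    using base by (intro integrable_real_indicator) auto
  have "((\<lambda>a. LINT x|lborel. \<bar>indicator A (x - a) - indicat_real A x\<bar>) \<longlongrightarrow> 0) (at 0)"
  proof (rule L1_translation_approx[OF iA])
    fix e :: real assume e: "e > 0"
    obtain U where U: "open U" "A \<subseteq> U" "U - A \<in> lmeasurable" "emeasure lebesgue (U - A) < ennreal e"
      using sets_lebesgue_outer_open[of A e] e by auto
    then have [measurable]: "U \<in> sets borel" by simp
    have UA: "emeasure lborel (U - A) < ennreal e"
      using U by simp
    have "emeasure lborel U = emeasure lborel A + emeasure lborel (U - A)"
      using U(2) by (subst plus_emeasure) (auto intro!: arg_cong[where f = "emeasure lborel"])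
    also have "\<dots> < \<infinity>"
      using base(2) UA by (auto simp: top_unique less_top[symmetric])
    finally have fin: "emeasure lborel U < \<infinity>" .
    have "(LINT x|lborel. \<bar>indicator A x - indicat_real U x\<bar>) = (LINT x|lborel. indicat_real (U - A) x)"
      using U(2) by (intro Bochner_Integration.integral_cong) (auto simp: indicator_def)
    also have "\<dots> \<le> e"
      using UA e by (simp add: measure_def enn2real_leI)
    finally show "\<exists>g. integrable lborel g \<and> (LINT x|lborel. \<bar>indicator A x - g x\<bar>) \<le> e \<and>
        ((\<lambda>a. LINT x|lborel. \<bar>g (x - a) - g x\<bar>) \<longlongrightarrow> 0) (at 0)"
      using L1_translation_open[OF U(1) fin] fin
      by (intro exI[of _ "indicat_real U"]) auto
  qed
  from tendsto_mult_left[OF this, of "\<bar>c\<bar>"]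
  show ?case
    by (simp flip: right_diff_distrib add: abs_mult mult.commute)
next
  case (add f g)
  have "((\<lambda>a. (LINT x|lborel. \<bar>f (x - a) - f x\<bar>) + (LINT x|lborel. \<bar>g (x - a) - g x\<bar>)) \<longlongrightarrow> 0) (at 0)"
    using tendsto_add[OF add.IH] by simp
  then show ?case
  proof (rule tendsto_sandwich[rotated 3])
    show "\<forall>\<^sub>F a in at 0. (LINT x|lborel. \<bar>f (x - a) + g (x - a) - (f x + g x)\<bar>)
        \<le> (LINT x|lborel. \<bar>f (x - a) - f x\<bar>) + (LINT x|lborel. \<bar>g (x - a) - g x\<bar>)"
    proof (intro always_eventually allI)
      fix a
      note i = integrable_translate[OF add(1), of a] integrable_translate[OF add(2), of a]
      have "(LINT x|lborel. \<bar>f (x - a) + g (x - a) - (f x + g x)\<bar>)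
        \<le> (LINT x|lborel. \<bar>f (x - a) - f x\<bar> + \<bar>g (x - a) - g x\<bar>)"
        using add(1,2) i by (intro integral_mono) auto
      also have "\<dots> = (LINT x|lborel. \<bar>f (x - a) - f x\<bar>) + (LINT x|lborel. \<bar>g (x - a) - g x\<bar>)"
        using add(1,2) i by (intro Bochner_Integration.integral_add) auto
      finally show "(LINT x|lborel. \<bar>f (x - a) + g (x - a) - (f x + g x)\<bar>)
        \<le> (LINT x|lborel. \<bar>f (x - a) - f x\<bar>) + (LINT x|lborel. \<bar>g (x - a) - g x\<bar>)" .
    qed
  qed auto
next
  case (lim f s)
  have lim0: "(\<lambda>i. LINT x|lborel. \<bar>f x - s i x\<bar>) \<longlonglongrightarrow> (LINT x::real|lborel. 0)"
  proof (rule integral_dominated_convergence[where w = "\<lambda>x. 3 * \<bar>f x\<bar>"])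
    have "(\<lambda>i. \<bar>f x - s i x\<bar>) \<longlonglongrightarrow> 0" for x
      using tendsto_rabs[OF tendsto_diff[OF tendsto_const[of "f x"] lim(2)[of x]]] by simp
    then show "AE x in lborel. (\<lambda>i. \<bar>f x - s i x\<bar>) \<longlonglongrightarrow> 0" by simp
    show "AE x in lborel. norm \<bar>f x - s i x\<bar> \<le> 3 * \<bar>f x\<bar>" for i
      using lim(3)[of _ i] by (intro AE_I2) (smt (verit) real_norm_def space_lborel UNIV_I)
  qed (use lim in auto)
  show ?case
  proof (rule L1_translation_approx)
    fix e :: real assume "e > 0"
    then have "\<forall>\<^sub>F i in sequentially. (LINT x|lborel. \<bar>f x - s i x\<bar>) < e"
      using order_tendstoD(2)[OF lim0] by simp
    then obtain i where "(LINT x|lborel. \<bar>f x - s i x\<bar>) < e"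
      by (auto dest: eventually_happens)
    then show "\<exists>g. integrable lborel g \<and> (LINT x|lborel. \<bar>f x - g x\<bar>) \<le> e \<and>
        ((\<lambda>a. LINT x|lborel. \<bar>g (x - a) - g x\<bar>) \<longlongrightarrow> 0) (at 0)"
      using lim by (intro exI[of _ "s i"]) auto
  qed (use lim in auto)
qed

section \<open>Moments of a function against Gaussian kernels\<close>

text \<open>
  The difference quotients are bounded by \<open>B\<close> through the mean value theorem, so dominated
  convergence applies to them.
\<close>

lemma has_real_derivative_integral:
  fixes f f' :: "real \<Rightarrow> 'a \<Rightarrow> real" and B :: "'a \<Rightarrow> real"
  assumes S: "open S" "convex S" "x \<in> S"
    and f: "\<And>t. t \<in> S \<Longrightarrow> integrable M (f t)"
    and f': "f' x \<in> borel_measurable M"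
    and deriv: "\<And>t y. t \<in> S \<Longrightarrow> ((\<lambda>s. f s y) has_real_derivative f' t y) (at t)"
    and bound: "\<And>t y. t \<in> S \<Longrightarrow> \<bar>f' t y\<bar> \<le> B y"
    and B: "integrable M B"
  shows "((\<lambda>t. integral\<^sup>L M (f t)) has_real_derivative integral\<^sup>L M (f' x)) (at x)"
proof -
  define q where "q t y = (if t \<in> S then (f t y - f x y) / (t - x) else 0)" for t y
  have [measurable]: "q t \<in> borel_measurable M" for t
    using f[of t] f[OF S(3)] unfolding q_def by (cases "t \<in> S") auto
  have "((\<lambda>t. integral\<^sup>L M (q t)) \<longlongrightarrow> integral\<^sup>L M (f' x)) (at x within S)"
  proof (rule integral_dominated_convergence_within[OF f' _ B])
    fix y
    have "((\<lambda>t. (f t y - f x y) / (t - x)) \<longlongrightarrow> f' x y) (at x within S)"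
      using deriv[OF S(3)] by (simp add: has_field_derivative_iff at_within_open[OF S(3,1)])
    moreover have "\<forall>\<^sub>F t in at x within S. (f t y - f x y) / (t - x) = q t y"
      by (auto simp: eventually_at_filter q_def)
    ultimately show "((\<lambda>t. q t y) \<longlongrightarrow> f' x y) (at x within S)"
      by (rule Lim_transform_eventually)
  next
    fix t y assume t: "t \<in> S" "t \<noteq> x"
    have "norm (f t y - f x y) \<le> B y * norm (t - x)"
      using S t bound
      by (intro field_differentiable_bound[OF S(2), of "\<lambda>s. f s y" "\<lambda>s. f' s y"])
         (auto intro: has_field_derivative_at_within deriv)
    then show "\<bar>q t y\<bar> \<le> B y"
      using t by (simp add: q_def field_simps)
  qed auto
  then have "((\<lambda>t. integral\<^sup>L M (q t)) \<longlongrightarrow> integral\<^sup>L M (f' x)) (at x)"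
    by (simp add: at_within_open[OF S(3,1)])
  moreover have "\<forall>\<^sub>F t in at x. integral\<^sup>L M (q t) = (integral\<^sup>L M (f t) - integral\<^sup>L M (f x)) / (t - x)"
    using eventually_at_in_open'[OF S(1,3)]
  proof eventually_elim
    case (elim t)
    then have "q t = (\<lambda>y. (f t y - f x y) / (t - x))"
      by (simp add: q_def fun_eq_iff)
    then show ?case
      using f[OF elim] f[OF S(3)] by simp
  qed
  ultimately show ?thesis
    unfolding has_field_derivative_iff by (rule Lim_transform_eventually)
qed

text \<open>A class of initial values for the heat equation that contains the bounded and the integrable ones.\<close>

definition gaussian_integrable :: "(real \<Rightarrow> real) \<Rightarrow> bool" where
  "gaussian_integrable g \<longleftrightarrow> g \<in> borel_measurable borel \<and>
     (\<forall>\<alpha>>0. integrable lborel (\<lambda>y. exp (- (\<alpha> * y\<^sup>2)) * g y))"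

text \<open>
  Up to a factor depending on \<open>a = 1 / (4 * c * t)\<close> alone, the moment of order \<open>0\<close> is the solution of the heat
  equation. Derivatives of moments are combinations of moments, so the order is kept as a parameter.
\<close>

definition gauss_moment :: "(real \<Rightarrow> real) \<Rightarrow> nat \<Rightarrow> real \<Rightarrow> real \<Rightarrow> real" where
  "gauss_moment g n a x = (LINT y|lborel. (x - y) ^ n * exp (- (a * (x - y)\<^sup>2)) * g y)"

lemma gaussian_integrableD:
  assumes "gaussian_integrable g" "\<alpha> > 0"
  shows "integrable lborel (\<lambda>y. exp (- (\<alpha> * y\<^sup>2)) * g y)"
  using assms by (simp add: gaussian_integrable_def)

text \<open>
  Half of the exponent absorbs the power, by comparison with one term of the exponential series.
\<close>

lemma power_mult_gauss_le:
  fixes a q :: real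
  assumes "a > 0"
  shows "\<bar>q\<bar> ^ n * exp (- (a * q\<^sup>2)) \<le> (1 + fact n * (2 / a) ^ n) * exp (- (a / 2 * q\<^sup>2))"
proof -
  define z where "z = a / 2 * q\<^sup>2"
  have z: "z \<ge> 0"
    using assms by (simp add: z_def)
  have sm: "summable (\<lambda>k. z ^ k /\<^sub>R fact k)"
    by (rule summable_exp_generic)
  have "(\<Sum>k\<in>{n}. z ^ k /\<^sub>R fact k) \<le> exp z"
    unfolding exp_def using z by (intro sum_le_suminf[OF sm]) auto
  then have zn: "z ^ n \<le> fact n * exp z"
    by (simp add: field_simps)
  have "\<bar>q\<bar> ^ n \<le> 1 + (q\<^sup>2) ^ n"
  proof (cases "\<bar>q\<bar> \<le> 1")
    case True
    then have "\<bar>q\<bar> ^ n \<le> 1"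
      by (simp add: power_le_one)
    also have "1 \<le> 1 + (q\<^sup>2) ^ n" by simp
    finally show ?thesis .
  next
    case False
    then have "\<bar>q\<bar> ^ n \<le> \<bar>q\<bar> ^ (2 * n)"
      by (intro power_increasing) auto
    also have "\<dots> = (q\<^sup>2) ^ n"
      by (simp add: power_mult)
    finally show ?thesis by simp
  qed
  also have "(q\<^sup>2) ^ n = (2 / a) ^ n * z ^ n"
    using assms by (simp add: z_def power_mult_distrib[symmetric])
  also have "1 + (2 / a) ^ n * z ^ n \<le> exp z + (2 / a) ^ n * (fact n * exp z)"
    using zn z assms by (intro add_mono mult_left_mono) auto
  also have "\<dots> = (1 + fact n * (2 / a) ^ n) * exp z"
    by (simp add: algebra_simps)
  finally have "\<bar>q\<bar> ^ n * exp (- (a * q\<^sup>2)) \<le> (1 + fact n * (2 / a) ^ n) * exp z * exp (- (a * q\<^sup>2))"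
    by (intro mult_right_mono) auto
  also have "\<dots> = (1 + fact n * (2 / a) ^ n) * exp (z - a * q\<^sup>2)"
    by (simp add: exp_diff exp_minus field_simps)
  also have "z - a * q\<^sup>2 = - (a / 2 * q\<^sup>2)"
    by (simp add: z_def)
  finally show ?thesis .
qed

text \<open>One Gaussian dominates the kernels locally uniformly in \<open>x\<close> and \<open>a\<close>.\<close>

lemma gauss_kernel_le:
  fixes a a0 x y R :: real
  assumes a: "0 < a0" "a0 \<le> a" and x: "\<bar>x\<bar> \<le> R"
  shows "\<bar>(x - y) ^ n * exp (- (a * (x - y)\<^sup>2))\<bar>
      \<le> (1 + fact n * (2 / a0) ^ n) * exp (a0 / 2 * R\<^sup>2) * exp (- (a0 / 4 * y\<^sup>2))"
proof -
  have "\<bar>(x - y) ^ n * exp (- (a * (x - y)\<^sup>2))\<bar> \<le> \<bar>x - y\<bar> ^ n * exp (- (a0 * (x - y)\<^sup>2))"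
    using a by (auto simp: abs_mult power_abs intro!: mult_left_mono mult_right_mono)
  also have "\<dots> \<le> (1 + fact n * (2 / a0) ^ n) * exp (- (a0 / 2 * (x - y)\<^sup>2))"
    by (rule power_mult_gauss_le[OF a(1)])
  also have "exp (- (a0 / 2 * (x - y)\<^sup>2)) \<le> exp (a0 / 2 * R\<^sup>2) * exp (- (a0 / 4 * y\<^sup>2))"
  proof -
    have "x\<^sup>2 \<le> R\<^sup>2"
      using x by (metis abs_ge_zero power2_abs power_mono)
    moreover have "0 \<le> (2 * x - y)\<^sup>2" by simp
    then have "y\<^sup>2 \<le> 2 * (x - y)\<^sup>2 + 2 * x\<^sup>2"
      by (simp add: power2_eq_square algebra_simps)
    ultimately have "y\<^sup>2 \<le> 2 * (x - y)\<^sup>2 + 2 * R\<^sup>2" by simp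
    then have "a0 / 4 * y\<^sup>2 \<le> a0 / 4 * (2 * (x - y)\<^sup>2 + 2 * R\<^sup>2)"
      using a by (intro mult_left_mono) auto
    then show ?thesis
      by (simp add: exp_add[symmetric] algebra_simps)
  qed
  finally show ?thesis
    using a by (simp add: mult.assoc mult_left_mono)
qed

lemma integrable_gauss_moment:
  assumes g: "gaussian_integrable g" and a: "a > 0"
  shows "integrable lborel (\<lambda>y. (x - y) ^ n * exp (- (a * (x - y)\<^sup>2)) * g y)"
proof -
  have [measurable]: "g \<in> borel_measurable borel"
    using g by (simp add: gaussian_integrable_def)
  let ?K = "(1 + fact n * (2 / a) ^ n) * exp (a / 2 * \<bar>x\<bar>\<^sup>2)"
  show ?thesis
  proof (rule Bochner_Integration.integrable_bound)
    show "integrable lborel (\<lambda>y. ?K * (exp (- (a / 4 * y\<^sup>2)) * g y))"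
      using a by (intro integrable_mult_right gaussian_integrableD[OF g]) simp
    have "\<bar>(x - y) ^ n * exp (- (a * (x - y)\<^sup>2)) * g y\<bar> \<le> \<bar>?K * (exp (- (a / 4 * y\<^sup>2)) * g y)\<bar>" for y
      using mult_right_mono[OF gauss_kernel_le[of a a x "\<bar>x\<bar>" y n], of "\<bar>g y\<bar>"] a
      by (simp add: abs_mult mult.assoc add_nonneg_nonneg abs_of_nonneg)
    then show "AE y in lborel. norm ((x - y) ^ n * exp (- (a * (x - y)\<^sup>2)) * g y)
        \<le> norm (?K * (exp (- (a / 4 * y\<^sup>2)) * g y))"
      by simp
  qed auto
qed

lemma gauss_moment_deriv_x:
  assumes g: "gaussian_integrable g" and a: "a > 0"
  shows "((\<lambda>x. gauss_moment g n a x) has_real_derivative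
      real n * gauss_moment g (n - 1) a x - 2 * a * gauss_moment g (Suc n) a x) (at x)"
proof -
  have [measurable]: "g \<in> borel_measurable borel"
    using g by (simp add: gaussian_integrable_def)
  define K where "K k = (1 + fact k * (2 / a) ^ k) * exp (a / 2 * (\<bar>x\<bar> + 1)\<^sup>2)" for k
  define f' where "f' t y = (real n * ((t - y) ^ (n - 1) * exp (- (a * (t - y)\<^sup>2)))
      - 2 * a * ((t - y) ^ Suc n * exp (- (a * (t - y)\<^sup>2)))) * g y" for t y
  have "((\<lambda>t. LINT y|lborel. (t - y) ^ n * exp (- (a * (t - y)\<^sup>2)) * g y) has_real_derivative
      (LINT y|lborel. f' x y)) (at x)"
  proof (rule has_real_derivative_integral[where S = "{x - 1<..<x + 1}" and
      B = "\<lambda>y. (real n * K (n - 1) + 2 * a * K (Suc n)) * \<bar>exp (- (a / 4 * y\<^sup>2)) * g y\<bar>"])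
    fix t y :: real assume t: "t \<in> {x - 1<..<x + 1}"
    show "((\<lambda>s. (s - y) ^ n * exp (- (a * (s - y)\<^sup>2)) * g y) has_real_derivative f' t y) (at t)"
      by (auto intro!: derivative_eq_intros simp: f'_def algebra_simps)
    have k: "\<bar>(t - y) ^ k * exp (- (a * (t - y)\<^sup>2))\<bar> \<le> K k * exp (- (a / 4 * y\<^sup>2))" for k
      unfolding K_def using t a by (intro gauss_kernel_le) auto
    have "\<bar>real n * ((t - y) ^ (n - 1) * exp (- (a * (t - y)\<^sup>2)))
        - 2 * a * ((t - y) ^ Suc n * exp (- (a * (t - y)\<^sup>2)))\<bar>
      \<le> real n * \<bar>(t - y) ^ (n - 1) * exp (- (a * (t - y)\<^sup>2))\<bar>
        + 2 * a * \<bar>(t - y) ^ Suc n * exp (- (a * (t - y)\<^sup>2))\<bar>"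
      using a by (intro order_trans[OF abs_triangle_ineq4]) (simp add: abs_mult)
    also have "\<dots> \<le> real n * (K (n - 1) * exp (- (a / 4 * y\<^sup>2))) + 2 * a * (K (Suc n) * exp (- (a / 4 * y\<^sup>2)))"
      using a by (intro add_mono mult_left_mono k) auto
    finally have "\<bar>f' t y\<bar> \<le> (real n * (K (n - 1) * exp (- (a / 4 * y\<^sup>2)))
        + 2 * a * (K (Suc n) * exp (- (a / 4 * y\<^sup>2)))) * \<bar>g y\<bar>"
      unfolding f'_def abs_mult[of _ "g y"] by (rule mult_right_mono) simp
    then show "\<bar>f' t y\<bar> \<le> (real n * K (n - 1) + 2 * a * K (Suc n)) * \<bar>exp (- (a / 4 * y\<^sup>2)) * g y\<bar>"
      by (simp add: abs_mult algebra_simps)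
  next
    show "integrable lborel (\<lambda>y. (real n * K (n - 1) + 2 * a * K (Suc n)) * \<bar>exp (- (a / 4 * y\<^sup>2)) * g y\<bar>)"
      using a by (intro integrable_mult_right integrable_abs gaussian_integrableD[OF g]) simp
  qed (use integrable_gauss_moment[OF g a] in \<open>auto simp: f'_def\<close>)
  moreover have "(LINT y|lborel. f' x y)
      = real n * gauss_moment g (n - 1) a x - 2 * a * gauss_moment g (Suc n) a x"
  proof -
    have "f' x = (\<lambda>y. real n * ((x - y) ^ (n - 1) * exp (- (a * (x - y)\<^sup>2)) * g y)
        - 2 * a * ((x - y) ^ Suc n * exp (- (a * (x - y)\<^sup>2)) * g y))"
      unfolding f'_def left_diff_distrib mult.assoc ..
    then show ?thesis
      unfolding gauss_moment_def
      using integrable_gauss_moment[OF g a, of x "n - 1"] integrable_gauss_moment[OF g a, of x "Suc n"]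
      by (simp del: power_Suc)
  qed
  ultimately show ?thesis
    unfolding gauss_moment_def by simp
qed

lemma gauss_moment_deriv_a:
  assumes g: "gaussian_integrable g" and a: "a > 0"
  shows "((\<lambda>a. gauss_moment g n a x) has_real_derivative - gauss_moment g (n + 2) a x) (at a)"
proof -
  have [measurable]: "g \<in> borel_measurable borel"
    using g by (simp add: gaussian_integrable_def)
  define K where "K = (1 + fact (n + 2) * (2 / (a / 2)) ^ (n + 2)) * exp ((a / 2) / 2 * \<bar>x\<bar>\<^sup>2)"
  define f' where "f' t y = - ((x - y) ^ (n + 2) * exp (- (t * (x - y)\<^sup>2)) * g y)" for t y
  have "((\<lambda>t. LINT y|lborel. (x - y) ^ n * exp (- (t * (x - y)\<^sup>2)) * g y) has_real_derivative
      (LINT y|lborel. f' a y)) (at a)"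
  proof (rule has_real_derivative_integral[where S = "{a / 2<..}" and
      B = "\<lambda>y. K * \<bar>exp (- ((a / 2) / 4 * y\<^sup>2)) * g y\<bar>"])
    fix t y :: real assume t: "t \<in> {a / 2<..}"
    have "((\<lambda>s. exp (- (s * q))) has_real_derivative - q * exp (- (t * q))) (at t)" for q
      by (auto intro!: derivative_eq_intros)
    from DERIV_cmult_right[OF DERIV_cmult[OF this[of "(x - y)\<^sup>2"], of "(x - y) ^ n"], of "g y"]
    show "((\<lambda>s. (x - y) ^ n * exp (- (s * (x - y)\<^sup>2)) * g y) has_real_derivative f' t y) (at t)"
      by (simp only: f'_def power_add mult_minus_left mult_minus_right mult_ac)
    have "\<bar>(x - y) ^ (n + 2) * exp (- (t * (x - y)\<^sup>2))\<bar> \<le> K * exp (- ((a / 2) / 4 * y\<^sup>2))"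
      unfolding K_def using t a by (intro gauss_kernel_le) auto
    from mult_right_mono[OF this, of "\<bar>g y\<bar>"]
    show "\<bar>f' t y\<bar> \<le> K * \<bar>exp (- ((a / 2) / 4 * y\<^sup>2)) * g y\<bar>"
      by (simp add: f'_def abs_mult mult.assoc)
  next
    show "integrable lborel (\<lambda>y. K * \<bar>exp (- ((a / 2) / 4 * y\<^sup>2)) * g y\<bar>)"
      using a by (intro integrable_mult_right integrable_abs gaussian_integrableD[OF g]) simp
  qed (use integrable_gauss_moment[OF g, of _ x n] a in \<open>auto simp: f'_def\<close>)
  then show ?thesis
    unfolding gauss_moment_def f'_def by simp
qed

lemma has_bochner_integral_gauss:
  assumes "a > (0::real)"
  shows "has_bochner_integral lborel (\<lambda>x. exp (- (a * x\<^sup>2))) (sqrt (pi / a))"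
proof -
  have "has_bochner_integral lborel (\<lambda>x::real. exp (- x\<^sup>2)) (2 *\<^sub>R (sqrt pi / 2))"
    by (rule has_bochner_integral_even_function[OF gaussian_moment_0]) simp
  then have "has_bochner_integral lborel (\<lambda>x::real. exp (- (0 + sqrt a * x)\<^sup>2)) (sqrt pi /\<^sub>R \<bar>sqrt a\<bar>)"
    using assms by (subst lborel_has_bochner_integral_real_affine_iff[of "sqrt a" _ _ 0, symmetric]) auto
  then show ?thesis
    using assms by (simp add: power_mult_distrib real_sqrt_divide divide_inverse real_sqrt_mult real_sqrt_inverse mult.commute)
qed

lemmas integrable_gauss = has_bochner_integral_gauss[THEN integrable.intros]
lemmas integral_gauss = has_bochner_integral_gauss[THEN has_bochner_integral_integral_eq]

lemma gaussian_integrable_integrable: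
  assumes [measurable]: "g \<in> borel_measurable borel" and g: "integrable lborel g"
  shows "gaussian_integrable g"
  unfolding gaussian_integrable_def
proof (intro conjI allI impI)
  fix \<alpha> :: real assume "\<alpha> > 0"
  then have "\<bar>exp (- (\<alpha> * y\<^sup>2)) * g y\<bar> \<le> \<bar>g y\<bar>" for y
    by (simp add: abs_mult mult_left_le_one_le)
  then show "integrable lborel (\<lambda>y. exp (- (\<alpha> * y\<^sup>2)) * g y)"
    by (intro Bochner_Integration.integrable_bound[OF g]) auto
qed simp

lemma gaussian_integrable_bounded:
  assumes [measurable]: "g \<in> borel_measurable borel" and g: "\<And>y. \<bar>g y\<bar> \<le> B"
  shows "gaussian_integrable g"
  unfolding gaussian_integrable_def
proof (intro conjI allI impI)
  fix \<alpha> :: real assume \<alpha>: "\<alpha> > 0"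
  show "integrable lborel (\<lambda>y. exp (- (\<alpha> * y\<^sup>2)) * g y)"
  proof (rule Bochner_Integration.integrable_bound)
    show "integrable lborel (\<lambda>y. B * exp (- (\<alpha> * y\<^sup>2)))"
      by (intro integrable_mult_right integrable_gauss \<alpha>)
    have "B \<ge> 0"
      using g[of 0] by simp
    then show "AE y in lborel. norm (exp (- (\<alpha> * y\<^sup>2)) * g y) \<le> norm (B * exp (- (\<alpha> * y\<^sup>2)))"
      using g by (auto simp: abs_mult mult.commute intro!: mult_right_mono)
  qed auto
qed simp

section \<open>Primitives of integrable functions\<close>

definition primitive :: "(real \<Rightarrow> real) \<Rightarrow> real \<Rightarrow> real" where
  "primitive f x = (LINT y|lborel. indicator {..x} y * f y)"

lemma integrable_indicator_mult:
  fixes f :: "real \<Rightarrow> real"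
  assumes "integrable lborel f" "A \<in> sets borel"
  shows "integrable lborel (\<lambda>y. indicator A y * f y)"
  using integrable_mult_indicator[of A lborel f] assms by simp

lemma primitive_diff:
  assumes "integrable lborel f" "x \<le> y"
  shows "primitive f y - primitive f x = (LINT z|lborel. indicator {x<..y} z * f z)"
proof -
  have "primitive f y - primitive f x = (LINT z|lborel. indicator {..y} z * f z - indicator {..x} z * f z)"
    unfolding primitive_def
    by (intro Bochner_Integration.integral_diff[symmetric] integrable_indicator_mult assms) auto
  also have "\<dots> = (LINT z|lborel. indicator {x<..y} z * f z)"
    using assms(2) by (intro Bochner_Integration.integral_cong) (auto simp: indicator_def)
  finally show ?thesis .
qed

lemma abs_primitive_diff_le:
  assumes f: "integrable lborel f" and "x \<le> y"
  shows "\<bar>primitive f y - primitive f x\<bar> \<le> primitive (\<lambda>z. \<bar>f z\<bar>) y - primitive (\<lambda>z. \<bar>f z\<bar>) x"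
  unfolding primitive_diff[OF f assms(2)] primitive_diff[OF integrable_abs[OF f] assms(2)]
  by (rule order_trans[OF integral_abs_bound]) (simp add: abs_mult)

lemma abs_primitive_le:
  assumes f: "integrable lborel f"
  shows "\<bar>primitive f x\<bar> \<le> (LINT z|lborel. \<bar>f z\<bar>)"
proof -
  have "\<bar>primitive f x\<bar> \<le> (LINT z|lborel. \<bar>indicator {..x} z * f z\<bar>)"
    unfolding primitive_def by (rule integral_abs_bound)
  also have "\<dots> \<le> (LINT z|lborel. \<bar>f z\<bar>)"
    using f integrable_indicator_mult[OF f, of "{..x}"]
    by (intro integral_mono) (auto simp: indicator_def)
  finally show ?thesis .
qed

lemma isCont_primitive:
  assumes f: "integrable lborel f"
  shows "isCont (primitive f) x"
proof -
  have [measurable]: "f \<in> borel_measurable borel"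
    using f by auto
  \<comment> \<open>The indicators of \<open>{..t}\<close> need not converge at \<open>x\<close> itself; removing this point from the
    integrand makes the convergence hold everywhere.\<close>
  define g where "g y = indicator (- {x}) y * f y" for y
  have [measurable]: "g \<in> borel_measurable borel"
    unfolding g_def by measurable
  have eq: "primitive f t = (LINT y|lborel. indicator {..t} y * g y)" for t
    unfolding primitive_def
  proof (rule integral_cong_AE)
    show "AE y in lborel. indicator {..t} y * f y = indicator {..t} y * g y"
      using AE_lborel_singleton[of x] by eventually_elim (simp add: g_def)
  qed auto
  have "((\<lambda>t. LINT y|lborel. indicator {..t} y * g y) \<longlongrightarrow> (LINT y|lborel. indicator {..x} y * g y)) (at x)"
  proof (rule integral_dominated_convergence_within[where w = "\<lambda>y. \<bar>f y\<bar>"])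
    fix y
    show "((\<lambda>t. indicator {..t} y * g y) \<longlongrightarrow> indicator {..x} y * g y) (at x)"
    proof (rule tendsto_eventually)
      consider "y < x" | "y = x" | "y > x" by linarith
      then show "\<forall>\<^sub>F t in at x. indicator {..t} y * g y = indicator {..x} y * g y"
      proof cases
        case 1
        then have "\<forall>\<^sub>F t in at x. t > y"
          by (metis eventually_at_topological lessThan_def open_greaterThan greaterThan_iff)
        then show ?thesis by eventually_elim (use 1 in simp)
      next
        case 3
        then have "\<forall>\<^sub>F t in at x. t < y"
          by (metis eventually_at_topological open_lessThan lessThan_iff)
        then show ?thesis by eventually_elim (use 3 in simp)
      qed (simp add: g_def)
    qed
  qed (use f in \<open>auto simp: g_def indicator_def\<close>)
  then show ?thesis
    unfolding isCont_def eq .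
qed

lemma borel_measurable_primitive:
  "integrable lborel f \<Longrightarrow> primitive f \<in> borel_measurable borel"
  by (intro borel_measurable_continuous_onI continuous_at_imp_continuous_on ballI isCont_primitive)

lemma primitive_at_top:
  assumes f: "integrable lborel f"
  shows "(primitive f \<longlongrightarrow> (LINT y|lborel. f y)) at_top"
  unfolding primitive_def
proof (rule integral_dominated_convergence_at_top[where w = "\<lambda>y. \<bar>f y\<bar>"])
  have "\<forall>\<^sub>F t in at_top. indicator {..t} y * f y = f y" for y
    using eventually_ge_at_top[of y] by eventually_elim simp
  then show "AE y in lborel. ((\<lambda>t. indicator {..t} y * f y) \<longlongrightarrow> f y) at_top"
    by (intro AE_I2 tendsto_eventually)
qed (use f in \<open>auto simp: indicator_def\<close>)

lemma primitive_at_bot: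
  assumes f: "integrable lborel f"
  shows "(primitive f \<longlongrightarrow> 0) at_bot"
  unfolding filterlim_at_bot_mirror primitive_def
proof -
  have "((\<lambda>t. LINT y|lborel. indicator {..- t} y * f y) \<longlongrightarrow> (LINT y::real|lborel. 0)) at_top"
  proof (rule integral_dominated_convergence_at_top[where w = "\<lambda>y. \<bar>f y\<bar>"])
    have "\<forall>\<^sub>F t in at_top. indicator {..- t} y * f y = 0" for y
      using eventually_gt_at_top[of "- y"] by eventually_elim simp
    then show "AE y in lborel. ((\<lambda>t. indicator {..- t} y * f y) \<longlongrightarrow> 0) at_top"
      by (intro AE_I2 tendsto_eventually)
  qed (use f in \<open>auto simp: indicator_def\<close>)
  then show "((\<lambda>t. LINT y|lborel. indicator {..- t} y * f y) \<longlongrightarrow> 0) at_top"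
    by simp
qed

text \<open>
  Cutting \<open>[x, y]\<close> at points where \<open>G\<close> takes \<open>n\<close> equally spaced values bounds the increment of
  \<open>H\<close> by \<open>n\<close> terms of order \<open>1 / n\<^sup>2\<close>. With \<open>G\<close> the primitive of \<open>\<bar>f\<bar>\<close>, this replaces the theorem
  that an absolutely continuous function with derivative \<open>0\<close> almost everywhere is constant.
\<close>

lemma quadratic_increment_constant:
  fixes G H :: "real \<Rightarrow> real"
  assumes G: "\<And>x. isCont G x" and C: "C \<ge> 0"
    and H: "\<And>x y. x \<le> y \<Longrightarrow> \<bar>H y - H x\<bar> \<le> C * (G y - G x)\<^sup>2"
    and mono: "\<And>x y. x \<le> y \<Longrightarrow> G x \<le> G y" and xy: "x \<le> y"
  shows "H x = H y"
proof -
  define d where "d = G y - G x"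
  have H': "\<bar>H v - H u\<bar> \<le> C * (G v - G u)\<^sup>2" for u v
    using H[of u v] H[of v u] by (cases "u \<le> v") (auto simp: power2_commute abs_minus_commute)
  have bd: "\<bar>H y - H x\<bar> \<le> C * d\<^sup>2 / real (Suc n)" for n
  proof -
    let ?N = "real (Suc n)"
    have "\<exists>p. G p = G x + real i / ?N * d" if "i \<le> Suc n" for i
    proof -
      have "0 \<le> d" using mono[OF xy] by (simp add: d_def)
      moreover have "real i / ?N \<le> 1"
        using that by simp
      ultimately have "real i / ?N * d \<le> 1 * d" "0 \<le> real i / ?N * d"
        by (rule mult_right_mono[rotated], simp)
      then have "G x \<le> G x + real i / ?N * d" "G x + real i / ?N * d \<le> G y"
        by (auto simp: d_def)
      then show ?thesis
        using IVT'[of G x "G x + real i / ?N * d" y] xy G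
        by (meson continuous_at_imp_continuous_on)
    qed
    then obtain p where p: "\<And>i. i \<le> Suc n \<Longrightarrow> G (p i) = G x + real i / ?N * d"
      by metis
    have "H (p 0) = H x" "H (p (Suc n)) = H y"
      using H'[of x "p 0"] H'[of y "p (Suc n)"] p[of 0] p[of "Suc n"] by (auto simp: d_def)
    then have "\<bar>H y - H x\<bar> = \<bar>\<Sum>i<Suc n. H (p (Suc i)) - H (p i)\<bar>"
      unfolding sum_lessThan_telescope[of "\<lambda>i. H (p i)"] by simp
    also have "\<dots> \<le> (\<Sum>i<Suc n. \<bar>H (p (Suc i)) - H (p i)\<bar>)"
      by (rule sum_abs)
    also have "\<dots> \<le> (\<Sum>i<Suc n. C * (d / ?N)\<^sup>2)"
    proof (rule sum_mono)
      fix i assume "i \<in> {..<Suc n}"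
      then have "G (p (Suc i)) - G (p i) = d / ?N"
        using p[of i] p[of "Suc i"] by (simp add: field_simps)
      then show "\<bar>H (p (Suc i)) - H (p i)\<bar> \<le> C * (d / ?N)\<^sup>2"
        using H'[of "p (Suc i)" "p i"] by metis
    qed
    also have "\<dots> = C * d\<^sup>2 / ?N"
      by (simp add: power2_eq_square)
    finally show ?thesis .
  qed
  have "(\<lambda>n. C * d\<^sup>2 / real (Suc n)) \<longlonglongrightarrow> 0"
    by (rule LIMSEQ_Suc[OF lim_const_over_n])
  from LIMSEQ_le_const[OF this, of "\<bar>H y - H x\<bar>"] bd
  have "\<bar>H y - H x\<bar> \<le> 0" by auto
  then show ?thesis by simp
qed

lemma abs_exp_diff_le:
  fixes p q B :: real
  assumes "\<bar>p\<bar> \<le> B" "\<bar>q\<bar> \<le> B"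
  shows "\<bar>exp p - exp q\<bar> \<le> exp B * \<bar>p - q\<bar>"
proof -
  have "norm (exp p - exp q) \<le> exp B * norm (p - q)"
    using assms
    by (intro field_differentiable_bound[where S = "{-B..B}" and f' = exp])
       (auto intro!: derivative_eq_intros)
  then show ?thesis by simp
qed

lemma abs_exp_taylor1_le:
  fixes p q B :: real
  assumes "\<bar>p\<bar> \<le> B" "\<bar>q\<bar> \<le> B"
  shows "\<bar>exp p - exp q - exp q * (p - q)\<bar> \<le> exp B * (p - q)\<^sup>2"
proof -
  have cl: "closed_segment q p \<subseteq> {-B..B}"
    using assms by (auto simp: closed_segment_eq_real_ivl abs_le_iff split: if_splits)
  have "norm ((exp p - exp q * p) - (exp q - exp q * q)) \<le> exp B * \<bar>p - q\<bar> * norm (p - q)"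
  proof (rule field_differentiable_bound[where S = "closed_segment q p" and f' = "\<lambda>r. exp r - exp q"])
    fix r assume r: "r \<in> closed_segment q p"
    show "((\<lambda>r. exp r - exp q * r) has_field_derivative exp r - exp q) (at r within closed_segment q p)"
      by (auto intro!: derivative_eq_intros)
    have "\<bar>exp r - exp q\<bar> \<le> exp B * \<bar>r - q\<bar>"
      using subsetD[OF cl r] assms by (intro abs_exp_diff_le) (auto simp: abs_le_iff)
    also have "\<dots> \<le> exp B * \<bar>p - q\<bar>"
      using r by (auto simp: closed_segment_eq_real_ivl split: if_splits)
    finally show "norm (exp r - exp q) \<le> exp B * \<bar>p - q\<bar>" by simp
  qed auto
  then show ?thesis
    by (simp add: algebra_simps power2_eq_square flip: abs_mult)
qed

text \<open>
  The chain rule for \<open>exp \<circ> (K * primitive f)\<close> in integrated form: the difference of the two sides has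
  increments of second order in those of the primitive of \<open>\<bar>f\<bar>\<close>.
\<close>

lemma exp_primitive:
  assumes f: "integrable lborel f"
  shows "exp (K * primitive f x) = 1 + K * primitive (\<lambda>y. exp (K * primitive f y) * f y) x"
    and "integrable lborel (\<lambda>y. exp (K * primitive f y) * f y)"
proof -
  define U where "U = primitive f"
  define G where "G = primitive (\<lambda>y. \<bar>f y\<bar>)"
  define g where "g y = exp (K * U y)" for y
  define B where "B = \<bar>K\<bar> * (LINT z|lborel. \<bar>f z\<bar>)"
  have [measurable]: "f \<in> borel_measurable borel" "U \<in> borel_measurable borel"
    using f borel_measurable_primitive[OF f] by (auto simp: U_def)
  then have [measurable]: "g \<in> borel_measurable borel"
    unfolding g_def by measurable
  have KU: "\<bar>K * U y\<bar> \<le> B" for y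
    using abs_primitive_le[OF f, of y] by (simp add: B_def U_def abs_mult mult_left_mono)
  have g_le: "\<bar>g y\<bar> \<le> exp B" for y
    using KU[of y] by (simp add: g_def abs_le_iff)
  have gf: "integrable lborel (\<lambda>y. g y * f y)"
  proof (rule Bochner_Integration.integrable_bound)
    show "integrable lborel (\<lambda>y. exp B * f y)" using f by simp
  qed (use g_le in \<open>auto simp: abs_mult intro!: mult_right_mono\<close>)
  then show "integrable lborel (\<lambda>y. exp (K * primitive f y) * f y)"
    by (simp add: g_def U_def)
  define H where "H x = g x - K * primitive (\<lambda>y. g y * f y) x" for x
  have UG: "\<bar>U y - U x\<bar> \<le> G y - G x" if "x \<le> y" for x y
    unfolding U_def G_def by (rule abs_primitive_diff_le[OF f that])
  have Gmono: "G x \<le> G y" if "x \<le> y" for x y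
    using UG[OF that] by linarith
  have incr: "\<bar>H y - H x\<bar> \<le> (2 * exp B * K\<^sup>2) * (G y - G x)\<^sup>2" if xy: "x \<le> y" for x y
  proof -
    note i1 = integrable_indicator_mult[OF gf, of "{x<..y}"]
    note i2 = integrable_indicator_mult[OF f, of "{x<..y}"]
    note i3 = integrable_indicator_mult[OF integrable_abs[OF f], of "{x<..y}"]
    have dG: "0 \<le> G y - G x" using Gmono[OF xy] by simp
    have "\<bar>g y - g x - g x * (K * U y - K * U x)\<bar> \<le> exp B * (K * U y - K * U x)\<^sup>2"
      unfolding g_def by (rule abs_exp_taylor1_le[OF KU KU])
    also have "(K * U y - K * U x)\<^sup>2 = K\<^sup>2 * \<bar>U y - U x\<bar>\<^sup>2"
      by (simp add: power_mult_distrib flip: right_diff_distrib)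
    also have "exp B * (K\<^sup>2 * \<bar>U y - U x\<bar>\<^sup>2) \<le> exp B * (K\<^sup>2 * (G y - G x)\<^sup>2)"
      using UG[OF xy] by (intro mult_left_mono power_mono) auto
    finally have A: "\<bar>g y - g x - g x * (K * U y - K * U x)\<bar> \<le> exp B * K\<^sup>2 * (G y - G x)\<^sup>2"
      by (simp add: mult.assoc)
    have "primitive (\<lambda>y. g y * f y) y - primitive (\<lambda>y. g y * f y) x - g x * (U y - U x)
        = (LINT z|lborel. indicator {x<..y} z * (g z * f z)) - g x * (LINT z|lborel. indicator {x<..y} z * f z)"
      unfolding U_def primitive_diff[OF gf xy] primitive_diff[OF f xy] ..
    also have "\<dots> = (LINT z|lborel. indicator {x<..y} z * ((g z - g x) * f z))"
    proof -
      have "(\<lambda>z. indicator {x<..y} z * ((g z - g x) * f z))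
          = (\<lambda>z. indicator {x<..y} z * (g z * f z) - g x * (indicator {x<..y} z * f z))"
        by (simp add: algebra_simps)
      then show ?thesis
        using i1 i2 by simp
    qed
    also have "\<bar>\<dots>\<bar> \<le> (LINT z|lborel. \<bar>indicator {x<..y} z * ((g z - g x) * f z)\<bar>)"
      by (rule integral_abs_bound)
    also have "\<dots> \<le> (LINT z|lborel. (exp B * \<bar>K\<bar> * (G y - G x)) * (indicator {x<..y} z * \<bar>f z\<bar>))"
    proof (rule integral_mono)
      have "integrable lborel (\<lambda>z. indicator {x<..y} z * (g z * f z) - g x * (indicator {x<..y} z * f z))"
        using i1 i2 by auto
      then show "integrable lborel (\<lambda>z. \<bar>indicator {x<..y} z * ((g z - g x) * f z)\<bar>)"
        by (intro integrable_abs) (simp add: algebra_simps)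
      show "integrable lborel (\<lambda>z. (exp B * \<bar>K\<bar> * (G y - G x)) * (indicator {x<..y} z * \<bar>f z\<bar>))"
        using i3 by (intro integrable_mult_right) auto
      fix z
      have "\<bar>g z - g x\<bar> \<le> exp B * \<bar>K\<bar> * (G y - G x)" if z: "x < z" "z \<le> y"
      proof -
        have "\<bar>g z - g x\<bar> \<le> exp B * \<bar>K * U z - K * U x\<bar>"
          unfolding g_def by (rule abs_exp_diff_le[OF KU KU])
        also have "\<bar>K * U z - K * U x\<bar> = \<bar>K\<bar> * \<bar>U z - U x\<bar>"
          by (simp add: abs_mult flip: right_diff_distrib)
        also have "\<bar>U z - U x\<bar> \<le> G y - G x"
          using UG[of x z] Gmono[of z y] z by simp
        finally show ?thesis by (simp add: mult.assoc mult_left_mono)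
      qed
      then show "\<bar>indicator {x<..y} z * ((g z - g x) * f z)\<bar>
          \<le> (exp B * \<bar>K\<bar> * (G y - G x)) * (indicator {x<..y} z * \<bar>f z\<bar>)"
        by (auto simp: indicator_def abs_mult intro!: mult_right_mono)
    qed
    also have "\<dots> = (exp B * \<bar>K\<bar> * (G y - G x)) * (G y - G x)"
      unfolding G_def primitive_diff[OF integrable_abs[OF f] xy] by simp
    finally have "\<bar>K\<bar> * \<bar>primitive (\<lambda>y. g y * f y) y - primitive (\<lambda>y. g y * f y) x - g x * (U y - U x)\<bar>
        \<le> \<bar>K\<bar> * ((exp B * \<bar>K\<bar> * (G y - G x)) * (G y - G x))"
      by (rule mult_left_mono) simp
    then have Bd: "\<bar>K * (primitive (\<lambda>y. g y * f y) y - primitive (\<lambda>y. g y * f y) x - g x * (U y - U x))\<bar>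
        \<le> exp B * K\<^sup>2 * (G y - G x)\<^sup>2"
      by (simp add: abs_mult power2_eq_square mult_ac abs_mult_self_eq)
    have "H y - H x = (g y - g x - g x * (K * U y - K * U x))
        - K * (primitive (\<lambda>y. g y * f y) y - primitive (\<lambda>y. g y * f y) x - g x * (U y - U x))"
      by (simp add: H_def algebra_simps)
    then show ?thesis
      using A Bd by (simp add: algebra_simps)
  qed
  have const: "H y = H x" if "y \<le> x" for x y
  proof (rule quadratic_increment_constant[of G "2 * exp B * K\<^sup>2" H])
    show "isCont G z" for z
      unfolding G_def by (rule isCont_primitive[OF integrable_abs[OF f]])
  qed (use incr Gmono that in auto)
  have "(H \<longlongrightarrow> exp (K * 0) - K * 0) at_bot"
    unfolding H_def[abs_def] g_def U_def
    using primitive_at_bot[OF f] primitive_at_bot[OF gf, unfolded g_def U_def]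
    by (intro tendsto_intros)
  moreover have "\<forall>\<^sub>F y in at_bot. H y = H x"
    using eventually_le_at_bot[of x] by eventually_elim (rule const)
  then have "(H \<longlongrightarrow> H x) at_bot"
    by (rule tendsto_eventually)
  ultimately have "H x = 1"
    using tendsto_unique[of at_bot H] by fastforce
  then show "exp (K * primitive f x) = 1 + K * primitive (\<lambda>y. exp (K * primitive f y) * f y) x"
    by (simp add: H_def g_def U_def)
qed

section \<open>The heat equation and the Hopf-Cole transformation\<close>

lemma gauss_tendsto_0_at_top:
  assumes "a > 0"
  shows "((\<lambda>y. exp (- (a * (x - y)\<^sup>2))) \<longlongrightarrow> (0::real)) at_top"
  using assms by real_asymp

lemma integral_gauss_first_moment_tail:
  assumes a: "a > (0::real)"
  shows "(LINT y|lborel. indicator {z..} y * ((x - y) * exp (- (a * (x - y)\<^sup>2))))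
    = - (exp (- (a * (x - z)\<^sup>2)) / (2 * a))"
proof -
  let ?f = "\<lambda>y. (x - y) * exp (- (a * (x - y)\<^sup>2))"
  let ?F = "\<lambda>y. exp (- (a * (x - y)\<^sup>2)) / (2 * a)"
  have D: "(?F has_real_derivative ?f y) (at y)" for y
    using a by (auto intro!: derivative_eq_intros simp: field_simps)
  have int: "integrable lborel ?f"
    using integrable_gauss_moment[OF gaussian_integrable_bounded[of "\<lambda>_. 1" 1] a, of x 1] by simp
  have "(LBINT y=ereal z..\<infinity>. ?f y) = 0 / (2 * a) - ?F z"
  proof (rule interval_integral_FTC_integrable)
    show "set_integrable lborel (einterval (ereal z) \<infinity>) ?f"
      unfolding set_integrable_def by (rule integrable_mult_indicator) (use int in auto)
    have "(?F \<longlongrightarrow> ?F z) (at z)"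
      using DERIV_isCont[OF D[of z]] by (simp only: isCont_def)
    then show "((?F \<circ> real_of_ereal) \<longlongrightarrow> ?F z) (at_right (ereal z))"
      unfolding ereal_tendsto_simps by (rule tendsto_within_subset) simp
    show "((?F \<circ> real_of_ereal) \<longlongrightarrow> 0 / (2 * a)) (at_left \<infinity>)"
      unfolding ereal_tendsto_simps using a gauss_tendsto_0_at_top[OF a, of x] by (intro tendsto_intros) auto
  qed (use D in \<open>auto simp: has_real_derivative_iff_has_vector_derivative\<close>)
  then have "(LINT y:{z<..}|lborel. ?f y) = - ?F z"
    by (simp add: interval_integral_to_infinity_eq)
  moreover have "(LINT y|lborel. indicator {z..} y * ?f y) = (LINT y|lborel. indicator {z<..} y * ?f y)"
  proof (rule integral_cong_AE)
    show "AE y in lborel. indicator {z..} y * ?f y = indicator {z<..} y * ?f y"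
      using AE_lborel_singleton[of z] by eventually_elim (auto simp: indicator_def)
  qed auto
  ultimately show ?thesis
    by (simp add: set_lebesgue_integral_def)
qed

text \<open>
  Integration by parts for a primitive. Since the primitive is differentiable only almost everywhere,
  the derivative is moved to the kernel by exchanging the order of integration.
\<close>

lemma gauss_moment_primitive:
  assumes f: "integrable lborel f" and a: "a > 0"
  shows "- 2 * a * gauss_moment (\<lambda>y. \<alpha> + \<beta> * primitive f y) 1 a x = \<beta> * gauss_moment f 0 a x"
proof -
  have [measurable]: "f \<in> borel_measurable borel" "primitive f \<in> borel_measurable borel"
    using f borel_measurable_primitive[OF f] by auto
  let ?K = "\<lambda>y. (x - y) * exp (- (a * (x - y)\<^sup>2))"
  have K: "integrable lborel ?K"
    using integrable_gauss_moment[OF gaussian_integrable_bounded[of "\<lambda>_. 1" 1] a, of x 1] by simp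
  have Kp: "integrable lborel (\<lambda>y. ?K y * primitive f y)"
    using integrable_gauss_moment[OF gaussian_integrable_bounded[of "primitive f", OF _ abs_primitive_le[OF f]] a, of x 1]
    by simp
  have K0: "(LINT y|lborel. ?K y) = 0"
  proof -
    have "(LINT y|lborel. ?K y) = (LINT q|lborel. q * exp (- (a * q\<^sup>2)))"
      using integral_reflect_translate[of "\<lambda>q. q * exp (- (a * q\<^sup>2))" x] by simp
    moreover have "(LINT q|lborel. q * exp (- (a * q\<^sup>2))) = - (LINT q|lborel. q * exp (- (a * q\<^sup>2)))"
      using integral_reflect_translate[of "\<lambda>q. q * exp (- (a * q\<^sup>2))" 0] by simp
    ultimately show ?thesis by simp
  qed
  define P where "P = (\<lambda>z y. indicator {z..} y * ?K y * f z)"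
  have meas: "case_prod P \<in> borel_measurable (lborel \<Otimes>\<^sub>M lborel)"
  proof -
    have "P z y = of_bool (z \<le> y) * ?K y * f z" for z y
      by (simp add: P_def indicator_def)
    then have "P = (\<lambda>z y. (if z \<le> y then 1 else 0) * ?K y * f z)"
      by (intro ext) simp
    then show ?thesis by simp
  qed
  have iK: "integrable lborel (\<lambda>y. indicator {z..} y * ?K y)" for z
    using integrable_indicator_mult[OF K, of "{z..}"] by simp
  have iP: "integrable lborel (P z)" for z
    unfolding P_def by (intro integrable_mult_left iK)
  have "integrable (lborel \<Otimes>\<^sub>M lborel) (case_prod P)"
  proof (rule lborel_pair.Fubini_integrable[OF meas])
    show "integrable lborel (\<lambda>z. LINT y|lborel. norm (case_prod P (z, y)))"
    proof (rule Bochner_Integration.integrable_bound)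
      show "integrable lborel (\<lambda>z. (LINT y|lborel. \<bar>?K y\<bar>) * f z)"
        using f by simp
      show "(\<lambda>z. LINT y|lborel. norm (case_prod P (z, y))) \<in> borel_measurable lborel"
        using meas by measurable
      have "(LINT y|lborel. \<bar>P z y\<bar>) \<le> (LINT y|lborel. \<bar>?K y\<bar>) * \<bar>f z\<bar>" for z
      proof -
        have "(LINT y|lborel. \<bar>P z y\<bar>) \<le> (LINT y|lborel. \<bar>?K y\<bar> * \<bar>f z\<bar>)"
        proof (rule integral_mono)
          show "integrable lborel (\<lambda>y. \<bar>P z y\<bar>)"
            by (intro integrable_abs iP)
          show "integrable lborel (\<lambda>y. \<bar>?K y\<bar> * \<bar>f z\<bar>)"
            by (intro integrable_mult_left integrable_abs K)
        qed (auto simp: P_def indicator_def abs_mult)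
        then show ?thesis using K by simp
      qed
      then show "AE z in lborel. norm (LINT y|lborel. norm (case_prod P (z, y)))
          \<le> norm ((LINT y|lborel. \<bar>?K y\<bar>) * f z)"
        by (simp add: abs_mult)
    qed
  qed (use iP in simp)
  from lborel_pair.Fubini_integral[OF this]
  have "(LINT y|lborel. LINT z|lborel. P z y) = (LINT z|lborel. LINT y|lborel. P z y)" .
  moreover have "(LINT z|lborel. P z y) = ?K y * primitive f y" for y
  proof -
    have "(LINT z|lborel. P z y) = (LINT z|lborel. ?K y * (indicator {..y} z * f z))"
      unfolding P_def by (intro Bochner_Integration.integral_cong) (auto simp: indicator_def)
    then show ?thesis by (simp add: primitive_def)
  qed
  moreover have "(LINT y|lborel. P z y) = - (exp (- (a * (x - z)\<^sup>2)) / (2 * a)) * f z" for z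
    unfolding P_def by (subst integral_gauss_first_moment_tail[OF a, symmetric]) simp
  ultimately have main: "(LINT y|lborel. ?K y * primitive f y) = - (gauss_moment f 0 a x / (2 * a))"
    by (simp add: gauss_moment_def)
  have "gauss_moment (\<lambda>y. \<alpha> + \<beta> * primitive f y) 1 a x
      = (LINT y|lborel. \<alpha> * ?K y + \<beta> * (?K y * primitive f y))"
    unfolding gauss_moment_def by (intro Bochner_Integration.integral_cong) (auto simp: algebra_simps)
  also have "\<dots> = \<beta> * (LINT y|lborel. ?K y * primitive f y)"
    using K Kp K0 by simp
  finally show ?thesis
    using main a by simp
qed

lemma heat_conv_gauss_moment:
  assumes [measurable]: "g \<in> borel_measurable borel" and "c > 0" "t > 0"
  shows "heat_conv c g x t = sqrt (1 / (4 * c * t) / pi) * gauss_moment g 0 (1 / (4 * c * t)) x"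
proof -
  have "(LINT y|lebesgue. exp (- ((x - y)\<^sup>2 / (4 * c * t))) * g y)
      = (LINT y|lborel. exp (- ((x - y)\<^sup>2 / (4 * c * t))) * g y)"
    by (rule integral_completion) simp
  then show ?thesis
    using assms by (simp add: heat_conv_def gauss_moment_def real_sqrt_divide real_sqrt_mult mult_ac)
qed

lemma heat_conv_deriv_x:
  assumes g: "gaussian_integrable g" and c: "c > 0" and t: "t > 0"
  defines "a \<equiv> 1 / (4 * c * t)"
  shows "((\<lambda>x. heat_conv c g x t) has_real_derivative
      sqrt (a / pi) * (- 2 * a * gauss_moment g 1 a x)) (at x)"
proof -
  have [measurable]: "g \<in> borel_measurable borel"
    using g by (simp add: gaussian_integrable_def)
  have a: "a > 0" using c t by (simp add: a_def)
  show ?thesis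
    using DERIV_cmult[OF gauss_moment_deriv_x[OF g a, of 0 x], of "sqrt (a / pi)"]
    by (simp add: heat_conv_gauss_moment[OF _ c t] a_def)
qed

lemma heat_conv_deriv_xx:
  assumes g: "gaussian_integrable g" and c: "c > 0" and t: "t > 0"
  defines "a \<equiv> 1 / (4 * c * t)"
  shows "((\<lambda>x. sqrt (a / pi) * (- 2 * a * gauss_moment g 1 a x)) has_real_derivative
      sqrt (a / pi) * (- 2 * a * (gauss_moment g 0 a x - 2 * a * gauss_moment g 2 a x))) (at x)"
proof -
  have a: "a > 0" using c t by (simp add: a_def)
  show ?thesis
    using DERIV_cmult[OF DERIV_cmult[OF gauss_moment_deriv_x[OF g a, of 1 x], of "- 2 * a"], of "sqrt (a / pi)"]
    by (simp add: numeral_2_eq_2)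
qed

lemma heat_conv_deriv_t:
  assumes g: "gaussian_integrable g" and c: "c > 0" and t: "t > 0"
  defines "a \<equiv> 1 / (4 * c * t)"
  shows "((\<lambda>t. heat_conv c g x t) has_real_derivative
      c * (sqrt (a / pi) * (- 2 * a * (gauss_moment g 0 a x - 2 * a * gauss_moment g 2 a x)))) (at t)"
proof -
  have [measurable]: "g \<in> borel_measurable borel"
    using g by (simp add: gaussian_integrable_def)
  have a: "a > 0" using c t by (simp add: a_def)
  have da: "((\<lambda>t. 1 / (4 * c * t)) has_real_derivative - (4 * c * a\<^sup>2)) (at t)"
    using c t by (auto intro!: derivative_eq_intros simp: a_def power2_eq_square field_simps)
  have ds: "((\<lambda>a. sqrt (a / pi)) has_real_derivative sqrt (a / pi) / (2 * a)) (at a)"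
  proof -
    have "((\<lambda>a. sqrt (a / pi)) has_real_derivative inverse (sqrt (a / pi)) / 2 * (1 / pi)) (at a)"
      using DERIV_real_sqrt[of "a / pi"] a
      by (intro DERIV_chain2[where f = sqrt]) (auto intro!: derivative_eq_intros)
    moreover have "inverse r / 2 * (1 / pi) = r / (2 * (pi * r\<^sup>2))" if "r \<noteq> 0" for r :: real
      using that by (simp add: field_simps power2_eq_square)
    from this[of "sqrt (a / pi)"]
    have "inverse (sqrt (a / pi)) / 2 * (1 / pi) = sqrt (a / pi) / (2 * a)"
      using a by simp
    ultimately show ?thesis by (simp only:)
  qed
  have "((\<lambda>a. sqrt (a / pi) * gauss_moment g 0 a x) has_real_derivative
      sqrt (a / pi) / (2 * a) * gauss_moment g 0 a x + (- gauss_moment g 2 a x) * sqrt (a / pi)) (at a)"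
    using DERIV_mult[OF ds gauss_moment_deriv_a[OF g a, of 0 x]] by (simp add: numeral_2_eq_2)
  from DERIV_chain2[OF this[unfolded a_def] da]
  have "((\<lambda>t. sqrt (1 / (4 * c * t) / pi) * gauss_moment g 0 (1 / (4 * c * t)) x) has_real_derivative
      (sqrt (a / pi) / (2 * a) * gauss_moment g 0 a x + (- gauss_moment g 2 a x) * sqrt (a / pi))
        * (- (4 * c * a\<^sup>2))) (at t)"
    by (simp add: a_def)
  moreover have "(sqrt (a / pi) / (2 * a) * gauss_moment g 0 a x + (- gauss_moment g 2 a x) * sqrt (a / pi))
        * (- (4 * c * a\<^sup>2)) = c * (sqrt (a / pi) * (- 2 * a * (gauss_moment g 0 a x - 2 * a * gauss_moment g 2 a x)))"
    using a by (simp add: power2_eq_square field_simps)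
  ultimately have D: "((\<lambda>t. sqrt (1 / (4 * c * t) / pi) * gauss_moment g 0 (1 / (4 * c * t)) x) has_real_derivative
      c * (sqrt (a / pi) * (- 2 * a * (gauss_moment g 0 a x - 2 * a * gauss_moment g 2 a x)))) (at t)"
    by (simp only:)
  have "\<forall>\<^sub>F s in nhds t. s \<in> {0<..}"
    using t by (intro eventually_nhds_in_open) auto
  then have "\<forall>\<^sub>F s in nhds t. heat_conv c g x s = sqrt (1 / (4 * c * s) / pi) * gauss_moment g 0 (1 / (4 * c * s)) x"
    by eventually_elim (use heat_conv_gauss_moment[OF _ c] in auto)
  then show ?thesis
    using D by (subst DERIV_cong_ev[OF refl _ refl]) auto
qed

text \<open>
  A quotient \<open>u = \<psi> / \<phi>\<close> of two solutions of the heat equation satisfies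
  \<open>u\<^sub>t = c * u\<^sub>x\<^sub>x + 2 * c * (\<phi>\<^sub>x / \<phi>) * u\<^sub>x\<close>, and here \<open>\<phi>\<^sub>x / \<phi> = k * u\<close>.
\<close>

lemma burgers_equation_quotient:
  fixes \<phi> \<psi> \<psi>x \<psi>xx :: "real \<Rightarrow> real \<Rightarrow> real"
  assumes pos: "\<And>x t. t > 0 \<Longrightarrow> \<phi> x t \<noteq> 0"
    and \<phi>x: "\<And>x t. t > 0 \<Longrightarrow> ((\<lambda>x. \<phi> x t) has_real_derivative k * \<psi> x t) (at x)"
    and \<phi>t: "\<And>x t. t > 0 \<Longrightarrow> ((\<lambda>t. \<phi> x t) has_real_derivative c * (k * \<psi>x x t)) (at t)"
    and \<psi>x: "\<And>x t. t > 0 \<Longrightarrow> ((\<lambda>x. \<psi> x t) has_real_derivative \<psi>x x t) (at x)"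
    and \<psi>xx: "\<And>x t. t > 0 \<Longrightarrow> ((\<lambda>x. \<psi>x x t) has_real_derivative \<psi>xx x t) (at x)"
    and \<psi>t: "\<And>x t. t > 0 \<Longrightarrow> ((\<lambda>t. \<psi> x t) has_real_derivative c * \<psi>xx x t) (at t)"
    and u: "\<And>x t. t > 0 \<Longrightarrow> u x t = \<psi> x t / \<phi> x t"
  shows "burgers_equation (- 2 * c * k) c u"
proof -
  define ut where "ut x t = (c * \<psi>xx x t * \<phi> x t - \<psi> x t * (c * (k * \<psi>x x t))) / (\<phi> x t * \<phi> x t)" for x t
  define ux where "ux x t = (\<psi>x x t * \<phi> x t - \<psi> x t * (k * \<psi> x t)) / (\<phi> x t * \<phi> x t)" for x t
  define uxx where "uxx x t = ((\<psi>xx x t * \<phi> x t + (k * \<psi> x t) * \<psi>x x t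
       - (\<psi>x x t * (k * \<psi> x t) + (k * \<psi>x x t) * \<psi> x t)) * (\<phi> x t * \<phi> x t)
     - (\<psi>x x t * \<phi> x t - \<psi> x t * (k * \<psi> x t)) * (k * \<psi> x t * \<phi> x t + k * \<psi> x t * \<phi> x t))
     / ((\<phi> x t * \<phi> x t) * (\<phi> x t * \<phi> x t))" for x t
  show ?thesis
    unfolding burgers_equation_def
  proof (rule exI[of _ ut], rule exI[of _ ux], rule exI[of _ uxx], intro allI impI conjI)
    fix x t :: real assume t: "t > 0"
    note nz = pos[OF t, of x]
    have "\<forall>\<^sub>F s in nhds t. s \<in> {0<..}"
      using t by (intro eventually_nhds_in_open) auto
    then have "\<forall>\<^sub>F s in nhds t. u x s = \<psi> x s / \<phi> x s"
      by eventually_elim (use u in auto)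
    then show "((\<lambda>s. u x s) has_real_derivative ut x t) (at t)"
      using DERIV_divide[OF \<psi>t[OF t, of x] \<phi>t[OF t, of x] nz]
      by (subst DERIV_cong_ev[OF refl _ refl]) (auto simp: ut_def)
    show "((\<lambda>y. u y t) has_real_derivative ux x t) (at x)"
      using DERIV_divide[OF \<psi>x[OF t, of x] \<phi>x[OF t, of x] nz] by (simp add: u[OF t] ux_def)
    have nz2: "\<phi> x t * \<phi> x t \<noteq> 0" using nz by simp
    show "((\<lambda>y. ux y t) has_real_derivative uxx x t) (at x)"
      unfolding ux_def uxx_def
      by (rule DERIV_divide[OF DERIV_diff[OF DERIV_mult[OF \<psi>xx[OF t] \<phi>x[OF t]]
            DERIV_mult[OF \<psi>x[OF t] DERIV_cmult[OF \<psi>x[OF t]]]] DERIV_mult[OF \<phi>x[OF t] \<phi>x[OF t]] nz2])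
    show "ut x t + - 2 * c * k * u x t * ux x t = c * uxx x t"
      unfolding ut_def ux_def uxx_def u[OF t]
      using nz by (simp add: divide_simps) (simp add: algebra_simps)
  qed
qed

section \<open>Norms and Gaussian averages\<close>

lemma Lp_norm_eq_integral:
  assumes [measurable]: "f \<in> borel_measurable borel"
    and int: "integrable lborel (\<lambda>x. \<bar>f x\<bar> powr p)"
  shows "Lp_norm p f = ennreal ((LINT x|lborel. \<bar>f x\<bar> powr p) powr (1 / p))"
proof -
  have "(\<integral>\<^sup>+x. ennreal (\<bar>f x\<bar> powr p) \<partial>lebesgue) = ennreal (LINT x|lborel. \<bar>f x\<bar> powr p)"
    unfolding nn_integral_completion by (rule nn_integral_eq_integral[OF int]) simp
  then show ?thesis
    by (simp add: Lp_norm_def integral_nonneg_AE)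
qed

lemma L1_norm_eq_integral:
  assumes [measurable]: "f \<in> borel_measurable borel" and "integrable lborel f"
  shows "Lp_norm 1 f = ennreal (LINT x|lborel. \<bar>f x\<bar>)"
  using Lp_norm_eq_integral[of f 1] assms by (simp add: integral_nonneg_AE)

text \<open>The triangle inequality for a continuous superposition of functions.\<close>

lemma L1_superposition:
  fixes P :: "real \<Rightarrow> real \<Rightarrow> real"
  assumes P: "case_prod P \<in> borel_measurable (lborel \<Otimes>\<^sub>M lborel)"
    and int: "\<And>q. integrable lborel (P q)"
    and int2: "integrable lborel (\<lambda>q. LINT x|lborel. \<bar>P q x\<bar>)"
  shows "integrable lborel (\<lambda>x. LINT q|lborel. P q x)"
    and "(LINT x|lborel. \<bar>LINT q|lborel. P q x\<bar>) \<le> (LINT q|lborel. LINT x|lborel. \<bar>P q x\<bar>)"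
proof -
  have i: "integrable (lborel \<Otimes>\<^sub>M lborel) (case_prod P)"
    by (rule lborel_pair.Fubini_integrable[OF P]) (use int int2 in auto)
  show i1: "integrable lborel (\<lambda>x. LINT q|lborel. P q x)"
    by (rule lborel_pair.integrable_snd[OF i])
  have j: "integrable (lborel \<Otimes>\<^sub>M lborel) (case_prod (\<lambda>q x. \<bar>P q x\<bar>))"
    using integrable_abs[OF i] by (simp add: case_prod_unfold)
  have "(LINT x|lborel. \<bar>LINT q|lborel. P q x\<bar>) \<le> (LINT x|lborel. LINT q|lborel. \<bar>P q x\<bar>)"
    using i1 lborel_pair.integrable_snd[OF j] by (intro integral_mono integral_abs_bound) auto
  also have "\<dots> = (LINT q|lborel. LINT x|lborel. \<bar>P q x\<bar>)"
    by (rule lborel_pair.Fubini_integral[OF j])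
  finally show "(LINT x|lborel. \<bar>LINT q|lborel. P q x\<bar>) \<le> (LINT q|lborel. LINT x|lborel. \<bar>P q x\<bar>)" .
qed

text \<open>
  The average of \<open>g\<close> against a Gaussian probability density of width \<open>s\<close>, centred at \<open>x\<close>. With
  \<open>s = sqrt (4 * c * t)\<close> it is the solution of the heat equation; in this form the limits of small and of
  large times amount to rescaling the argument of \<open>g\<close>.
\<close>

definition gauss_avg :: "(real \<Rightarrow> real) \<Rightarrow> real \<Rightarrow> real \<Rightarrow> real" where
  "gauss_avg g s x = 1 / sqrt pi * (LINT q|lborel. exp (- q\<^sup>2) * g (x - s * q))"

lemma heat_conv_eq_gauss_avg:
  assumes [measurable]: "g \<in> borel_measurable borel" and c: "c > 0" and t: "t > 0"
  shows "heat_conv c g x t = gauss_avg g (sqrt (4 * c * t)) x"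
proof -
  define s where "s = sqrt (4 * c * t)"
  have s: "s > 0" "s\<^sup>2 = 4 * c * t"
    using c t by (auto simp: s_def)
  have "(LINT y|lebesgue. exp (- ((x - y)\<^sup>2 / (4 * c * t))) * g y)
      = (LINT y|lborel. exp (- ((x - y)\<^sup>2 / s\<^sup>2)) * g y)"
    unfolding s(2) by (rule integral_completion) simp
  also have "\<dots> = s * (LINT q|lborel. exp (- q\<^sup>2) * g (x - s * q))"
    using s(1) by (subst lborel_integral_real_affine[of "- s" _ x]) (auto simp: power_mult_distrib)
  finally have "heat_conv c g x t = s / sqrt (4 * pi * c * t) * (LINT q|lborel. exp (- q\<^sup>2) * g (x - s * q))"
    by (simp add: heat_conv_def)
  also have "s / sqrt (4 * pi * c * t) = 1 / sqrt pi"
    using c t by (simp add: s_def real_sqrt_mult)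
  finally show ?thesis
    by (simp add: gauss_avg_def s_def)
qed

lemma integrable_gauss_avg:
  assumes g: "gaussian_integrable g" and s: "s > 0"
  shows "integrable lborel (\<lambda>q. exp (- q\<^sup>2) * g (x - s * q))"
proof -
  have "integrable lborel (\<lambda>y. exp (- (1 / s\<^sup>2 * (x - y)\<^sup>2)) * g y)"
    using integrable_gauss_moment[OF g, of "1 / s\<^sup>2" x 0] s by simp
  from lborel_integrable_real_affine[OF this, of "- s" x] s show ?thesis
    by (simp add: power_mult_distrib)
qed

lemma gauss_avg_bounds:
  assumes [measurable]: "g \<in> borel_measurable borel" and g: "\<And>y. A \<le> g y" "\<And>y. g y \<le> B"
  shows "A \<le> gauss_avg g s x" "gauss_avg g s x \<le> B"
proof -
  note int1 = integrable_gauss[of 1, simplified]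
  have int: "integrable lborel (\<lambda>q. exp (- q\<^sup>2) * g (x - s * q))"
  proof (rule Bochner_Integration.integrable_bound)
    show "integrable lborel (\<lambda>q. (\<bar>A\<bar> + \<bar>B\<bar>) * exp (- q\<^sup>2))"
      using int1 by (rule integrable_mult_right)
    have "\<bar>g y\<bar> \<le> \<bar>A\<bar> + \<bar>B\<bar>" for y
      using g[of y] by linarith
    then show "AE q in lborel. norm (exp (- q\<^sup>2) * g (x - s * q)) \<le> norm ((\<bar>A\<bar> + \<bar>B\<bar>) * exp (- q\<^sup>2))"
      by (auto simp: abs_mult mult.commute intro!: mult_right_mono)
  qed auto
  have I: "(LINT q|lborel. exp (- q\<^sup>2)) = sqrt pi"
    using integral_gauss[of 1] by simp
  have "(LINT q|lborel. exp (- q\<^sup>2) * A) \<le> (LINT q|lborel. exp (- q\<^sup>2) * g (x - s * q))"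
    using int int1 g by (intro integral_mono mult_left_mono) auto
  then show "A \<le> gauss_avg g s x"
    using I int1 by (simp add: gauss_avg_def field_simps)
  have "(LINT q|lborel. exp (- q\<^sup>2) * g (x - s * q)) \<le> (LINT q|lborel. exp (- q\<^sup>2) * B)"
    using int int1 g by (intro integral_mono mult_left_mono) auto
  then show "gauss_avg g s x \<le> B"
    using I int1 by (simp add: gauss_avg_def field_simps)
qed

lemma gauss_avg_tendsto:
  assumes [measurable]: "g \<in> borel_measurable borel" and g: "\<And>y. \<bar>g y\<bar> \<le> B" and cont: "isCont g x"
  shows "((\<lambda>s. gauss_avg g s x) \<longlongrightarrow> g x) (at_right 0)"
proof -
  note int1 = integrable_gauss[of 1, simplified]
  have "((\<lambda>s. LINT q|lborel. exp (- q\<^sup>2) * g (x - s * q)) \<longlongrightarrow> (LINT q|lborel. exp (- q\<^sup>2) * g x)) (at_right 0)"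
  proof (rule integral_dominated_convergence_within[where w = "\<lambda>q. exp (- q\<^sup>2) * B"])
    fix q :: real
    have "((\<lambda>s. x - s * q) \<longlongrightarrow> x - 0 * q) (at_right 0)"
      by (intro tendsto_intros)
    then have "((\<lambda>s. g (x - s * q)) \<longlongrightarrow> g x) (at_right 0)"
      using cont isCont_tendsto_compose by fastforce
    then show "((\<lambda>s. exp (- q\<^sup>2) * g (x - s * q)) \<longlongrightarrow> exp (- q\<^sup>2) * g x) (at_right 0)"
      by (rule tendsto_mult_left)
  qed (use g int1 in \<open>auto simp: abs_mult\<close>)
  from tendsto_mult_left[OF this, of "1 / sqrt pi"]
  show ?thesis
    using integral_gauss[of 1] int1 by (simp add: gauss_avg_def[abs_def])
qed

text \<open>
  The difference \<open>gauss_avg w s - w\<close> is a Gaussian superposition of the differences of \<open>w\<close> with its translates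
  by \<open>s * q\<close>, each of which is small in mean when \<open>s\<close> is small.
\<close>

lemma gauss_avg_L1:
  assumes [measurable]: "w \<in> borel_measurable borel" and w: "integrable lborel w"
  shows "\<And>s. s > 0 \<Longrightarrow> integrable lborel (gauss_avg w s)"
    and "((\<lambda>s. LINT x|lborel. \<bar>gauss_avg w s x - w x\<bar>) \<longlongrightarrow> 0) (at_right 0)"
proof -
  note int1 = integrable_gauss[of 1, simplified]
  define \<tau> where "\<tau> a = (LINT x|lborel. \<bar>w (x - a) - w x\<bar>)" for a
  have [measurable]: "\<tau> \<in> borel_measurable borel"
    unfolding \<tau>_def by measurable
  have iw: "integrable lborel (\<lambda>x. w (x - a) - w x)" for a
    using integrable_translate[OF w, of a] w by simp
  have \<tau>_nonneg: "0 \<le> \<tau> a" for a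
    by (simp add: \<tau>_def)
  have \<tau>_le: "\<tau> a \<le> 2 * (LINT x|lborel. \<bar>w x\<bar>)" for a
  proof -
    have "\<tau> a \<le> (LINT x|lborel. \<bar>w (x - a)\<bar> + \<bar>w x\<bar>)"
      unfolding \<tau>_def using iw[of a] integrable_translate[OF w, of a] w
      by (intro integral_mono) auto
    also have "\<dots> = (LINT x|lborel. \<bar>w (x - a)\<bar>) + (LINT x|lborel. \<bar>w x\<bar>)"
      using integrable_translate[OF w, of a] w by simp
    finally show ?thesis
      using integral_translate[of "\<lambda>x. \<bar>w x\<bar>" a] by simp
  qed
  have "(\<tau> \<longlongrightarrow> \<tau> 0) (at 0)"
    using L1_translation_continuous[OF w] by (simp add: \<tau>_def[abs_def])
  then have \<tau>_cont: "isCont \<tau> 0"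
    by (simp add: isCont_def)
  define P where "P s q x = exp (- q\<^sup>2) * (w (x - s * q) - w x)" for s q x
  have iP: "integrable lborel (P s q)" for s q
    unfolding P_def using iw by (intro integrable_mult_right) auto
  have nP: "(LINT x|lborel. \<bar>P s q x\<bar>) = exp (- q\<^sup>2) * \<tau> (s * q)" for s q
    by (simp add: P_def \<tau>_def abs_mult)
  have ibd: "integrable lborel (\<lambda>q. exp (- q\<^sup>2) * (2 * (LINT x|lborel. \<bar>w x\<bar>)))"
    using int1 by simp
  have iP2: "integrable lborel (\<lambda>q. LINT x|lborel. \<bar>P s q x\<bar>)" for s
    unfolding nP
    by (rule Bochner_Integration.integrable_bound[OF ibd])
       (auto simp: abs_mult \<tau>_nonneg abs_of_nonneg[OF order_trans[OF \<tau>_nonneg \<tau>_le]] intro!: \<tau>_le)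
  have mP: "case_prod (P s) \<in> borel_measurable (lborel \<Otimes>\<^sub>M lborel)" for s
    unfolding P_def by measurable
  have diff: "gauss_avg w s x - w x = 1 / sqrt pi * (LINT q|lborel. P s q x)" if s: "s > 0" for s x
  proof -
    have "(LINT q|lborel. P s q x)
        = (LINT q|lborel. exp (- q\<^sup>2) * w (x - s * q)) - (LINT q|lborel. exp (- q\<^sup>2) * w x)"
      unfolding P_def right_diff_distrib
      using integrable_gauss_avg[OF gaussian_integrable_integrable[OF _ w] s] int1
      by (intro Bochner_Integration.integral_diff) auto
    then show ?thesis
      using integral_gauss[of 1] int1 by (simp add: gauss_avg_def field_simps)
  qed
  have iD: "integrable lborel (\<lambda>x. gauss_avg w s x - w x)" if "s > 0" for s
    unfolding diff[OF that] by (intro integrable_mult_right L1_superposition(1)[OF mP iP iP2])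
  show "integrable lborel (gauss_avg w s)" if "s > 0" for s
    using Bochner_Integration.integrable_add[OF iD[OF that] w] by simp
  have "((\<lambda>s. LINT q|lborel. exp (- q\<^sup>2) * \<tau> (s * q)) \<longlongrightarrow> (LINT q::real|lborel. 0)) (at_right 0)"
  proof (rule integral_dominated_convergence_within[OF _ _ ibd])
    fix q :: real
    have "((\<lambda>s. s * q) \<longlongrightarrow> 0 * q) (at_right 0)"
      by (intro tendsto_intros)
    then have "((\<lambda>s. \<tau> (s * q)) \<longlongrightarrow> \<tau> 0) (at_right 0)"
      using isCont_tendsto_compose[OF \<tau>_cont] by simp
    then have "((\<lambda>s. exp (- q\<^sup>2) * \<tau> (s * q)) \<longlongrightarrow> exp (- q\<^sup>2) * \<tau> 0) (at_right 0)"
      by (rule tendsto_mult_left)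
    then show "((\<lambda>s. exp (- q\<^sup>2) * \<tau> (s * q)) \<longlongrightarrow> 0) (at_right 0)"
      by (simp add: \<tau>_def)
  qed (use \<tau>_le \<tau>_nonneg in \<open>auto simp: abs_mult\<close>)
  then have lim: "((\<lambda>s. 1 / sqrt pi * (LINT q|lborel. exp (- q\<^sup>2) * \<tau> (s * q))) \<longlongrightarrow> 0) (at_right 0)"
    using tendsto_mult_left[of _ 0 "at_right 0" "1 / sqrt pi"] by simp
  show "((\<lambda>s. LINT x|lborel. \<bar>gauss_avg w s x - w x\<bar>) \<longlongrightarrow> 0) (at_right 0)"
  proof (rule tendsto_sandwich[OF _ _ tendsto_const lim])
    show "\<forall>\<^sub>F s in at_right 0. (LINT x|lborel. \<bar>gauss_avg w s x - w x\<bar>)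
        \<le> 1 / sqrt pi * (LINT q|lborel. exp (- q\<^sup>2) * \<tau> (s * q))"
      unfolding eventually_at_filter
    proof (intro always_eventually allI impI)
      fix s :: real assume s: "s \<in> {0<..}"
      have "(LINT x|lborel. \<bar>gauss_avg w s x - w x\<bar>) = 1 / sqrt pi * (LINT x|lborel. \<bar>LINT q|lborel. P s q x\<bar>)"
        using s by (simp add: diff abs_mult)
      also have "\<dots> \<le> 1 / sqrt pi * (LINT q|lborel. LINT x|lborel. \<bar>P s q x\<bar>)"
        by (intro mult_left_mono L1_superposition(2)[OF mP iP iP2]) simp
      finally show "(LINT x|lborel. \<bar>gauss_avg w s x - w x\<bar>)
        \<le> 1 / sqrt pi * (LINT q|lborel. exp (- q\<^sup>2) * \<tau> (s * q))"
        unfolding nP .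
    qed
  qed simp
qed

section \<open>The Hopf-Cole solution: equation and initial value\<close>

text \<open>
  The initial value is taken Borel measurable, so that joint measurability in two variables, as Fubini's
  theorem demands, is available. A Lebesgue measurable one differs from such a function on a null
  set only, which alters neither the representation nor the norms.
\<close>

locale hopf_cole_data =
  fixes b c :: real and u0 :: "real \<Rightarrow> real"
  assumes b: "b \<noteq> 0" and c: "c > 0"
    and u0_borel [measurable]: "u0 \<in> borel_measurable borel"
    and u0: "integrable lborel u0"
begin

definition k :: real where "k = - (b / (2 * c))"
definition \<phi>0 :: "real \<Rightarrow> real" where "\<phi>0 y = exp (k * primitive u0 y)"
definition w :: "real \<Rightarrow> real" where "w y = \<phi>0 y * u0 y"
text \<open>A bound for the exponent of \<open>\<phi>0\<close>; it keeps all averages of \<open>\<phi>0\<close> away from \<open>0\<close> and from infinity.\<close>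

definition B :: real where "B = \<bar>k\<bar> * (LINT y|lborel. \<bar>u0 y\<bar>)"

lemma phi0_eq: "phi0 b c u0 = \<phi>0"
proof
  fix x
  have "(LINT \<xi>:{..x}|lebesgue. u0 \<xi>) = primitive u0 x"
    unfolding set_lebesgue_integral_def primitive_def real_scaleR_def
    by (rule integral_completion) simp
  then show "phi0 b c u0 x = \<phi>0 x"
    by (simp add: phi0_def \<phi>0_def k_def)
qed

lemma \<phi>0_bounds: "exp (- B) \<le> \<phi>0 y" "\<phi>0 y \<le> exp B"
proof -
  have "\<bar>k * primitive u0 y\<bar> \<le> B"
    using abs_primitive_le[OF u0, of y] by (simp add: B_def abs_mult mult_left_mono)
  then show "exp (- B) \<le> \<phi>0 y" "\<phi>0 y \<le> exp B"
    by (auto simp: \<phi>0_def abs_le_iff)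
qed

lemma abs_\<phi>0_le: "\<bar>\<phi>0 y\<bar> \<le> exp B"
  using \<phi>0_bounds[of y] by (simp add: \<phi>0_def)

lemma isCont_\<phi>0: "isCont \<phi>0 x"
  unfolding \<phi>0_def[abs_def] by (intro continuous_intros isCont_primitive u0)

lemma \<phi>0_borel [measurable]: "\<phi>0 \<in> borel_measurable borel"
  by (intro borel_measurable_continuous_onI continuous_at_imp_continuous_on ballI isCont_\<phi>0)

lemma w_borel [measurable]: "w \<in> borel_measurable borel"
  unfolding w_def[abs_def] by measurable

lemma w: "integrable lborel w"
  using exp_primitive(2)[OF u0, of k] by (simp add: w_def[abs_def] \<phi>0_def)

text \<open>In differential form: \<open>\<phi>0\<close> has the derivative \<open>k * w\<close> almost everywhere.\<close>

lemma \<phi>0_primitive: "\<phi>0 y = 1 + k * primitive w y"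
  using exp_primitive(1)[OF u0, of k y] by (simp add: w_def[abs_def] \<phi>0_def)

lemma gaussian_integrable_\<phi>0: "gaussian_integrable \<phi>0"
  by (rule gaussian_integrable_bounded[OF _ abs_\<phi>0_le]) simp

lemma gaussian_integrable_w: "gaussian_integrable w"
  by (rule gaussian_integrable_integrable[OF _ w]) simp

definition \<Phi> :: "real \<Rightarrow> real \<Rightarrow> real" where "\<Phi> = gauss_avg \<phi>0"
definition \<Psi> :: "real \<Rightarrow> real \<Rightarrow> real" where "\<Psi> = gauss_avg w"

lemma \<Phi>_bounds: "exp (- B) \<le> \<Phi> s x" "\<Phi> s x \<le> exp B"
  unfolding \<Phi>_def by (rule gauss_avg_bounds[OF \<phi>0_borel \<phi>0_bounds])+

lemma \<Phi>_pos: "\<Phi> s x > 0"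
  using \<Phi>_bounds(1)[of s x] by (rule less_le_trans[rotated]) simp

lemma heat_conv_\<phi>0: "t > 0 \<Longrightarrow> heat_conv c \<phi>0 x t = \<Phi> (sqrt (4 * c * t)) x"
  unfolding \<Phi>_def by (rule heat_conv_eq_gauss_avg[OF \<phi>0_borel c])

lemma heat_conv_w: "t > 0 \<Longrightarrow> heat_conv c w x t = \<Psi> (sqrt (4 * c * t)) x"
  unfolding \<Psi>_def by (rule heat_conv_eq_gauss_avg[OF w_borel c])

lemma hopf_cole_eq:
  assumes "t > 0"
  shows "hopf_cole b c u0 x t = \<Psi> (sqrt (4 * c * t)) x / \<Phi> (sqrt (4 * c * t)) x"
  using heat_conv_\<phi>0[OF assms, of x] heat_conv_w[OF assms, of x]
  by (simp add: hopf_cole_def phi0_eq w_def[abs_def])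

text \<open>
  By \<open>\<phi>\<^sub>x = k * \<psi>\<close> the second derivative of \<open>\<phi>\<close> is \<open>k * \<psi>\<^sub>x\<close>, which turns the heat equation for \<open>\<phi>\<close> into
  \<open>\<phi>\<^sub>t = c * k * \<psi>\<^sub>x\<close>.
\<close>

lemma burgers_equation_hopf_cole:
  assumes u: "\<And>x t. t > 0 \<Longrightarrow> u x t = hopf_cole b c u0 x t"
  shows "burgers_equation b c u"
proof -
  define a where "a t = 1 / (4 * c * t)" for t
  have a: "a t > 0" if "t > 0" for t
    using c that by (simp add: a_def)
  define \<psi>x where "\<psi>x x t = sqrt (a t / pi) * (- 2 * a t * gauss_moment w 1 (a t) x)" for x t
  define \<psi>xx where "\<psi>xx x t = sqrt (a t / pi) *
      (- 2 * a t * (gauss_moment w 0 (a t) x - 2 * a t * gauss_moment w 2 (a t) x))" for x t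
  define \<phi>x where "\<phi>x x t = sqrt (a t / pi) * (- 2 * a t * gauss_moment \<phi>0 1 (a t) x)" for x t
  define \<phi>xx where "\<phi>xx x t = sqrt (a t / pi) *
      (- 2 * a t * (gauss_moment \<phi>0 0 (a t) x - 2 * a t * gauss_moment \<phi>0 2 (a t) x))" for x t
  note gi = gaussian_integrable_w gaussian_integrable_\<phi>0
  have \<phi>x_eq: "\<phi>x x t = k * heat_conv c w x t" if "t > 0" for x t
  proof -
    have "- 2 * a t * gauss_moment \<phi>0 1 (a t) x = k * gauss_moment w 0 (a t) x"
      using gauss_moment_primitive[OF w a[OF that], of 1 k x]
      by (simp add: \<phi>0_primitive[abs_def])
    then show ?thesis
      using heat_conv_gauss_moment[OF w_borel c that] by (simp add: \<phi>x_def a_def)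
  qed
  have \<psi>x: "((\<lambda>x. heat_conv c w x t) has_real_derivative \<psi>x x t) (at x)" if "t > 0" for x t
    using heat_conv_deriv_x[OF gi(1) c that] unfolding \<psi>x_def a_def .
  have \<phi>xx_eq: "\<phi>xx x t = k * \<psi>x x t" if "t > 0" for x t
  proof -
    have "((\<lambda>x. \<phi>x x t) has_real_derivative \<phi>xx x t) (at x)"
      using heat_conv_deriv_xx[OF gi(2) c that] unfolding \<phi>x_def \<phi>xx_def a_def .
    moreover have "((\<lambda>x. \<phi>x x t) has_real_derivative k * \<psi>x x t) (at x)"
      unfolding \<phi>x_eq[OF that] by (rule DERIV_cmult[OF \<psi>x[OF that]])
    ultimately show ?thesis
      by (rule DERIV_unique)
  qed
  have "burgers_equation (- 2 * c * k) c u"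
  proof (rule burgers_equation_quotient[where \<phi> = "heat_conv c \<phi>0" and \<psi> = "heat_conv c w"])
    fix x t :: real assume t: "t > 0"
    show "heat_conv c \<phi>0 x t \<noteq> 0"
      using \<Phi>_pos[of "sqrt (4 * c * t)" x] by (simp add: heat_conv_\<phi>0[OF t])
    show "((\<lambda>x. heat_conv c \<phi>0 x t) has_real_derivative k * heat_conv c w x t) (at x)"
      using heat_conv_deriv_x[OF gi(2) c t] unfolding \<phi>x_eq[OF t, symmetric] \<phi>x_def a_def .
    show "((\<lambda>t. heat_conv c \<phi>0 x t) has_real_derivative c * (k * \<psi>x x t)) (at t)"
      using heat_conv_deriv_t[OF gi(2) c t] unfolding \<phi>xx_eq[OF t, symmetric] \<phi>xx_def a_def .
    show "((\<lambda>x. \<psi>x x t) has_real_derivative \<psi>xx x t) (at x)"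
      using heat_conv_deriv_xx[OF gi(1) c t] unfolding \<psi>x_def \<psi>xx_def a_def .
    show "((\<lambda>t. heat_conv c w x t) has_real_derivative c * \<psi>xx x t) (at t)"
      using heat_conv_deriv_t[OF gi(1) c t] unfolding \<psi>xx_def a_def .
    show "u x t = heat_conv c w x t / heat_conv c \<phi>0 x t"
      using u[OF t] hopf_cole_eq[OF t] heat_conv_\<phi>0[OF t] heat_conv_w[OF t] by simp
  qed (use \<psi>x in auto)
  moreover have "- 2 * c * k = b"
    using c by (simp add: k_def)
  ultimately show ?thesis by simp
qed

text \<open>
  Because \<open>w = \<phi>0 * u0\<close>, the error is \<open>((\<Psi> - w) + u0 * (\<phi>0 - \<Phi>)) / \<Phi>\<close>. The first term is small in mean as an
  approximation by averages, the second one by dominated convergence, since \<open>\<phi>0\<close> is continuous and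
  bounded.
\<close>

lemma initial_value_hopf_cole:
  assumes u: "\<And>x t. t > 0 \<Longrightarrow> u x t = hopf_cole b c u0 x t"
  shows "initial_value_L1 u0 u"
proof -
  have [measurable]: "\<Phi> s \<in> borel_measurable borel" "\<Psi> s \<in> borel_measurable borel" for s
    unfolding \<Phi>_def \<Psi>_def gauss_avg_def[abs_def] by measurable
  define v where "v s x = \<Psi> s x / \<Phi> s x - u0 x" for s x
  define N where "N s = (LINT x|lborel. \<bar>\<Psi> s x - w x\<bar>) + (LINT x|lborel. \<bar>u0 x\<bar> * \<bar>\<phi>0 x - \<Phi> s x\<bar>)" for s
  have "\<bar>\<phi>0 x - \<Phi> s x\<bar> \<le> 2 * exp B" for s x
    using \<phi>0_bounds[of x] \<Phi>_bounds[where s = s and x = x] exp_gt_zero[of "- B"] by linarith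
  then have dom: "\<bar>\<bar>u0 x\<bar> * \<bar>\<phi>0 x - \<Phi> s x\<bar>\<bar> \<le> \<bar>u0 x\<bar> * (2 * exp B)" for s x
    by (simp add: abs_mult mult_left_mono)
  have i0: "integrable lborel (\<lambda>x. \<bar>u0 x\<bar> * (2 * exp B))"
    using u0 by simp
  have i1: "integrable lborel (\<lambda>x. \<bar>u0 x\<bar> * \<bar>\<phi>0 x - \<Phi> s x\<bar>)" for s
    using dom by (intro Bochner_Integration.integrable_bound[OF i0]) (auto simp: abs_mult)
  have "((\<lambda>s. LINT x|lborel. \<bar>u0 x\<bar> * \<bar>\<phi>0 x - \<Phi> s x\<bar>) \<longlongrightarrow> (LINT x::real|lborel. 0)) (at_right 0)"
  proof (rule integral_dominated_convergence_within[OF _ _ i0])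
    fix x
    have "((\<lambda>s. \<Phi> s x) \<longlongrightarrow> \<phi>0 x) (at_right 0)"
      unfolding \<Phi>_def by (rule gauss_avg_tendsto[OF \<phi>0_borel abs_\<phi>0_le isCont_\<phi>0])
    then have "((\<lambda>s. \<bar>u0 x\<bar> * \<bar>\<phi>0 x - \<Phi> s x\<bar>) \<longlongrightarrow> \<bar>u0 x\<bar> * \<bar>\<phi>0 x - \<phi>0 x\<bar>) (at_right 0)"
      by (intro tendsto_intros)
    then show "((\<lambda>s. \<bar>u0 x\<bar> * \<bar>\<phi>0 x - \<Phi> s x\<bar>) \<longlongrightarrow> 0) (at_right 0)"
      by simp
  qed (use dom in auto)
  then have N: "((\<lambda>s. exp B * N s) \<longlongrightarrow> 0) (at_right 0)"
    using tendsto_mult_left[OF tendsto_add[OF gauss_avg_L1(2)[OF w_borel w]], of _ 0 "exp B"]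
    by (simp add: N_def \<Psi>_def)
  have v: "integrable lborel (v s)" "(LINT x|lborel. \<bar>v s x\<bar>) \<le> exp B * N s" if s: "s > 0" for s
  proof -
    have i2: "integrable lborel (\<lambda>x. \<bar>\<Psi> s x - w x\<bar>)"
      unfolding \<Psi>_def using gauss_avg_L1(1)[OF w_borel w s] w by simp
    then have i3: "integrable lborel (\<lambda>x. exp B * (\<bar>\<Psi> s x - w x\<bar> + \<bar>u0 x\<bar> * \<bar>\<phi>0 x - \<Phi> s x\<bar>))"
      using i1 by (intro integrable_mult_right Bochner_Integration.integrable_add)
    have bd: "\<bar>v s x\<bar> \<le> exp B * (\<bar>\<Psi> s x - w x\<bar> + \<bar>u0 x\<bar> * \<bar>\<phi>0 x - \<Phi> s x\<bar>)" for x
    proof -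
      have "v s x = 1 / \<Phi> s x * ((\<Psi> s x - w x) + u0 x * (\<phi>0 x - \<Phi> s x))"
        using \<Phi>_pos[of s x] by (simp add: v_def w_def field_simps)
      also have "\<bar>\<dots>\<bar> = 1 / \<Phi> s x * \<bar>(\<Psi> s x - w x) + u0 x * (\<phi>0 x - \<Phi> s x)\<bar>"
        using \<Phi>_pos[of s x] by (simp add: abs_mult)
      also have "\<dots> \<le> exp B * (\<bar>\<Psi> s x - w x\<bar> + \<bar>u0 x\<bar> * \<bar>\<phi>0 x - \<Phi> s x\<bar>)"
      proof (rule mult_mono)
        show "1 / \<Phi> s x \<le> exp B"
          using \<Phi>_bounds(1)[of s x] \<Phi>_pos[of s x] by (simp add: exp_minus field_simps)
        show "\<bar>(\<Psi> s x - w x) + u0 x * (\<phi>0 x - \<Phi> s x)\<bar> \<le> \<bar>\<Psi> s x - w x\<bar> + \<bar>u0 x\<bar> * \<bar>\<phi>0 x - \<Phi> s x\<bar>"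
          by (metis abs_mult abs_triangle_ineq)
      qed auto
      finally show ?thesis .
    qed
    show iv: "integrable lborel (v s)"
      by (rule Bochner_Integration.integrable_bound[OF i3])
         (auto simp: v_def[abs_def] intro!: order_trans[OF bd[unfolded v_def]])
    have "(LINT x|lborel. \<bar>v s x\<bar>) \<le> (LINT x|lborel. exp B * (\<bar>\<Psi> s x - w x\<bar> + \<bar>u0 x\<bar> * \<bar>\<phi>0 x - \<Phi> s x\<bar>))"
      using iv i3 bd by (intro integral_mono) auto
    also have "\<dots> = exp B * N s"
      using i1 i2 by (simp add: N_def)
    finally show "(LINT x|lborel. \<bar>v s x\<bar>) \<le> exp B * N s" .
  qed
  have lim: "((\<lambda>s. LINT x|lborel. \<bar>v s x\<bar>) \<longlongrightarrow> 0) (at_right 0)"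
    by (rule tendsto_sandwich[OF _ _ tendsto_const N])
       (use v in \<open>auto simp: eventually_at_filter\<close>)
  have "filterlim (\<lambda>t. sqrt (4 * c * t)) (at_right 0) (at_right 0)"
    using c by real_asymp
  from filterlim_compose[OF lim this]
  have "((\<lambda>t. LINT x|lborel. \<bar>v (sqrt (4 * c * t)) x\<bar>) \<longlongrightarrow> 0) (at_right 0)" .
  then have "((\<lambda>t. ennreal (LINT x|lborel. \<bar>v (sqrt (4 * c * t)) x\<bar>)) \<longlongrightarrow> ennreal 0) (at_right 0)"
    by (rule tendsto_ennrealI)
  moreover have "\<forall>\<^sub>F t in at_right 0. ennreal (LINT x|lborel. \<bar>v (sqrt (4 * c * t)) x\<bar>)
      = Lp_norm 1 (\<lambda>x. u x t - u0 x)"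
    unfolding eventually_at_filter
  proof (intro always_eventually allI impI)
    fix t :: real assume t: "t \<in> {0<..}"
    have eq: "(\<lambda>x. u x t - u0 x) = v (sqrt (4 * c * t))"
      using t u by (auto simp: v_def hopf_cole_eq)
    show "ennreal (LINT x|lborel. \<bar>v (sqrt (4 * c * t)) x\<bar>) = Lp_norm 1 (\<lambda>x. u x t - u0 x)"
      unfolding eq using v(1)[of "sqrt (4 * c * t)"] t c
      by (intro L1_norm_eq_integral[symmetric]) (auto simp: v_def[abs_def])
  qed
  ultimately show ?thesis
    unfolding initial_value_L1_def using Lim_transform_eventually by fastforce
qed

end

section \<open>Convergence of norms\<close>

lemma abs_powr_diff_le:
  fixes a b C p :: real
  assumes p: "p \<ge> 1" and a: "\<bar>a\<bar> \<le> C" and b: "\<bar>b\<bar> \<le> C"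
  shows "\<bar>\<bar>a\<bar> powr p - \<bar>b\<bar> powr p\<bar> \<le> p * C powr (p - 1) * \<bar>a - b\<bar>"
proof -
  have *: "\<bar>y powr p - x powr p\<bar> \<le> p * C powr (p - 1) * (y - x)" if xy: "0 \<le> x" "x < y" "y \<le> C" for x y
  proof -
    have "continuous_on {x..y} (\<lambda>z. z powr p)"
      using xy p by (intro continuous_on_powr' continuous_intros) auto
    moreover have "\<And>z. x < z \<Longrightarrow> z < y \<Longrightarrow> (\<lambda>z. z powr p) differentiable (at z)"
      using xy by (metis has_real_derivative_powr le_less_trans real_differentiable_def)
    ultimately obtain l z where z: "x < z" "z < y" "((\<lambda>z. z powr p) has_real_derivative l) (at z)"
      "y powr p - x powr p = (y - x) * l"
      using MVT[OF xy(2), of "\<lambda>z. z powr p"] by blast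
    have "((\<lambda>z. z powr p) has_real_derivative p * z powr (p - 1)) (at z)"
      using z xy by (intro has_real_derivative_powr) auto
    then have l: "l = p * z powr (p - 1)"
      using z(3) DERIV_unique by blast
    have "z powr (p - 1) \<le> C powr (p - 1)"
      using z xy p by (intro powr_mono2) auto
    then have "0 \<le> l" "l \<le> p * C powr (p - 1)"
      using p by (auto simp: l)
    then show ?thesis
      using z(4) xy by (simp add: abs_mult mult.commute mult_left_mono)
  qed
  have C: "0 \<le> p * C powr (p - 1)"
    using p by simp
  consider "\<bar>a\<bar> < \<bar>b\<bar>" | "\<bar>a\<bar> = \<bar>b\<bar>" | "\<bar>b\<bar> < \<bar>a\<bar>" by linarith
  then show ?thesis
  proof cases
    case 1
    then have "\<bar>\<bar>b\<bar> powr p - \<bar>a\<bar> powr p\<bar> \<le> p * C powr (p - 1) * (\<bar>b\<bar> - \<bar>a\<bar>)"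
      using b by (intro *) auto
    also have "\<dots> \<le> p * C powr (p - 1) * \<bar>a - b\<bar>"
      using C by (intro mult_left_mono) auto
    finally show ?thesis by (simp add: abs_minus_commute)
  next
    case 2
    then show ?thesis using C by simp
  next
    case 3
    then have "\<bar>\<bar>a\<bar> powr p - \<bar>b\<bar> powr p\<bar> \<le> p * C powr (p - 1) * (\<bar>a\<bar> - \<bar>b\<bar>)"
      using a by (intro *) auto
    also have "\<dots> \<le> p * C powr (p - 1) * \<bar>a - b\<bar>"
      using C by (intro mult_left_mono) auto
    finally show ?thesis .
  qed
qed

lemma integrable_powr_bounded:
  assumes f: "integrable lborel f" and C: "\<And>x. \<bar>f x\<bar> \<le> C" and p: "p \<ge> 1"
  shows "integrable lborel (\<lambda>x. \<bar>f x :: real\<bar> powr p)"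
proof -
  have [measurable]: "f \<in> borel_measurable lborel"
    using f by auto
  have i: "integrable lborel (\<lambda>x. p * C powr (p - 1) * f x)"
    using f by simp
  have "\<bar>f x\<bar> powr p \<le> \<bar>p * C powr (p - 1) * f x\<bar>" for x
    using abs_powr_diff_le[OF p C[of x], of 0] order_trans[OF abs_ge_zero C[of x]] p
    by (simp add: abs_mult)
  then show ?thesis
    by (intro Bochner_Integration.integrable_bound[OF i]) auto
qed

text \<open>
  On bounded functions the power \<open>p\<close> is Lipschitz continuous, so convergence in mean of a uniformly
  bounded family gives convergence of all the power integrals.
\<close>

lemma Lp_integral_tendsto:
  fixes f :: "real \<Rightarrow> real \<Rightarrow> real"
  assumes f: "\<And>s. s > 0 \<Longrightarrow> integrable lborel (f s)" "\<And>s x. s > 0 \<Longrightarrow> \<bar>f s x\<bar> \<le> C"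
    and g: "integrable lborel g" "\<And>x. \<bar>g x\<bar> \<le> C"
    and lim: "((\<lambda>s. LINT x|lborel. \<bar>f s x - g x\<bar>) \<longlongrightarrow> 0) at_top" and p: "p \<ge> 1"
  shows "((\<lambda>s. LINT x|lborel. \<bar>f s x\<bar> powr p) \<longlongrightarrow> (LINT x|lborel. \<bar>g x\<bar> powr p)) at_top"
proof -
  let ?L = "p * C powr (p - 1)"
  have "((\<lambda>s. ?L * (LINT x|lborel. \<bar>f s x - g x\<bar>)) \<longlongrightarrow> 0) at_top"
    using tendsto_mult_left[OF lim, of ?L] by simp
  then have "((\<lambda>s. (LINT x|lborel. \<bar>f s x\<bar> powr p) - (LINT x|lborel. \<bar>g x\<bar> powr p)) \<longlongrightarrow> 0) at_top"
  proof (rule Lim_null_comparison[rotated])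
    show "\<forall>\<^sub>F s in at_top. norm ((LINT x|lborel. \<bar>f s x\<bar> powr p) - (LINT x|lborel. \<bar>g x\<bar> powr p))
        \<le> ?L * (LINT x|lborel. \<bar>f s x - g x\<bar>)"
      using eventually_gt_at_top[of "0::real"]
    proof eventually_elim
      case (elim s)
      note i = integrable_powr_bounded[OF f(1)[OF elim] f(2)[OF elim] p] integrable_powr_bounded[OF g p]
      have "\<bar>(LINT x|lborel. \<bar>f s x\<bar> powr p) - (LINT x|lborel. \<bar>g x\<bar> powr p)\<bar>
          = \<bar>LINT x|lborel. \<bar>f s x\<bar> powr p - \<bar>g x\<bar> powr p\<bar>"
        using i by simp
      also have "\<dots> \<le> (LINT x|lborel. \<bar>\<bar>f s x\<bar> powr p - \<bar>g x\<bar> powr p\<bar>)"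
        by (rule integral_abs_bound)
      also have "\<dots> \<le> (LINT x|lborel. ?L * \<bar>f s x - g x\<bar>)"
        using i f(1)[OF elim] g(1) abs_powr_diff_le[OF p f(2)[OF elim] g(2)]
        by (intro integral_mono integrable_mult_right integrable_abs Bochner_Integration.integrable_diff) auto
      finally show ?case by simp
    qed
  qed
  then show ?thesis
    by (simp only: LIM_zero_iff)
qed

lemma Linf_norm_eq_SUP:
  assumes "\<And>x. \<bar>f x\<bar> \<le> C"
  shows "Linf_norm f = ennreal (SUP x. \<bar>f x\<bar>)"
proof (rule antisym)
  have bdd: "bdd_above (range (\<lambda>x. \<bar>f x\<bar>))"
    using assms by (auto intro!: bdd_aboveI[of _ C])
  show le: "Linf_norm f \<le> ennreal (SUP x. \<bar>f x\<bar>)"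
    unfolding Linf_norm_def by (intro SUP_least ennreal_leI cSUP_upper bdd) auto
  then obtain r where r: "Linf_norm f = ennreal r" "r \<ge> 0"
    by (cases "Linf_norm f") (auto simp: top_unique)
  have "\<bar>f x\<bar> \<le> r" for x
  proof -
    have "ennreal \<bar>f x\<bar> \<le> ennreal r"
      unfolding r(1)[symmetric] Linf_norm_def by (rule SUP_upper) simp
    then show ?thesis using r by simp
  qed
  then show "ennreal (SUP x. \<bar>f x\<bar>) \<le> Linf_norm f"
    unfolding r(1) by (intro ennreal_leI cSUP_least) auto
qed

lemma SUP_abs_scale:
  fixes f :: "real \<Rightarrow> real"
  assumes f: "\<And>x. \<bar>f x\<bar> \<le> C" and a: "a \<ge> 0"
  shows "(SUP x. a * \<bar>f x\<bar>) = a * (SUP x. \<bar>f x\<bar>)"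
proof (cases "a = 0")
  case False
  then have a: "a > 0" using a by simp
  have bdd: "bdd_above (range (\<lambda>x. \<bar>f x\<bar>))"
    using f by (auto intro!: bdd_aboveI[of _ C])
  have bdd2: "bdd_above (range (\<lambda>x. a * \<bar>f x\<bar>))"
    using f a by (auto intro!: bdd_aboveI[of _ "a * C"])
  show ?thesis
  proof (rule antisym)
    show "(SUP x. a * \<bar>f x\<bar>) \<le> a * (SUP x. \<bar>f x\<bar>)"
      using a by (intro cSUP_least mult_left_mono cSUP_upper bdd) auto
    have "\<bar>f x\<bar> \<le> (SUP x. a * \<bar>f x\<bar>) / a" for x
      using cSUP_upper[OF _ bdd2, of x] a by (simp add: field_simps)
    then have "(SUP x. \<bar>f x\<bar>) \<le> (SUP x. a * \<bar>f x\<bar>) / a"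
      by (intro cSUP_least) auto
    then show "a * (SUP x. \<bar>f x\<bar>) \<le> (SUP x. a * \<bar>f x\<bar>)"
      using a by (simp add: field_simps)
  qed
qed simp

lemma abs_SUP_abs_diff_le:
  fixes f g :: "real \<Rightarrow> real"
  assumes f: "\<And>x. \<bar>f x\<bar> \<le> C" and g: "\<And>x. \<bar>g x\<bar> \<le> C" and d: "\<And>x. \<bar>f x - g x\<bar> \<le> d"
  shows "\<bar>(SUP x. \<bar>f x\<bar>) - (SUP x. \<bar>g x\<bar>)\<bar> \<le> d"
proof -
  have *: "(SUP x. \<bar>f x\<bar>) \<le> (SUP x. \<bar>g x\<bar>) + d"
    if g: "\<And>x. \<bar>g x\<bar> \<le> C" and d: "\<And>x. \<bar>f x - g x\<bar> \<le> d" for f g :: "real \<Rightarrow> real"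
  proof (rule cSUP_least)
    fix x :: real
    have "\<bar>g x\<bar> \<le> (SUP x. \<bar>g x\<bar>)"
      using g by (intro cSUP_upper bdd_aboveI[of _ C]) auto
    then show "\<bar>f x\<bar> \<le> (SUP x. \<bar>g x\<bar>) + d"
      using d[of x] by linarith
  qed simp
  show ?thesis
    using *[OF g d] *[OF f, of g] d by (simp add: abs_le_iff abs_minus_commute algebra_simps)
qed

section \<open>Convergence to the self-similar profile\<close>

text \<open>
  The extra factor \<open>exp (- \<xi>\<^sup>2)\<close> is what makes convergence of the averages uniform: half of it, combined
  with the kernel, is bounded by \<open>exp (- \<eta>\<^sup>2 / 3)\<close> for every \<open>\<xi>\<close>, because
  \<open>\<xi>\<^sup>2 / 2 + (\<xi> - \<eta>)\<^sup>2 = 3 / 2 * (\<xi> - 2 * \<eta> / 3)\<^sup>2 + \<eta>\<^sup>2 / 3\<close>.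
\<close>

lemma gauss_avg_diff_le:
  assumes [measurable]: "g \<in> borel_measurable borel" "h \<in> borel_measurable borel"
    and g: "\<And>y. \<bar>g y\<bar> \<le> C" and h: "\<And>y. \<bar>h y\<bar> \<le> C"
  shows "exp (- \<xi>\<^sup>2) * \<bar>gauss_avg g 1 \<xi> - gauss_avg h 1 \<xi>\<bar>
    \<le> exp (- (1 / 2 * \<xi>\<^sup>2)) * (LINT \<eta>|lborel. exp (- (1 / 3 * \<eta>\<^sup>2)) * \<bar>g \<eta> - h \<eta>\<bar>)"
proof -
  have avg: "gauss_avg f 1 \<xi> = 1 / sqrt pi * (LINT \<eta>|lborel. exp (- (\<xi> - \<eta>)\<^sup>2) * f \<eta>)" for f
    using integral_reflect_translate[of "\<lambda>q. exp (- q\<^sup>2) * f (\<xi> - q)" \<xi>] by (simp add: gauss_avg_def)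
  have i: "integrable lborel (\<lambda>\<eta>. exp (- (\<xi> - \<eta>)\<^sup>2) * f \<eta>)" if "gaussian_integrable f" for f
    using integrable_gauss_moment[OF that, of 1 \<xi> 0] by simp
  note gi = i[OF gaussian_integrable_bounded[OF assms(1) g]] i[OF gaussian_integrable_bounded[OF assms(2) h]]
  have gh: "gaussian_integrable (\<lambda>\<eta>. \<bar>g \<eta> - h \<eta>\<bar>)"
  proof (rule gaussian_integrable_bounded)
    show "\<bar>\<bar>g y - h y\<bar>\<bar> \<le> 2 * C" for y
      using g[of y] h[of y] by linarith
  qed simp
  have id: "integrable lborel (\<lambda>\<eta>. exp (- (\<xi> - \<eta>)\<^sup>2) * \<bar>g \<eta> - h \<eta>\<bar>)"
    by (rule i[OF gh])
  have "\<bar>gauss_avg g 1 \<xi> - gauss_avg h 1 \<xi>\<bar>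
      = 1 / sqrt pi * \<bar>LINT \<eta>|lborel. exp (- (\<xi> - \<eta>)\<^sup>2) * (g \<eta> - h \<eta>)\<bar>"
  proof -
    have "(LINT \<eta>|lborel. exp (- (\<xi> - \<eta>)\<^sup>2) * (g \<eta> - h \<eta>))
        = (LINT \<eta>|lborel. exp (- (\<xi> - \<eta>)\<^sup>2) * g \<eta>) - (LINT \<eta>|lborel. exp (- (\<xi> - \<eta>)\<^sup>2) * h \<eta>)"
      unfolding right_diff_distrib by (rule Bochner_Integration.integral_diff[OF gi])
    then show ?thesis
      unfolding avg right_diff_distrib[symmetric] by (simp add: abs_mult)
  qed
  also have "\<dots> \<le> 1 * (LINT \<eta>|lborel. \<bar>exp (- (\<xi> - \<eta>)\<^sup>2) * (g \<eta> - h \<eta>)\<bar>)"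
    using pi_ge_two by (intro mult_mono integral_abs_bound) auto
  also have "\<dots> = (LINT \<eta>|lborel. exp (- (\<xi> - \<eta>)\<^sup>2) * \<bar>g \<eta> - h \<eta>\<bar>)"
    by (simp add: abs_mult)
  finally have "exp (- \<xi>\<^sup>2) * \<bar>gauss_avg g 1 \<xi> - gauss_avg h 1 \<xi>\<bar>
      \<le> exp (- \<xi>\<^sup>2) * (LINT \<eta>|lborel. exp (- (\<xi> - \<eta>)\<^sup>2) * \<bar>g \<eta> - h \<eta>\<bar>)"
    by (rule mult_left_mono) simp
  also have "\<dots> = exp (- (1 / 2 * \<xi>\<^sup>2)) *
      (LINT \<eta>|lborel. exp (- (1 / 2 * \<xi>\<^sup>2)) * (exp (- (\<xi> - \<eta>)\<^sup>2) * \<bar>g \<eta> - h \<eta>\<bar>))"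
    by (simp flip: exp_add)
  also have "\<dots> \<le> exp (- (1 / 2 * \<xi>\<^sup>2)) * (LINT \<eta>|lborel. exp (- (1 / 3 * \<eta>\<^sup>2)) * \<bar>g \<eta> - h \<eta>\<bar>)"
  proof (intro mult_left_mono integral_mono)
    show "integrable lborel (\<lambda>\<eta>. exp (- (1 / 2 * \<xi>\<^sup>2)) * (exp (- (\<xi> - \<eta>)\<^sup>2) * \<bar>g \<eta> - h \<eta>\<bar>))"
      by (rule integrable_mult_right[OF id])
    show "integrable lborel (\<lambda>\<eta>. exp (- (1 / 3 * \<eta>\<^sup>2)) * \<bar>g \<eta> - h \<eta>\<bar>)"
      by (rule gaussian_integrableD[OF gh]) simp
    fix \<eta> :: real
    have "1 / 2 * \<xi>\<^sup>2 + (\<xi> - \<eta>)\<^sup>2 = 3 / 2 * (\<xi> - 2 * \<eta> / 3)\<^sup>2 + 1 / 3 * \<eta>\<^sup>2"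
      by (simp add: power2_eq_square field_simps)
    then have "1 / 3 * \<eta>\<^sup>2 \<le> 1 / 2 * \<xi>\<^sup>2 + (\<xi> - \<eta>)\<^sup>2"
      by simp
    then have "exp (- (1 / 2 * \<xi>\<^sup>2)) * exp (- (\<xi> - \<eta>)\<^sup>2) \<le> exp (- (1 / 3 * \<eta>\<^sup>2))"
      by (simp flip: exp_add)
    then show "exp (- (1 / 2 * \<xi>\<^sup>2)) * (exp (- (\<xi> - \<eta>)\<^sup>2) * \<bar>g \<eta> - h \<eta>\<bar>)
        \<le> exp (- (1 / 3 * \<eta>\<^sup>2)) * \<bar>g \<eta> - h \<eta>\<bar>"
      unfolding mult.assoc[symmetric] by (rule mult_right_mono) simp
  qed auto
  finally show ?thesis .
qed

lemma abs_gauss_diff_le: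
  fixes \<xi> a :: real
  shows "\<bar>exp (- (\<xi> - a)\<^sup>2) - exp (- \<xi>\<^sup>2)\<bar> \<le> min 1 \<bar>a\<bar>"
proof -
  have "norm (exp (- (\<xi> - a)\<^sup>2) - exp (- \<xi>\<^sup>2)) \<le> 1 * norm ((\<xi> - a) - \<xi>)"
  proof (rule field_differentiable_bound[where S = UNIV and f' = "\<lambda>x. - (2 * x) * exp (- x\<^sup>2)"])
    fix x :: real
    show "((\<lambda>x. exp (- x\<^sup>2)) has_field_derivative - (2 * x) * exp (- x\<^sup>2)) (at x within UNIV)"
      by (auto intro!: derivative_eq_intros)
    have "0 \<le> (\<bar>x\<bar> - 1)\<^sup>2" by simp
    then have "2 * \<bar>x\<bar> \<le> 1 + x\<^sup>2"
      by (simp add: power2_eq_square algebra_simps)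
    also have "\<dots> \<le> exp (x\<^sup>2)"
      by (rule exp_ge_add_one_self)
    finally show "norm (- (2 * x) * exp (- x\<^sup>2)) \<le> 1"
      by (simp add: abs_mult exp_minus field_simps)
  qed auto
  moreover have "exp (- (\<xi> - a)\<^sup>2) \<le> 1" "exp (- \<xi>\<^sup>2) \<le> 1"
    by auto
  then have "\<bar>exp (- (\<xi> - a)\<^sup>2) - exp (- \<xi>\<^sup>2)\<bar> \<le> 1"
    using exp_gt_zero[of "- (\<xi> - a)\<^sup>2"] exp_gt_zero[of "- \<xi>\<^sup>2"] by linarith
  ultimately show ?thesis by simp
qed

text \<open>
  Seen from distance \<open>s\<close>, an integrable function \<open>w\<close> looks like a point mass: smoothing it with a Gaussian
  of width \<open>s\<close> leaves, after rescaling, the Gaussian itself times the total mass. The error is a superposition, weighted by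
  \<open>w y\<close>, of the differences of the Gaussian with its translates by \<open>y / s\<close>, which are small in mean and
  uniformly.
\<close>

lemma point_mass_approximation:
  fixes w :: "real \<Rightarrow> real"
  assumes [measurable]: "w \<in> borel_measurable borel" and w: "integrable lborel w"
  defines "R \<equiv> \<lambda>s \<xi>. (LINT y|lborel. exp (- (\<xi> - y / s)\<^sup>2) * w y) - (LINT y|lborel. w y) * exp (- \<xi>\<^sup>2)"
  shows "\<And>s. integrable lborel (R s)"
    and "((\<lambda>s. LINT \<xi>|lborel. \<bar>R s \<xi>\<bar>) \<longlongrightarrow> 0) at_top"
    and "\<exists>\<rho>. (\<rho> \<longlongrightarrow> 0) at_top \<and> (\<forall>s>0. \<forall>\<xi>. \<bar>R s \<xi>\<bar> \<le> \<rho> s)"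
proof -
  define P where "P s y \<xi> = w y * (exp (- (\<xi> - y / s)\<^sup>2) - exp (- \<xi>\<^sup>2))" for s y \<xi>
  have iy: "integrable lborel (\<lambda>y. exp (- (\<xi> - y / s)\<^sup>2) * w y)" for s \<xi>
    by (rule Bochner_Integration.integrable_bound[OF w]) (auto simp: abs_mult mult_left_le_one_le)
  have R: "R s \<xi> = (LINT y|lborel. P s y \<xi>)" for s \<xi>
  proof -
    have "(LINT y|lborel. P s y \<xi>) = (LINT y|lborel. exp (- (\<xi> - y / s)\<^sup>2) * w y - w y * exp (- \<xi>\<^sup>2))"
      by (simp add: P_def algebra_simps)
    also have "\<dots> = R s \<xi>"
      unfolding R_def using iy[of \<xi> s] w by simp
    finally show ?thesis ..
  qed
  have e: "integrable lborel (\<lambda>\<xi>::real. exp (- \<xi>\<^sup>2))"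
    using integrable_gauss[of 1] by simp
  define \<tau> where "\<tau> a = (LINT \<xi>|lborel. \<bar>exp (- (\<xi> - a)\<^sup>2) - exp (- \<xi>\<^sup>2)\<bar>)" for a :: real
  have [measurable]: "\<tau> \<in> borel_measurable borel"
    unfolding \<tau>_def by measurable
  have \<tau>_nonneg: "0 \<le> \<tau> a" for a
    by (simp add: \<tau>_def)
  have ia: "integrable lborel (\<lambda>\<xi>. exp (- (\<xi> - a)\<^sup>2) - exp (- \<xi>\<^sup>2))" for a :: real
    using integrable_translate[OF e, of a] e by simp
  have \<tau>_le: "\<tau> a \<le> 2 * sqrt pi" for a
  proof -
    have "\<tau> a \<le> (LINT \<xi>|lborel. exp (- (\<xi> - a)\<^sup>2) + exp (- \<xi>\<^sup>2))"
      unfolding \<tau>_def using ia[of a] integrable_translate[OF e, of a] e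
    proof (intro integral_mono)
      show "\<bar>exp (- (\<xi> - a)\<^sup>2) - exp (- \<xi>\<^sup>2)\<bar> \<le> exp (- (\<xi> - a)\<^sup>2) + exp (- \<xi>\<^sup>2)" for \<xi>
        using exp_gt_zero[of "- (\<xi> - a)\<^sup>2"] exp_gt_zero[of "- \<xi>\<^sup>2"] by linarith
    qed auto
    also have "\<dots> = (LINT \<xi>|lborel. exp (- (\<xi> - a)\<^sup>2)) + (LINT \<xi>|lborel. exp (- \<xi>\<^sup>2))"
      using integrable_translate[OF e, of a] e by simp
    also have "\<dots> = 2 * sqrt pi"
      using integral_translate[of "\<lambda>\<xi>. exp (- \<xi>\<^sup>2)" a] integral_gauss[of 1] by simp
    finally show ?thesis .
  qed
  have "(\<tau> \<longlongrightarrow> \<tau> 0) (at 0)"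
    using L1_translation_continuous[OF e] by (simp add: \<tau>_def[abs_def])
  then have \<tau>_cont: "isCont \<tau> 0"
    by (simp add: isCont_def)
  have nP: "(LINT \<xi>|lborel. \<bar>P s y \<xi>\<bar>) = \<bar>w y\<bar> * \<tau> (y / s)" for s y
    by (simp add: P_def \<tau>_def abs_mult)
  have iP: "integrable lborel (P s y)" for s y
    unfolding P_def using ia by (intro integrable_mult_right) auto
  have mP: "case_prod (P s) \<in> borel_measurable (lborel \<Otimes>\<^sub>M lborel)" for s
    unfolding P_def by measurable
  have ibd: "integrable lborel (\<lambda>y. \<bar>w y\<bar> * (2 * sqrt pi))"
    using w by simp
  have iP2: "integrable lborel (\<lambda>y. LINT \<xi>|lborel. \<bar>P s y \<xi>\<bar>)" for s
    unfolding nP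
    by (rule Bochner_Integration.integrable_bound[OF ibd]) (auto simp: abs_mult \<tau>_nonneg intro!: mult_left_mono \<tau>_le)
  show "integrable lborel (R s)" for s
    unfolding R by (rule L1_superposition(1)[OF mP iP iP2])
  have small: "((\<lambda>s. y / s) \<longlongrightarrow> 0) at_top" for y :: real
    by real_asymp
  have "((\<lambda>s. LINT y|lborel. \<bar>w y\<bar> * \<tau> (y / s)) \<longlongrightarrow> (LINT y::real|lborel. 0)) at_top"
  proof (rule integral_dominated_convergence_at_top[where w = "\<lambda>y. \<bar>w y\<bar> * (2 * sqrt pi)"])
    have "((\<lambda>s. \<bar>w y\<bar> * \<tau> (y / s)) \<longlongrightarrow> \<bar>w y\<bar> * \<tau> 0) at_top" for y
      using isCont_tendsto_compose[OF \<tau>_cont small] by (rule tendsto_mult_left)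
    then show "AE y in lborel. ((\<lambda>s. \<bar>w y\<bar> * \<tau> (y / s)) \<longlongrightarrow> 0) at_top"
      by (simp add: \<tau>_def)
  qed (use ibd in \<open>auto simp: abs_mult \<tau>_nonneg intro!: always_eventually mult_left_mono \<tau>_le\<close>)
  then have lim: "((\<lambda>s. LINT y|lborel. \<bar>w y\<bar> * \<tau> (y / s)) \<longlongrightarrow> 0) at_top"
    by simp
  show "((\<lambda>s. LINT \<xi>|lborel. \<bar>R s \<xi>\<bar>) \<longlongrightarrow> 0) at_top"
  proof (rule tendsto_sandwich[OF _ _ tendsto_const lim])
    show "\<forall>\<^sub>F s in at_top. (LINT \<xi>|lborel. \<bar>R s \<xi>\<bar>) \<le> (LINT y|lborel. \<bar>w y\<bar> * \<tau> (y / s))"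
      using L1_superposition(2)[OF mP iP iP2] by (simp add: R nP)
  qed simp
  define \<rho> where "\<rho> s = (LINT y|lborel. \<bar>w y\<bar> * min 1 \<bar>y / s\<bar>)" for s
  have "(\<rho> \<longlongrightarrow> (LINT y::real|lborel. 0)) at_top"
    unfolding \<rho>_def
  proof (rule integral_dominated_convergence_at_top[where w = "\<lambda>y. \<bar>w y\<bar>"])
    have "((\<lambda>s. \<bar>w y\<bar> * min 1 \<bar>y / s\<bar>) \<longlongrightarrow> \<bar>w y\<bar> * min 1 \<bar>0\<bar>) at_top" for y
      by (intro tendsto_intros small)
    then show "AE y in lborel. ((\<lambda>s. \<bar>w y\<bar> * min 1 \<bar>y / s\<bar>) \<longlongrightarrow> 0) at_top"
      by simp
  qed (use w in \<open>auto intro!: always_eventually simp: abs_mult mult_left_le\<close>)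
  moreover have "\<bar>R s \<xi>\<bar> \<le> \<rho> s" for s \<xi>
  proof -
    have iP': "integrable lborel (\<lambda>y. P s y \<xi>)"
      unfolding P_def using iy[of \<xi> s] w by (simp add: algebra_simps)
    have i\<rho>: "integrable lborel (\<lambda>y. \<bar>w y\<bar> * min 1 \<bar>y / s\<bar>)"
      by (rule Bochner_Integration.integrable_bound[OF w]) (auto simp: abs_mult mult_left_le)
    have "\<bar>R s \<xi>\<bar> \<le> (LINT y|lborel. \<bar>P s y \<xi>\<bar>)"
      unfolding R by (rule integral_abs_bound)
    also have "\<dots> \<le> \<rho> s"
      unfolding \<rho>_def
    proof (rule integral_mono[OF integrable_abs[OF iP'] i\<rho>])
      show "\<bar>P s y \<xi>\<bar> \<le> \<bar>w y\<bar> * min 1 \<bar>y / s\<bar>" for y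
        unfolding P_def abs_mult by (rule mult_left_mono[OF abs_gauss_diff_le abs_ge_zero])
    qed
    finally show ?thesis .
  qed
  ultimately show "\<exists>\<rho>. (\<rho> \<longlongrightarrow> 0) at_top \<and> (\<forall>s>0. \<forall>\<xi>. \<bar>R s \<xi>\<bar> \<le> \<rho> s)"
    by (intro exI[of _ \<rho>]) auto
qed

context hopf_cole_data
begin

definition m :: real where "m = (LINT y|lborel. u0 y)"
definition M :: real where "M = (LINT y|lborel. w y)"
definition E :: real where "E = exp (k * m)"

text \<open>The limit of \<open>\<phi>0 (s * y)\<close> as \<open>s\<close> tends to infinity, and its Gaussian average.\<close>

definition step :: "real \<Rightarrow> real" where "step y = (if y < 0 then 1 else E)"
definition D :: "real \<Rightarrow> real" where "D = gauss_avg step 1"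

text \<open>The solution at time \<open>t\<close> in self-similar variables, with \<open>s = sqrt (4 * c * t)\<close>, and its limit.\<close>

definition G :: "real \<Rightarrow> real \<Rightarrow> real" where "G s \<xi> = s * \<Psi> s (s * \<xi>) / \<Phi> s (s * \<xi>)"
definition G_lim :: "real \<Rightarrow> real" where "G_lim \<xi> = M / sqrt pi * (exp (- \<xi>\<^sup>2) / D \<xi>)"

lemma \<phi>0_at_top: "(\<phi>0 \<longlongrightarrow> E) at_top"
  unfolding \<phi>0_def[abs_def] E_def m_def by (intro tendsto_intros primitive_at_top u0)

lemma \<phi>0_at_bot: "(\<phi>0 \<longlongrightarrow> 1) at_bot"
proof -
  have "(\<phi>0 \<longlongrightarrow> exp (k * 0)) at_bot"
    unfolding \<phi>0_def[abs_def] by (intro tendsto_intros primitive_at_bot u0)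
  then show ?thesis by simp
qed

text \<open>Evaluating \<open>\<phi>0 = 1 + k * primitive w\<close> at infinity links the masses of \<open>u0\<close> and of \<open>w\<close>.\<close>

lemma E_eq: "E = 1 + k * M"
proof (rule tendsto_unique[OF _ \<phi>0_at_top])
  show "(\<phi>0 \<longlongrightarrow> 1 + k * M) at_top"
    unfolding \<phi>0_primitive[abs_def] M_def by (intro tendsto_intros primitive_at_top w)
qed simp

lemma step_borel [measurable]: "step \<in> borel_measurable borel"
  unfolding step_def[abs_def] by measurable

lemma step_bounds: "exp (- B) \<le> step y" "step y \<le> exp B"
proof -
  have "exp (- B) \<le> E" "E \<le> exp B"
    by (rule tendsto_lowerbound[OF \<phi>0_at_top] tendsto_upperbound[OF \<phi>0_at_top],
        simp add: \<phi>0_bounds, simp)+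
  moreover have "B \<ge> 0"
    by (simp add: B_def)
  ultimately show "exp (- B) \<le> step y" "step y \<le> exp B"
    by (auto simp: step_def)
qed

lemma D_bounds: "exp (- B) \<le> D \<xi>" "D \<xi> \<le> exp B"
  unfolding D_def by (rule gauss_avg_bounds[OF step_borel step_bounds])+

lemma D_pos: "D \<xi> > 0"
  using D_bounds(1)[of \<xi>] by (rule less_le_trans[rotated]) simp

lemma D_borel [measurable]: "D \<in> borel_measurable borel"
  unfolding D_def gauss_avg_def[abs_def] by measurable

lemma \<Phi>_borel [measurable]: "\<Phi> s \<in> borel_measurable borel"
  unfolding \<Phi>_def gauss_avg_def[abs_def] by measurable

lemma \<Psi>_borel [measurable]: "\<Psi> s \<in> borel_measurable borel"
  unfolding \<Psi>_def gauss_avg_def[abs_def] by measurable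

lemma G_borel [measurable]: "G s \<in> borel_measurable borel"
  unfolding G_def[abs_def] by measurable

lemma \<Phi>_scaled: "\<Phi> s (s * \<xi>) = gauss_avg (\<lambda>y. \<phi>0 (s * y)) 1 \<xi>"
  by (simp add: \<Phi>_def gauss_avg_def algebra_simps)

lemma \<Psi>_scaled:
  assumes s: "s > 0"
  shows "s * \<Psi> s (s * \<xi>) = 1 / sqrt pi * (LINT y|lborel. exp (- (\<xi> - y / s)\<^sup>2) * w y)"
proof -
  have "(LINT y|lborel. exp (- (\<xi> - y / s)\<^sup>2) * w y) = s * (LINT q|lborel. exp (- q\<^sup>2) * w (s * \<xi> - s * q))"
    using s by (subst lborel_integral_real_affine[of "- s" _ "s * \<xi>"]) (auto simp: diff_divide_distrib)
  then show ?thesis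
    by (simp add: \<Psi>_def gauss_avg_def)
qed

text \<open>
  Pointwise convergence to the step function holds except at \<open>0\<close>. It cannot be uniform near \<open>0\<close> when
  \<open>E \<noteq> 1\<close>, hence the weighted mean.
\<close>

lemma step_error_tendsto:
  "((\<lambda>s. LINT y|lborel. exp (- (1 / 3 * y\<^sup>2)) * \<bar>\<phi>0 (s * y) - step y\<bar>) \<longlongrightarrow> 0) at_top"
proof -
  have "((\<lambda>s. LINT y|lborel. exp (- (1 / 3 * y\<^sup>2)) * \<bar>\<phi>0 (s * y) - step y\<bar>)
      \<longlongrightarrow> (LINT y::real|lborel. 0)) at_top"
  proof (rule integral_dominated_convergence_at_top[where w = "\<lambda>y. exp (- (1 / 3 * y\<^sup>2)) * (2 * exp B)"])
    show "AE y in lborel. ((\<lambda>s. exp (- (1 / 3 * y\<^sup>2)) * \<bar>\<phi>0 (s * y) - step y\<bar>) \<longlongrightarrow> 0) at_top"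
      using AE_lborel_singleton[of 0]
    proof eventually_elim
      case (elim y)
      have "((\<lambda>s. \<phi>0 (s * y)) \<longlongrightarrow> step y) at_top"
      proof (cases "y > 0")
        case True
        then have "filterlim (\<lambda>s. s * y) at_top at_top" by real_asymp
        then show ?thesis
          using filterlim_compose[OF \<phi>0_at_top] True by (simp add: step_def)
      next
        case False
        then have y: "y < 0" using elim by simp
        then have "filterlim (\<lambda>s. s * y) at_bot at_top" by real_asymp
        then show ?thesis
          using filterlim_compose[OF \<phi>0_at_bot] y by (simp add: step_def)
      qed
      then have "((\<lambda>s. exp (- (1 / 3 * y\<^sup>2)) * \<bar>\<phi>0 (s * y) - step y\<bar>)
          \<longlongrightarrow> exp (- (1 / 3 * y\<^sup>2)) * \<bar>step y - step y\<bar>) at_top"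
        by (intro tendsto_intros)
      then show ?case by simp
    qed
    have "\<bar>\<phi>0 (s * y) - step y\<bar> \<le> 2 * exp B" for s y
      using \<phi>0_bounds[of "s * y"] step_bounds[of y] exp_gt_zero[of "- B"] by linarith
    then show "\<forall>\<^sub>F s in at_top. AE y in lborel. norm (exp (- (1 / 3 * y\<^sup>2)) * \<bar>\<phi>0 (s * y) - step y\<bar>)
        \<le> exp (- (1 / 3 * y\<^sup>2)) * (2 * exp B)"
      by (intro always_eventually allI AE_I2) (simp add: abs_mult)
    show "integrable lborel (\<lambda>y. exp (- (1 / 3 * y\<^sup>2)) * (2 * exp B))"
      using integrable_gauss[of "1 / 3"] by simp
  qed simp_all
  then show ?thesis by simp
qed

lemma abs_M_le: "\<bar>M\<bar> \<le> (LINT y|lborel. \<bar>w y\<bar>)"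
  unfolding M_def by (rule integral_abs_bound)

text \<open>A common bound for all rescaled solutions and their limit.\<close>

definition C :: real where "C = exp B * (LINT y|lborel. \<bar>w y\<bar>)"

lemma G_bound:
  assumes s: "s > 0"
  shows "\<bar>G s \<xi>\<bar> \<le> C"
proof -
  have i: "integrable lborel (\<lambda>y. exp (- (\<xi> - y / s)\<^sup>2) * w y)"
    by (rule Bochner_Integration.integrable_bound[OF w]) (auto simp: abs_mult mult_left_le_one_le)
  have "\<bar>s * \<Psi> s (s * \<xi>)\<bar> \<le> 1 * (LINT y|lborel. \<bar>exp (- (\<xi> - y / s)\<^sup>2) * w y\<bar>)"
    unfolding \<Psi>_scaled[OF s] abs_mult[of "1 / sqrt pi"] using pi_ge_two
    by (intro mult_mono integral_abs_bound) auto
  also have "\<dots> \<le> 1 * (LINT y|lborel. \<bar>w y\<bar>)"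
  proof (intro mult_left_mono integral_mono)
    show "integrable lborel (\<lambda>y. \<bar>exp (- (\<xi> - y / s)\<^sup>2) * w y\<bar>)"
      by (rule integrable_abs[OF i])
    show "\<bar>exp (- (\<xi> - y / s)\<^sup>2) * w y\<bar> \<le> \<bar>w y\<bar>" for y
      by (simp add: abs_mult mult_left_le_one_le)
  qed (use w in auto)
  finally have N: "\<bar>s * \<Psi> s (s * \<xi>)\<bar> \<le> (LINT y|lborel. \<bar>w y\<bar>)" by simp
  have "1 / \<Phi> s (s * \<xi>) \<le> exp B"
    using \<Phi>_bounds(1)[of s "s * \<xi>"] \<Phi>_pos[of s "s * \<xi>"] by (simp add: exp_minus field_simps)
  then have "1 / \<Phi> s (s * \<xi>) * \<bar>s * \<Psi> s (s * \<xi>)\<bar> \<le> C"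
    unfolding C_def using N by (intro mult_mono) auto
  then show ?thesis
    using \<Phi>_pos[of s "s * \<xi>"] by (simp add: G_def abs_mult)
qed

lemma inverse_D_le: "1 / D \<xi> \<le> exp B"
  using D_bounds(1)[of \<xi>] D_pos[of \<xi>] by (simp add: exp_minus field_simps)

lemma G_limit_bound: "\<bar>G_lim \<xi>\<bar> \<le> C"
proof -
  have "\<bar>M\<bar> / sqrt pi \<le> \<bar>M\<bar> / 1"
    using pi_ge_two by (intro divide_left_mono) auto
  then have M: "\<bar>M\<bar> / sqrt pi \<le> (LINT y|lborel. \<bar>w y\<bar>)"
    using abs_M_le by simp
  have e: "exp (- \<xi>\<^sup>2) * (1 / D \<xi>) \<le> 1 * exp B"
    using inverse_D_le[of \<xi>] D_pos[of \<xi>] by (intro mult_mono) auto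
  have "\<bar>M\<bar> / sqrt pi * (exp (- \<xi>\<^sup>2) * (1 / D \<xi>)) \<le> (LINT y|lborel. \<bar>w y\<bar>) * (1 * exp B)"
    by (rule mult_mono[OF M e]) (use D_pos[of \<xi>] in auto)
  then show ?thesis
    using D_pos[of \<xi>] by (simp add: G_lim_def C_def abs_mult mult.commute)
qed

lemma profile_integrable: "integrable lborel (\<lambda>\<xi>. exp (- \<xi>\<^sup>2) / D \<xi>)"
proof (rule Bochner_Integration.integrable_bound)
  show "integrable lborel (\<lambda>\<xi>::real. exp B * exp (- \<xi>\<^sup>2))"
    using integrable_gauss[of 1] by simp
  have "\<bar>exp (- \<xi>\<^sup>2) / D \<xi>\<bar> \<le> exp B * exp (- \<xi>\<^sup>2)" for \<xi>
    using mult_right_mono[OF inverse_D_le[of \<xi>], of "exp (- \<xi>\<^sup>2)"] D_pos[of \<xi>] by simp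
  then show "AE \<xi> in lborel. norm (exp (- \<xi>\<^sup>2) / D \<xi>) \<le> norm (exp B * exp (- \<xi>\<^sup>2))"
    by simp
qed simp

lemma G_limit_integrable: "integrable lborel G_lim"
  unfolding G_lim_def[abs_def] by (intro integrable_mult_right profile_integrable)

text \<open>
  The error splits into that of the numerator, a point mass approximation, and that of the denominator,
  where the numerator's factor \<open>exp (- \<xi>\<^sup>2)\<close> makes up for the fact that \<open>\<Phi> s (s * \<xi>)\<close> need not converge in mean.
\<close>

lemma G_tendsto:
  shows "\<And>s. s > 0 \<Longrightarrow> integrable lborel (G s)"
    and "((\<lambda>s. LINT \<xi>|lborel. \<bar>G s \<xi> - G_lim \<xi>\<bar>) \<longlongrightarrow> 0) at_top"
    and "\<exists>\<delta>. (\<delta> \<longlongrightarrow> 0) at_top \<and> (\<forall>s>0. \<forall>\<xi>. \<bar>G s \<xi> - G_lim \<xi>\<bar> \<le> \<delta> s)"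
proof -
  define R where "R s \<xi> = (LINT y|lborel. exp (- (\<xi> - y / s)\<^sup>2) * w y) - M * exp (- \<xi>\<^sup>2)" for s \<xi>
  define \<epsilon> where "\<epsilon> s = (LINT y|lborel. exp (- (1 / 3 * y\<^sup>2)) * \<bar>\<phi>0 (s * y) - step y\<bar>)" for s
  define L where "L = \<bar>M\<bar> * exp (2 * B)"
  note R = point_mass_approximation[OF w_borel w, folded M_def, folded R_def]
  have \<epsilon>: "(\<epsilon> \<longlongrightarrow> 0) at_top"
    unfolding \<epsilon>_def by (rule step_error_tendsto)
  have \<epsilon>_nonneg: "0 \<le> \<epsilon> s" for s
    by (simp add: \<epsilon>_def)
  have L: "0 \<le> L" by (simp add: L_def)
  have inv: "1 / \<Phi> s x \<le> exp B" for s x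
    using \<Phi>_bounds(1)[of s x] \<Phi>_pos[of s x] by (simp add: exp_minus field_simps)
  have bd: "\<bar>G s \<xi> - G_lim \<xi>\<bar> \<le> exp B * \<bar>R s \<xi>\<bar> + L * \<epsilon> s * exp (- (1 / 2 * \<xi>\<^sup>2))" if s: "s > 0" for s \<xi>
  proof -
    define P where "P = \<Phi> s (s * \<xi>)"
    have P: "P > 0" by (simp add: P_def \<Phi>_pos)
    have iP: "1 / P \<le> exp B" by (simp add: P_def inv)
    have "s * \<Psi> s (s * \<xi>) = 1 / sqrt pi * (R s \<xi> + M * exp (- \<xi>\<^sup>2))"
      unfolding \<Psi>_scaled[OF s] R_def by simp
    then have Gs: "G s \<xi> = 1 / sqrt pi * (R s \<xi> + M * exp (- \<xi>\<^sup>2)) / P"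
      by (simp only: G_def P_def)
    have "G s \<xi> - G_lim \<xi> = 1 / sqrt pi * ((1 / P) * R s \<xi> + (1 / P) * (1 / D \<xi>) * M * (exp (- \<xi>\<^sup>2) * (D \<xi> - P)))"
      unfolding Gs G_lim_def using P D_pos[of \<xi>] by (simp add: field_simps)
    then have "\<bar>G s \<xi> - G_lim \<xi>\<bar> \<le> 1 * \<bar>(1 / P) * R s \<xi> + (1 / P) * (1 / D \<xi>) * M * (exp (- \<xi>\<^sup>2) * (D \<xi> - P))\<bar>"
      unfolding abs_mult[of "1 / sqrt pi"] using pi_ge_two by (simp only: abs_mult) (intro mult_right_mono, auto)
    also have "\<dots> \<le> \<bar>(1 / P) * R s \<xi>\<bar> + \<bar>(1 / P) * (1 / D \<xi>) * M * (exp (- \<xi>\<^sup>2) * (D \<xi> - P))\<bar>"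
      unfolding mult_1 by (rule abs_triangle_ineq)
    also have "\<bar>(1 / P) * R s \<xi>\<bar> = (1 / P) * \<bar>R s \<xi>\<bar>"
      using P by (simp add: abs_mult)
    also have "(1 / P) * \<bar>R s \<xi>\<bar> \<le> exp B * \<bar>R s \<xi>\<bar>"
      by (rule mult_right_mono[OF iP abs_ge_zero])
    also have "\<bar>(1 / P) * (1 / D \<xi>) * M * (exp (- \<xi>\<^sup>2) * (D \<xi> - P))\<bar>
        = (1 / P) * (1 / D \<xi>) * \<bar>M\<bar> * (exp (- \<xi>\<^sup>2) * \<bar>P - D \<xi>\<bar>)"
      using P D_pos[of \<xi>] by (simp add: abs_mult abs_minus_commute)
    also have "\<dots> \<le> (exp B * exp B * \<bar>M\<bar>) * (exp (- (1 / 2 * \<xi>\<^sup>2)) * \<epsilon> s)"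
    proof (rule mult_mono)
      show "(1 / P) * (1 / D \<xi>) * \<bar>M\<bar> \<le> exp B * exp B * \<bar>M\<bar>"
        using iP inverse_D_le[of \<xi>] P D_pos[of \<xi>] by (intro mult_right_mono mult_mono) auto
      show "exp (- \<xi>\<^sup>2) * \<bar>P - D \<xi>\<bar> \<le> exp (- (1 / 2 * \<xi>\<^sup>2)) * \<epsilon> s"
        unfolding P_def \<Phi>_scaled D_def \<epsilon>_def
      proof (rule gauss_avg_diff_le)
        show "\<bar>\<phi>0 (s * y)\<bar> \<le> exp B" for y by (rule abs_\<phi>0_le)
        show "\<bar>step y\<bar> \<le> exp B" for y
          using step_bounds[of y] exp_gt_zero[of "- B"] by linarith
      qed simp_all
    qed auto
    also have "\<dots> = L * \<epsilon> s * exp (- (1 / 2 * \<xi>\<^sup>2))"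
      by (simp add: L_def mult_exp_exp algebra_simps)
    finally show ?thesis by simp
  qed
  have g2: "integrable lborel (\<lambda>\<xi>::real. exp (- (1 / 2 * \<xi>\<^sup>2)))"
    by (rule integrable_gauss) simp
  have idom: "integrable lborel (\<lambda>\<xi>. exp B * \<bar>R s \<xi>\<bar> + L * \<epsilon> s * exp (- (1 / 2 * \<xi>\<^sup>2)))" for s
    using R(1)[of s] g2 by (intro Bochner_Integration.integrable_add integrable_mult_right integrable_abs)
  have iD: "integrable lborel (\<lambda>\<xi>. G s \<xi> - G_lim \<xi>)" if s: "s > 0" for s
  proof (rule Bochner_Integration.integrable_bound[OF idom])
    show "(\<lambda>\<xi>. G s \<xi> - G_lim \<xi>) \<in> borel_measurable lborel"
      unfolding G_lim_def by measurable
    show "AE \<xi> in lborel. norm (G s \<xi> - G_lim \<xi>) \<le> norm (exp B * \<bar>R s \<xi>\<bar> + L * \<epsilon> s * exp (- (1 / 2 * \<xi>\<^sup>2)))"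
      using order_trans[OF bd[OF s] abs_ge_self] by simp
  qed
  show "integrable lborel (G s)" if "s > 0" for s
    using Bochner_Integration.integrable_add[OF iD[OF that] G_limit_integrable] by simp
  have lim: "((\<lambda>s. exp B * (LINT \<xi>|lborel. \<bar>R s \<xi>\<bar>) + L * \<epsilon> s * (LINT \<xi>::real|lborel. exp (- (1 / 2 * \<xi>\<^sup>2)))) \<longlongrightarrow> exp B * 0 + L * 0 * (LINT \<xi>::real|lborel. exp (- (1 / 2 * \<xi>\<^sup>2)))) at_top"
    by (intro tendsto_intros R(2) \<epsilon>)
  show "((\<lambda>s. LINT \<xi>|lborel. \<bar>G s \<xi> - G_lim \<xi>\<bar>) \<longlongrightarrow> 0) at_top"
  proof (rule tendsto_sandwich[OF _ _ tendsto_const])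
    show "((\<lambda>s. exp B * (LINT \<xi>|lborel. \<bar>R s \<xi>\<bar>) + L * \<epsilon> s * (LINT \<xi>::real|lborel. exp (- (1 / 2 * \<xi>\<^sup>2)))) \<longlongrightarrow> 0) at_top"
      using lim by simp
    show "\<forall>\<^sub>F s in at_top. (LINT \<xi>|lborel. \<bar>G s \<xi> - G_lim \<xi>\<bar>)
        \<le> exp B * (LINT \<xi>|lborel. \<bar>R s \<xi>\<bar>) + L * \<epsilon> s * (LINT \<xi>::real|lborel. exp (- (1 / 2 * \<xi>\<^sup>2)))"
      using eventually_gt_at_top[of "0::real"]
    proof eventually_elim
      case (elim s)
      have "(LINT \<xi>|lborel. \<bar>G s \<xi> - G_lim \<xi>\<bar>)
          \<le> (LINT \<xi>|lborel. exp B * \<bar>R s \<xi>\<bar> + L * \<epsilon> s * exp (- (1 / 2 * \<xi>\<^sup>2)))"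
        by (intro integral_mono integrable_abs iD elim idom bd)
      also have "\<dots> = (LINT \<xi>|lborel. exp B * \<bar>R s \<xi>\<bar>) + (LINT \<xi>|lborel. L * \<epsilon> s * exp (- (1 / 2 * \<xi>\<^sup>2)))"
        using R(1)[of s] g2
        by (intro Bochner_Integration.integral_add integrable_mult_right integrable_abs)
      finally show ?case by simp
    qed
  qed simp
  obtain \<rho> where \<rho>: "(\<rho> \<longlongrightarrow> 0) at_top" "\<And>s \<xi>. s > 0 \<Longrightarrow> \<bar>R s \<xi>\<bar> \<le> \<rho> s"
    using R(3) by blast
  have "((\<lambda>s. exp B * \<rho> s + L * \<epsilon> s) \<longlongrightarrow> exp B * 0 + L * 0) at_top"
    by (intro tendsto_intros \<rho> \<epsilon>)
  moreover have "\<bar>G s \<xi> - G_lim \<xi>\<bar> \<le> exp B * \<rho> s + L * \<epsilon> s" if s: "s > 0" for s \<xi>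
  proof -
    have "L * \<epsilon> s * exp (- (1 / 2 * \<xi>\<^sup>2)) \<le> L * \<epsilon> s * 1"
      using L \<epsilon>_nonneg[of s] by (intro mult_left_mono) auto
    moreover have "exp B * \<bar>R s \<xi>\<bar> \<le> exp B * \<rho> s"
      using \<rho>(2)[OF s] by simp
    ultimately show ?thesis
      using bd[OF s, of \<xi>] by linarith
  qed
  ultimately show "\<exists>\<delta>. (\<delta> \<longlongrightarrow> 0) at_top \<and> (\<forall>s>0. \<forall>\<xi>. \<bar>G s \<xi> - G_lim \<xi>\<bar> \<le> \<delta> s)"
    by (intro exI[of _ "\<lambda>s. exp B * \<rho> s + L * \<epsilon> s"]) auto
qed

end

section \<open>The error function and the profile\<close>

text \<open>
  Half of the Gaussian mass \<open>sqrt pi\<close> lies to the left of \<open>0\<close>; with the prefactor \<open>1 / sqrt pi\<close>, the error function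
  measures the rest.
\<close>

lemma primitive_gauss_eq_erf: "primitive (\<lambda>q. exp (- q\<^sup>2)) x = sqrt pi * (1 / 2 + erf x)"
proof -
  let ?e = "\<lambda>q::real. exp (- q\<^sup>2)"
  have e: "integrable lborel ?e"
    using integrable_gauss[of 1] by simp
  have "primitive ?e 0 = (LINT q|lborel. indicator {0..} (0 - q) * ?e (0 - q))"
    unfolding primitive_def by (intro Bochner_Integration.integral_cong) (auto simp: indicator_def)
  also have "\<dots> = (LINT q|lborel. indicator {0..} q * ?e q)"
    by (rule integral_reflect_translate)
  also have "\<dots> = sqrt pi / 2"
    using has_bochner_integral_integral_eq[OF gaussian_moment_0] by simp
  finally have zero: "primitive ?e 0 = sqrt pi / 2" .
  have Ioc: "(LINT q|lborel. indicator {u<..v} q * ?e q) = (LINT q:{u<..<v}|lborel. ?e q)" for u v :: real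
    unfolding set_lebesgue_integral_def real_scaleR_def
  proof (rule integral_cong_AE)
    show "AE q in lborel. indicator {u<..v} q * ?e q = indicator {u<..<v} q * ?e q"
      using AE_lborel_singleton[of v] by eventually_elim (auto simp: indicator_def)
  qed auto
  have "(LBINT \<xi>=0..x. ?e \<xi>) = primitive ?e x - primitive ?e 0"
  proof (cases "0 \<le> x")
    case True
    then show ?thesis
      by (simp add: interval_lebesgue_integral_def zero_ereal_def primitive_diff[OF e] Ioc)
  next
    case False
    then have "primitive ?e 0 - primitive ?e x = (LINT q:{x<..<0}|lborel. ?e q)"
      using primitive_diff[OF e, of x 0] Ioc[of x 0] by simp
    then show ?thesis
      using False by (simp add: interval_lebesgue_integral_def zero_ereal_def)
  qed
  then show ?thesis
    by (simp add: erf_def zero field_simps)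
qed

lemma erf_has_real_derivative: "(erf has_real_derivative exp (- x\<^sup>2) / sqrt pi) (at x)"
proof -
  let ?e = "\<lambda>q::real. exp (- q\<^sup>2)"
  define r where "r = \<bar>x\<bar> + 1"
  have "((\<lambda>u. LBINT y=ereal 0..u. ?e y) has_vector_derivative ?e x) (at x within {- r..r})"
    by (rule interval_integral_FTC2) (auto simp: r_def intro!: continuous_intros)
  then have "((\<lambda>u. LBINT y=0..u. ?e y) has_vector_derivative ?e x) (at x)"
    by (subst (asm) at_within_interior) (auto simp: r_def zero_ereal_def)
  then have "((\<lambda>u. LBINT y=0..u. ?e y) has_real_derivative ?e x) (at x)"
    by (simp add: has_real_derivative_iff_has_vector_derivative)
  from DERIV_cmult[OF this, of "1 / sqrt pi"] show ?thesis
    by (simp add: erf_def[abs_def])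
qed

lemma erf_minus: "erf (- x) = - erf x"
proof -
  let ?e = "\<lambda>q::real. exp (- q\<^sup>2)"
  have e: "integrable lborel ?e"
    using integrable_gauss[of 1] by simp
  have "primitive ?e (- x) + primitive ?e x = sqrt pi"
  proof -
    have "primitive ?e (- x) = (LINT q|lborel. indicator {x..} (0 - q) * ?e (0 - q))"
      unfolding primitive_def by (intro Bochner_Integration.integral_cong) (auto simp: indicator_def)
    also have "\<dots> = (LINT q|lborel. indicator {x..} q * ?e q)"
      by (rule integral_reflect_translate)
    finally have "primitive ?e (- x) + primitive ?e x
        = (LINT q|lborel. indicator {x..} q * ?e q + indicator {..x} q * ?e q)"
      unfolding primitive_def
      by (simp add: integrable_indicator_mult[OF e])
    also have "\<dots> = (LINT q|lborel. ?e q)"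
    proof (rule integral_cong_AE)
      show "AE q in lborel. indicator {x..} q * ?e q + indicator {..x} q * ?e q = ?e q"
        using AE_lborel_singleton[of x] by eventually_elim (auto simp: indicator_def)
    qed auto
    finally show ?thesis
      using integral_gauss[of 1] by simp
  qed
  then have "sqrt pi * (1 / 2 + erf (- x) + (1 / 2 + erf x)) = sqrt pi * 1"
    unfolding primitive_gauss_eq_erf by (simp add: algebra_simps)
  then show ?thesis
    by simp
qed

context hopf_cole_data
begin

lemma D_eq_primitive: "D \<xi> = 1 - (1 - E) * (primitive (\<lambda>q. exp (- q\<^sup>2)) \<xi> / sqrt pi)"
proof -
  let ?e = "\<lambda>q::real. exp (- q\<^sup>2)"
  have e: "integrable lborel ?e"
    using integrable_gauss[of 1] by simp
  have "(LINT q|lborel. ?e q * step (\<xi> - 1 * q))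
      = (LINT q|lborel. ?e q - (1 - E) * (indicator {..\<xi>} q * ?e q))"
    by (intro Bochner_Integration.integral_cong) (auto simp: step_def indicator_def algebra_simps)
  also have "\<dots> = sqrt pi - (1 - E) * primitive ?e \<xi>"
    using e integrable_indicator_mult[OF e, of "{..\<xi>}"] integral_gauss[of 1] by (simp add: primitive_def)
  finally show ?thesis
    by (simp add: D_def gauss_avg_def field_simps)
qed

lemma D_eq_erf: "D \<xi> = (1 + E) / 2 - (1 - E) * erf \<xi>"
  unfolding D_eq_primitive primitive_gauss_eq_erf by (simp add: field_simps)

definition F0 :: "real \<Rightarrow> real" where "F0 \<xi> = exp (- \<xi>\<^sup>2) / D \<xi>"

lemma F0_borel [measurable]: "F0 \<in> borel_measurable borel"
  unfolding F0_def[abs_def] by measurable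

lemma F0_integrable: "integrable lborel F0"
  unfolding F0_def[abs_def] by (rule profile_integrable)

lemma F0_nonneg: "0 \<le> F0 \<xi>"
  using D_pos[of \<xi>] by (simp add: F0_def)

lemma F0_bound: "\<bar>F0 \<xi>\<bar> \<le> exp B"
proof -
  have "exp (- \<xi>\<^sup>2) * (1 / D \<xi>) \<le> 1 * exp B"
    using inverse_D_le[of \<xi>] D_pos[of \<xi>] by (intro mult_mono) auto
  then show ?thesis
    using F0_nonneg[of \<xi>] by (simp add: F0_def)
qed

lemma G_lim_eq: "G_lim \<xi> = M / sqrt pi * F0 \<xi>"
  by (simp add: G_lim_def F0_def)

text \<open>
  The absolute value \<open>h\<close> in the profile reflects it when \<open>E > 1\<close>, since the error function is odd.
\<close>

lemma burgers_profile_eq: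
  "burgers_profile b c m = (if E \<le> 1 then F0 else (\<lambda>\<xi>. F0 (0 + (-1) * \<xi>)))"
proof
  fix \<xi>
  have E: "exp (- (b * m / (2 * c))) = E"
    by (simp add: E_def k_def)
  show "burgers_profile b c m \<xi> = (if E \<le> 1 then F0 else (\<lambda>\<xi>. F0 (0 + (-1) * \<xi>))) \<xi>"
    unfolding burgers_profile_def Let_def E F0_def D_eq_erf by (simp add: erf_minus algebra_simps)
qed

lemma burgers_profile_integrable: "integrable lborel (burgers_profile b c m)"
  using F0_integrable lborel_integrable_real_affine[OF F0_integrable, of "-1" 0]
  by (simp add: burgers_profile_eq)

lemma burgers_profile_bound: "\<bar>burgers_profile b c m \<xi>\<bar> \<le> exp B"
  using F0_bound by (simp add: burgers_profile_eq)

lemma Lp_norm_profile: "Lp_norm p (burgers_profile b c m) = Lp_norm p F0"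
proof -
  have "(\<integral>\<^sup>+x. ennreal (\<bar>F0 (0 + (-1) * x)\<bar> powr p) \<partial>lborel) = (\<integral>\<^sup>+x. ennreal (\<bar>F0 x\<bar> powr p) \<partial>lborel)"
    using nn_integral_real_affine[of "\<lambda>x. ennreal (\<bar>F0 x\<bar> powr p)" "-1" 0] by simp
  then show ?thesis
    by (simp add: burgers_profile_eq Lp_norm_def nn_integral_completion)
qed

lemma Linf_norm_profile: "Linf_norm (burgers_profile b c m) = Linf_norm F0"
proof -
  have "range (\<lambda>x. ennreal \<bar>F0 (0 + (-1) * x)\<bar>) = range (\<lambda>x. ennreal \<bar>F0 x\<bar>)"
    by (auto simp: image_iff) (metis minus_minus)
  then show ?thesis
    by (simp add: burgers_profile_eq Linf_norm_def)
qed

text \<open>The mass factor is the ratio of the masses of \<open>w\<close> and of \<open>u0\<close>.\<close>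

lemma mass_factor_eq: "m * mass_factor b c m = M"
proof -
  have k: "k \<noteq> 0" using b c by (simp add: k_def)
  have M: "M = (E - 1) / k"
    using E_eq k by (simp add: field_simps)
  show ?thesis
  proof (cases "m = 0")
    case True
    then show ?thesis by (simp add: M E_def)
  next
    case False
    have "exp (- (b * m / (2 * c))) = E"
      by (simp add: E_def k_def)
    then show ?thesis
      using False b c by (simp add: mass_factor_def M k_def field_simps)
  qed
qed

text \<open>
  Up to a constant the profile is the derivative of \<open>ln D\<close>, and \<open>D\<close> runs from \<open>1\<close> to \<open>E = exp (k * m)\<close>.
\<close>

lemma profile_mass: "\<bar>M\<bar> / sqrt pi * (LINT \<xi>|lborel. F0 \<xi>) = \<bar>m\<bar>"
proof (cases "E = 1")
  case True
  have k: "k \<noteq> 0" using b c by (simp add: k_def)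
  then have "M = 0" "m = 0"
    using True E_eq by (auto simp: E_def)
  then show ?thesis by simp
next
  case False
  have k: "k \<noteq> 0" using b c by (simp add: k_def)
  let ?e = "\<lambda>q::real. exp (- q\<^sup>2)"
  have e: "integrable lborel ?e"
    using integrable_gauss[of 1] by simp
  define A where "A \<xi> = - (sqrt pi / (1 - E)) * ln (D \<xi>)" for \<xi>
  have D_deriv: "(D has_real_derivative - (1 - E) * (exp (- \<xi>\<^sup>2) / sqrt pi)) (at \<xi>)" for \<xi>
    unfolding D_eq_erf[abs_def]
    using DERIV_diff[OF DERIV_const[of "(1 + E) / 2"]
        DERIV_cmult[OF erf_has_real_derivative[of \<xi>], of "1 - E"]]
    by (simp only: diff_0 mult_minus_left)
  have A_deriv: "(A has_real_derivative F0 \<xi>) (at \<xi>)" for \<xi>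
  proof -
    have "(A has_real_derivative - (sqrt pi / (1 - E)) * (1 / D \<xi> * (- (1 - E) * (exp (- \<xi>\<^sup>2) / sqrt pi)))) (at \<xi>)"
      unfolding A_def[abs_def] by (intro DERIV_cmult DERIV_chain2[OF DERIV_ln_divide D_deriv] D_pos)
    also have "- (sqrt pi / (1 - E)) * (1 / D \<xi> * (- (1 - E) * (exp (- \<xi>\<^sup>2) / sqrt pi))) = F0 \<xi>"
      using False D_pos[of \<xi>] by (simp add: F0_def field_simps)
    finally show ?thesis .
  qed
  have D_cont: "isCont D \<xi>" for \<xi>
    using D_deriv DERIV_isCont by blast
  have "(D \<longlongrightarrow> 1 - (1 - E) * (0 / sqrt pi)) at_bot"
    unfolding D_eq_primitive[abs_def] by (intro tendsto_intros primitive_at_bot[OF e]) auto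
  then have "(A \<longlongrightarrow> - (sqrt pi / (1 - E)) * ln 1) at_bot"
    unfolding A_def[abs_def] by (intro tendsto_intros) auto
  then have A_bot: "(A \<longlongrightarrow> 0) at_bot" by simp
  have "(D \<longlongrightarrow> 1 - (1 - E) * ((LINT q|lborel. ?e q) / sqrt pi)) at_top"
    unfolding D_eq_primitive[abs_def] by (intro tendsto_intros primitive_at_top[OF e]) auto
  then have "(D \<longlongrightarrow> E) at_top"
    using integral_gauss[of 1] by simp
  then have A_top: "(A \<longlongrightarrow> - (sqrt pi / (1 - E)) * ln E) at_top"
    unfolding A_def[abs_def] by (intro tendsto_intros) (auto simp: E_def)
  have "(LBINT \<xi>=-\<infinity>..\<infinity>. F0 \<xi>) = - (sqrt pi / (1 - E)) * ln E - 0"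
  proof (rule interval_integral_FTC_nonneg(2))
    show "isCont F0 \<xi>" for \<xi>
      unfolding F0_def[abs_def] using D_pos[of \<xi>]
      by (intro continuous_intros D_cont) auto
    show "((A \<circ> real_of_ereal) \<longlongrightarrow> 0) (at_right (- \<infinity>))"
      unfolding ereal_tendsto_simps by (rule A_bot)
    show "((A \<circ> real_of_ereal) \<longlongrightarrow> - (sqrt pi / (1 - E)) * ln E) (at_left \<infinity>)"
      unfolding ereal_tendsto_simps by (rule A_top)
  qed (use A_deriv F0_nonneg in auto)
  then have I: "(LINT \<xi>|lborel. F0 \<xi>) = - (sqrt pi / (1 - E)) * (k * m)"
    by (simp add: interval_lebesgue_integral_def set_lebesgue_integral_def E_def)
  have "M / sqrt pi * (LINT \<xi>|lborel. F0 \<xi>) = m"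
    unfolding I using E_eq False k by (simp add: field_simps)
  moreover have "0 \<le> (LINT \<xi>|lborel. F0 \<xi>)"
    by (simp add: F0_nonneg)
  ultimately show ?thesis
    by (metis abs_divide abs_mult abs_of_nonneg pi_ge_zero real_sqrt_ge_zero)
qed

lemma hopf_cole_self_similar:
  assumes t: "t > 0" and s: "s = sqrt (4 * c * t)"
  shows "hopf_cole b c u0 x t = G s (x / s) / s"
  using t c by (simp add: hopf_cole_eq s[symmetric] G_def) (simp add: s)

text \<open>
  Substituting \<open>x = s * \<xi>\<close> gives \<open>\<parallel>u\<parallel>\<^sub>p = s powr (1 / p - 1) * \<parallel>G s\<parallel>\<^sub>p\<close>, and \<open>s\<close> is \<open>sqrt (4 * c)\<close> times \<open>sqrt t\<close>.
\<close>

lemma Lp_norm_limit: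
  assumes u: "\<And>x t. t > 0 \<Longrightarrow> u x t = hopf_cole b c u0 x t" and p: "p \<ge> 1"
  shows "((\<lambda>t. ennreal (t powr (1 / 2 * (1 - 1 / p))) * Lp_norm p (\<lambda>x. u x t))
    \<longlongrightarrow> ennreal (\<bar>M\<bar> / sqrt pi * (4 * c) powr (- (1 / 2 * (1 - 1 / p)))) * Lp_norm p F0) at_top"
proof -
  define \<alpha> where "\<alpha> = 1 / 2 * (1 - 1 / p)"
  define J where "J s = (LINT \<xi>|lborel. \<bar>G s \<xi>\<bar> powr p)" for s
  define J0 where "J0 = (LINT \<xi>|lborel. \<bar>G_lim \<xi>\<bar> powr p)"
  have J: "(J \<longlongrightarrow> J0) at_top"
    unfolding J_def J0_def
    by (rule Lp_integral_tendsto[OF G_tendsto(1) G_bound G_limit_integrable G_limit_bound G_tendsto(2) p])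
  have J_nonneg: "0 \<le> J s" for s
    by (simp add: J_def)
  have "filterlim (\<lambda>t. sqrt (4 * c * t)) at_top at_top"
    using c by real_asymp
  note J' = filterlim_compose[OF J this]
  have "((\<lambda>t. (4 * c) powr (- \<alpha>) * J (sqrt (4 * c * t)) powr (1 / p)) \<longlongrightarrow> (4 * c) powr (- \<alpha>) * J0 powr (1 / p)) at_top"
    using p J_nonneg by (intro tendsto_mult_left tendsto_powr'[OF J' tendsto_const]) auto
  then have lim: "((\<lambda>t. ennreal ((4 * c) powr (- \<alpha>) * J (sqrt (4 * c * t)) powr (1 / p)))
      \<longlongrightarrow> ennreal ((4 * c) powr (- \<alpha>) * J0 powr (1 / p))) at_top"
    by (rule tendsto_ennrealI)
  have ev: "\<forall>\<^sub>F t in at_top. ennreal ((4 * c) powr (- \<alpha>) * J (sqrt (4 * c * t)) powr (1 / p))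
      = ennreal (t powr \<alpha>) * Lp_norm p (\<lambda>x. u x t)"
    using eventually_gt_at_top[of 0]
  proof eventually_elim
    case (elim t)
    define s where "s = sqrt (4 * c * t)"
    have s: "s > 0" using elim c by (simp add: s_def)
    have ux: "u x t = G s (x / s) / s" for x
      using u[OF elim] hopf_cole_self_similar[OF elim s_def] by simp
    have up: "\<bar>u x t\<bar> powr p = s powr (- p) * \<bar>G s (x / s)\<bar> powr p" for x
      using s by (simp add: ux abs_divide powr_divide powr_minus_divide)
    note iG = integrable_powr_bounded[OF G_tendsto(1)[OF s] G_bound[OF s] p]
    have i: "integrable lborel (\<lambda>x. \<bar>u x t\<bar> powr p)"
      unfolding up using lborel_integrable_real_affine[OF iG, of "1 / s" 0] s by simp
    have "(LINT x|lborel. \<bar>u x t\<bar> powr p) = s powr (- p) * (LINT x|lborel. \<bar>G s (x / s)\<bar> powr p)"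
      unfolding up by simp
    also have "(LINT x|lborel. \<bar>G s (x / s)\<bar> powr p) = s * J s"
      using s by (subst lborel_integral_real_affine[of s _ 0]) (auto simp: J_def)
    also have "s powr (- p) * (s * J s) = s powr (1 - p) * J s"
      using s by (simp add: powr_diff powr_minus divide_inverse mult_ac)
    finally have I: "(LINT x|lborel. \<bar>u x t\<bar> powr p) = s powr (1 - p) * J s" .
    have "Lp_norm p (\<lambda>x. u x t) = ennreal ((s powr (1 - p) * J s) powr (1 / p))"
      unfolding I[symmetric] by (rule Lp_norm_eq_integral[OF _ i]) (simp add: ux)
    also have "(s powr (1 - p) * J s) powr (1 / p) = s powr (- (2 * \<alpha>)) * J s powr (1 / p)"
      using J_nonneg[of s] p s
      by (simp add: powr_mult powr_powr \<alpha>_def diff_divide_distrib)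
    finally have L: "Lp_norm p (\<lambda>x. u x t) = ennreal (s powr (- (2 * \<alpha>)) * J s powr (1 / p))" .
    have "s powr (- (2 * \<alpha>)) = (s powr 2) powr (- \<alpha>)"
      by (simp add: powr_powr)
    also have "s powr 2 = 4 * c * t"
      using s elim c by (simp add: s_def)
    also have "(4 * c * t) powr (- \<alpha>) = (4 * c) powr (- \<alpha>) * t powr (- \<alpha>)"
      using c elim by (simp add: powr_mult)
    finally have "t powr \<alpha> * (s powr (- (2 * \<alpha>)) * J s powr (1 / p)) = (4 * c) powr (- \<alpha>) * J s powr (1 / p)"
      using elim by (simp add: powr_minus field_simps)
    then show ?case
      unfolding L s_def[symmetric] using J_nonneg[of s] by (auto simp flip: ennreal_mult)
  qed
  have "J0 = (\<bar>M\<bar> / sqrt pi) powr p * (LINT \<xi>|lborel. \<bar>F0 \<xi>\<bar> powr p)"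
  proof -
    have "\<bar>G_lim \<xi>\<bar> powr p = (\<bar>M\<bar> / sqrt pi) powr p * \<bar>F0 \<xi>\<bar> powr p" for \<xi>
      using powr_mult[of "\<bar>M\<bar> / sqrt pi" "\<bar>F0 \<xi>\<bar>" p] by (simp add: G_lim_eq abs_mult)
    then show ?thesis by (simp add: J0_def)
  qed
  then have "J0 powr (1 / p) = \<bar>M\<bar> / sqrt pi * (LINT \<xi>|lborel. \<bar>F0 \<xi>\<bar> powr p) powr (1 / p)"
    using p by (simp add: powr_mult powr_powr)
  then have "ennreal ((4 * c) powr (- \<alpha>) * J0 powr (1 / p))
      = ennreal (\<bar>M\<bar> / sqrt pi * (4 * c) powr (- \<alpha>)) * Lp_norm p F0"
    unfolding Lp_norm_eq_integral[OF F0_borel integrable_powr_bounded[OF F0_integrable F0_bound p]]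
    by (simp add: ennreal_mult[symmetric] mult_ac)
  then show ?thesis
    using Lim_transform_eventually[OF lim ev] unfolding \<alpha>_def[symmetric] by simp
qed

lemma Linf_norm_limit:
  assumes u: "\<And>x t. t > 0 \<Longrightarrow> u x t = hopf_cole b c u0 x t"
  shows "((\<lambda>t. ennreal (t powr (1 / 2)) * Linf_norm (\<lambda>x. u x t))
    \<longlongrightarrow> ennreal (\<bar>M\<bar> / sqrt (4 * pi * c)) * Linf_norm F0) at_top"
proof -
  define S where "S s = (SUP \<xi>. \<bar>G s \<xi>\<bar>)" for s
  define S0 where "S0 = (SUP \<xi>. \<bar>G_lim \<xi>\<bar>)"
  obtain \<delta> where \<delta>: "(\<delta> \<longlongrightarrow> 0) at_top" "\<And>s \<xi>. s > 0 \<Longrightarrow> \<bar>G s \<xi> - G_lim \<xi>\<bar> \<le> \<delta> s"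
    using G_tendsto(3) by blast
  have "((\<lambda>s. S s - S0) \<longlongrightarrow> 0) at_top"
  proof (rule Lim_null_comparison[OF _ \<delta>(1)])
    show "\<forall>\<^sub>F s in at_top. norm (S s - S0) \<le> \<delta> s"
      using eventually_gt_at_top[of 0]
    proof eventually_elim
      case (elim s)
      show ?case
        unfolding S_def S0_def real_norm_def
        by (rule abs_SUP_abs_diff_le[OF G_bound[OF elim] G_limit_bound \<delta>(2)[OF elim]])
    qed
  qed
  then have S: "(S \<longlongrightarrow> S0) at_top"
    by (simp only: LIM_zero_iff)
  have "filterlim (\<lambda>t. sqrt (4 * c * t)) at_top at_top"
    using c by real_asymp
  from tendsto_mult_left[OF filterlim_compose[OF S this], of "1 / sqrt (4 * c)"]
  have lim: "((\<lambda>t. ennreal (1 / sqrt (4 * c) * S (sqrt (4 * c * t)))) \<longlongrightarrow> ennreal (1 / sqrt (4 * c) * S0)) at_top"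
    by (rule tendsto_ennrealI)
  have ev: "\<forall>\<^sub>F t in at_top. ennreal (1 / sqrt (4 * c) * S (sqrt (4 * c * t)))
      = ennreal (t powr (1 / 2)) * Linf_norm (\<lambda>x. u x t)"
    using eventually_gt_at_top[of 0]
  proof eventually_elim
    case (elim t)
    define s where "s = sqrt (4 * c * t)"
    have s: "s > 0" using elim c by (simp add: s_def)
    have ux: "\<bar>u x t\<bar> = 1 / s * \<bar>G s (x / s)\<bar>" for x
      using u[OF elim] hopf_cole_self_similar[OF elim s_def] s by simp
    have Gb: "\<bar>G s (x / s)\<bar> \<le> C" for x
      by (rule G_bound[OF s])
    have "\<bar>u x t\<bar> \<le> 1 / s * C" for x
      unfolding ux using Gb s by (intro mult_left_mono) auto
    from Linf_norm_eq_SUP[OF this]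
    have "Linf_norm (\<lambda>x. u x t) = ennreal (SUP x. 1 / s * \<bar>G s (x / s)\<bar>)"
      unfolding ux .
    also have "(SUP x. 1 / s * \<bar>G s (x / s)\<bar>) = 1 / s * (SUP x. \<bar>G s (x / s)\<bar>)"
      using s by (intro SUP_abs_scale[OF Gb]) simp
    also have "range (\<lambda>x. \<bar>G s (x / s)\<bar>) = range (\<lambda>\<xi>. \<bar>G s \<xi>\<bar>)"
    proof -
      have "\<bar>G s \<xi>\<bar> = \<bar>G s ((\<xi> * s) / s)\<bar>" for \<xi>
        using s by simp
      then show ?thesis by blast
    qed
    finally have L: "Linf_norm (\<lambda>x. u x t) = ennreal (1 / s * S s)"
      by (simp add: S_def)
    have "0 \<le> S s"
      unfolding S_def
      by (rule order_trans[OF abs_ge_zero cSUP_upper[of 0 UNIV "\<lambda>\<xi>. \<bar>G s \<xi>\<bar>"]])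
         (auto intro!: bdd_aboveI[of _ C] G_bound s)
    moreover have "t powr (1 / 2) * (1 / s * S s) = 1 / sqrt (4 * c) * S s"
      using elim c by (simp add: s_def powr_half_sqrt real_sqrt_mult)
    ultimately show ?case
      unfolding L s_def[symmetric] using s by (simp flip: ennreal_mult)
  qed
  have "S0 = (SUP \<xi>. \<bar>M\<bar> / sqrt pi * \<bar>F0 \<xi>\<bar>)"
    by (simp add: S0_def G_lim_eq abs_mult)
  also have "\<dots> = \<bar>M\<bar> / sqrt pi * (SUP \<xi>. \<bar>F0 \<xi>\<bar>)"
    by (rule SUP_abs_scale[OF F0_bound]) simp
  finally have "1 / sqrt (4 * c) * S0 = \<bar>M\<bar> / sqrt (4 * pi * c) * (SUP \<xi>. \<bar>F0 \<xi>\<bar>)"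
    by (simp add: real_sqrt_mult)
  moreover have "0 \<le> (SUP \<xi>. \<bar>F0 \<xi>\<bar>)"
    by (rule order_trans[OF abs_ge_zero cSUP_upper[of 0 UNIV "\<lambda>\<xi>. \<bar>F0 \<xi>\<bar>"]])
       (auto intro!: bdd_aboveI[of _ "exp B"] F0_bound)
  ultimately have "ennreal (1 / sqrt (4 * c) * S0) = ennreal (\<bar>M\<bar> / sqrt (4 * pi * c)) * Linf_norm F0"
    unfolding Linf_norm_eq_SUP[OF F0_bound] using c by (simp flip: ennreal_mult)
  then show ?thesis
    using Lim_transform_eventually[OF lim ev] by simp
qed

text \<open>The asymptotic constants in terms of the total mass \<open>m\<close>.\<close>

lemma Lp_constant:
  assumes "p \<ge> 1"
  shows "\<bar>M\<bar> / sqrt pi * (4 * c) powr (- (1 / 2 * (1 - 1 / p)))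
    = \<bar>m\<bar> / sqrt (4 * pi * c) * (4 * c) powr (1 / (2 * p)) * \<bar>mass_factor b c m\<bar>"
proof -
  have "- (1 / 2 * (1 - 1 / p)) = 1 / (2 * p) - 1 / 2"
    using assms by (simp add: field_simps)
  then have "(4 * c) powr (- (1 / 2 * (1 - 1 / p))) = (4 * c) powr (1 / (2 * p)) / sqrt (4 * c)"
    using c by (simp only: powr_diff powr_half_sqrt)
  then show ?thesis
    unfolding mass_factor_eq[symmetric] by (simp add: abs_mult real_sqrt_mult mult_ac)
qed

theorem hopf_cole_asymptotics:
  assumes u: "\<And>x t. t > 0 \<Longrightarrow> u x t = hopf_cole b c u0 x t"
    and F: "F = burgers_profile b c m"
  shows "((\<lambda>t. Lp_norm 1 (\<lambda>x. u x t)) \<longlongrightarrow> ennreal \<bar>m\<bar>) at_top"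
    and "\<And>p. p \<ge> 1 \<Longrightarrow> ((\<lambda>t. ennreal (t powr (1 / 2 * (1 - 1 / p))) * Lp_norm p (\<lambda>x. u x t))
           \<longlongrightarrow> ennreal (\<bar>m\<bar> / sqrt (4 * pi * c) * (4 * c) powr (1 / (2 * p)) * \<bar>mass_factor b c m\<bar>)
               * Lp_norm p F) at_top"
    and "((\<lambda>t. ennreal (t powr (1 / 2)) * Linf_norm (\<lambda>x. u x t))
           \<longlongrightarrow> ennreal (\<bar>m\<bar> / sqrt (4 * pi * c) * \<bar>mass_factor b c m\<bar>) * Linf_norm F) at_top"
proof -
  show "((\<lambda>t. ennreal (t powr (1 / 2 * (1 - 1 / p))) * Lp_norm p (\<lambda>x. u x t))
           \<longlongrightarrow> ennreal (\<bar>m\<bar> / sqrt (4 * pi * c) * (4 * c) powr (1 / (2 * p)) * \<bar>mass_factor b c m\<bar>)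
               * Lp_norm p F) at_top" if "p \<ge> 1" for p
    using Lp_norm_limit[OF u that] unfolding Lp_constant[OF that] F Lp_norm_profile .
  show "((\<lambda>t. ennreal (t powr (1 / 2)) * Linf_norm (\<lambda>x. u x t))
           \<longlongrightarrow> ennreal (\<bar>m\<bar> / sqrt (4 * pi * c) * \<bar>mass_factor b c m\<bar>) * Linf_norm F) at_top"
    using Linf_norm_limit[OF u] unfolding F Linf_norm_profile mass_factor_eq[symmetric]
    by (simp add: abs_mult)
  have "ennreal (\<bar>M\<bar> / sqrt pi * (4 * c) powr (- (1 / 2 * (1 - 1 / 1)))) * Lp_norm 1 F0 = ennreal \<bar>m\<bar>"
    unfolding L1_norm_eq_integral[OF F0_borel F0_integrable] profile_mass[symmetric]
    using c F0_nonneg by (simp flip: ennreal_mult)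
  then have "((\<lambda>t. ennreal (t powr (1 / 2 * (1 - 1 / 1))) * Lp_norm 1 (\<lambda>x. u x t)) \<longlongrightarrow> ennreal \<bar>m\<bar>) at_top"
    using Lp_norm_limit[OF u, of 1] by simp
  moreover have "\<forall>\<^sub>F t in at_top. ennreal (t powr (1 / 2 * (1 - 1 / 1))) * Lp_norm 1 (\<lambda>x. u x t) = Lp_norm 1 (\<lambda>x. u x t)"
    using eventually_gt_at_top[of 0] by eventually_elim simp
  ultimately show "((\<lambda>t. Lp_norm 1 (\<lambda>x. u x t)) \<longlongrightarrow> ennreal \<bar>m\<bar>) at_top"
    by (rule Lim_transform_eventually)
qed

end

section \<open>The asymptotic theorem\<close>

lemma heat_conv_cong_AE:
  assumes "AE y in lebesgue. f y = g y"
    and "f \<in> borel_measurable lebesgue" "g \<in> borel_measurable lebesgue"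
  shows "heat_conv c f x t = heat_conv c g x t"
proof -
  have [measurable]: "(\<lambda>y. exp (- ((x - y)\<^sup>2 / (4 * c * t)))) \<in> borel_measurable lebesgue"
    by (rule measurable_completion) simp
  have "(LINT y|lebesgue. exp (- ((x - y)\<^sup>2 / (4 * c * t))) * f y)
      = (LINT y|lebesgue. exp (- ((x - y)\<^sup>2 / (4 * c * t))) * g y)"
    using assms by (intro integral_cong_AE) auto
  then show ?thesis
    by (simp add: heat_conv_def)
qed

theorem theorem2:
  fixes b c m :: real and u0 :: "real \<Rightarrow> real" and u :: "real \<Rightarrow> real \<Rightarrow> real"
    and F :: "real \<Rightarrow> real"
  assumes "b \<noteq> 0" and "c > 0"
    and "integrable lebesgue u0"
    and "m = (LINT x|lebesgue. u0 x)"
    and "\<And>x t. t > 0 \<Longrightarrow> u x t = hopf_cole b c u0 x t"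
    and "F = burgers_profile b c m"
  shows "burgers_equation b c u \<and> initial_value_L1 u0 u
    \<and> integrable lebesgue F \<and> bounded (range F)
    \<and> ((\<lambda>t. Lp_norm 1 (\<lambda>x. u x t)) \<longlongrightarrow> ennreal \<bar>m\<bar>) at_top
    \<and> (\<forall>p\<ge>1. ((\<lambda>t. ennreal (t powr (1 / 2 * (1 - 1 / p))) * Lp_norm p (\<lambda>x. u x t))
           \<longlongrightarrow> ennreal (\<bar>m\<bar> / sqrt (4 * pi * c) * (4 * c) powr (1 / (2 * p)) * \<bar>mass_factor b c m\<bar>)
               * Lp_norm p F) at_top)
    \<and> ((\<lambda>t. ennreal (t powr (1 / 2)) * Linf_norm (\<lambda>x. u x t))
           \<longlongrightarrow> ennreal (\<bar>m\<bar> / sqrt (4 * pi * c) * \<bar>mass_factor b c m\<bar>) * Linf_norm F) at_top"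
proof -
  have u0_meas: "u0 \<in> borel_measurable lebesgue"
    using assms(3) by auto
  \<comment> \<open>A Borel measurable version of \<open>u0\<close> yields the same function \<open>u\<close>, the same mass and the same
    distance from the initial value.\<close>
  then obtain v where v [measurable]: "v \<in> borel_measurable borel" and uv: "AE x in lborel. u0 x = v x"
    using completion_ex_borel_measurable_real[of u0 lborel] by auto
  have v_leb: "v \<in> borel_measurable lebesgue"
    by (rule measurable_completion) simp
  have uv': "AE x in lebesgue. u0 x = v x"
    using uv by (rule AE_completion)
  have "integrable lebesgue v"
    using assms(3) integrable_cong_AE[OF u0_meas v_leb uv'] by simp
  then have iv: "integrable lborel v"
    using integrable_completion[of v lborel] by simp
  interpret hopf_cole_data b c v
    by unfold_locales (use assms(1,2) iv in auto)
  have m_eq: "m = hopf_cole_data.m v"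
  proof -
    have "(LINT x|lebesgue. u0 x) = (LINT x|lebesgue. v x)"
      by (rule integral_cong_AE[OF u0_meas v_leb uv'])
    then show ?thesis
      using assms(4) integral_completion[of v lborel] by (simp add: m_def)
  qed
  have phi: "phi0 b c u0 = phi0 b c v"
  proof
    fix x
    have "(LINT \<xi>:{..x}|lebesgue. u0 \<xi>) = (LINT \<xi>:{..x}|lebesgue. v \<xi>)"
      using u0_meas v_leb uv' by (intro set_lebesgue_integral_cong_AE) auto
    then show "phi0 b c u0 x = phi0 b c v x"
      by (simp add: phi0_def)
  qed
  have phi_meas: "phi0 b c v \<in> borel_measurable lebesgue"
    unfolding phi0_eq by (rule measurable_completion) simp
  have u: "u x t = hopf_cole b c v x t" if "t > 0" for x t
  proof -
    have "heat_conv c (\<lambda>y. phi0 b c v y * u0 y) x t = heat_conv c (\<lambda>y. phi0 b c v y * v y) x t"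
      using uv' u0_meas v_leb phi_meas by (intro heat_conv_cong_AE) auto
    then show ?thesis
      using assms(5)[OF that] by (simp add: hopf_cole_def phi)
  qed
  have "Lp_norm 1 (\<lambda>x. u x t - u0 x) = Lp_norm 1 (\<lambda>x. u x t - v x)" for t
  proof -
    have "(\<integral>\<^sup>+x. ennreal (\<bar>u x t - u0 x\<bar> powr 1) \<partial>lebesgue) = (\<integral>\<^sup>+x. ennreal (\<bar>u x t - v x\<bar> powr 1) \<partial>lebesgue)"
      using uv' by (intro nn_integral_cong_AE) auto
    then show ?thesis
      by (simp only: Lp_norm_def)
  qed
  then have init: "initial_value_L1 u0 u"
    using initial_value_hopf_cole[OF u] by (simp add: initial_value_L1_def)
  have F: "F = burgers_profile b c (hopf_cole_data.m v)"
    using assms(6) m_eq by simp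
  have "integrable lebesgue F"
    unfolding F using burgers_profile_integrable
    by (subst integrable_completion) auto
  moreover have "bounded (range F)"
    unfolding F bounded_iff using burgers_profile_bound by auto
  ultimately show ?thesis
    using burgers_equation_hopf_cole[OF u] init hopf_cole_asymptotics[OF u F] unfolding m_eq by blast
qed

end
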